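(* Let $N\ge1$, $s\in(0,1)$, $\beta>-1$, and let $g:\mathbb{R}\to[0,\infty)$ be nondecreasing and locally Lipschitz continuous, with $g(r)r\ge0$ for all $r$ and $$\mathcal G(r):=\int_r^\infty\frac{d\sigma}{g(\sigma)}<+\infty\qquad\text{for }r>0.$$ Let $U(t)=\mathcal G^{-1}\big(\frac{t^{\beta+1}}{\beta+1}\big)$ for $t>0$. Let $u$ be a nonnegative classical solution of $$\partial_tu+(-\Delta)^su+t^\beta g(u)=0\quad\text{in }Q_\infty=(0,\infty)\times\mathbb{R}^N$$ belonging to $L^1_{loc}(0,\infty;\mathcal L^s(\mathbb{R}^N))$. Then either $$u(t,x)<U(t)\quad\text{for all }(t,x)\in Q_\infty,$$ or $$u(t,x)=U(t)\quad\text{for all }(t,x)\in Q_\infty.$$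
   Context: The fractional Laplacian is $(-\Delta)^s\phi(x)=\lim_{\varepsilon\to0^+}a_{N,s}\int_{|z-x|>\varepsilon}\frac{\phi(x)-\phi(z)}{|z-x|^{N+2s}}dz$, with $a_{N,s}=\frac{\Gamma(\frac N2+s)}{\pi^{N/2}\Gamma(2-s)}s(1-s)$. $\mathcal L^s(\mathbb{R}^N)$ is the space of $\phi\in L^1_{loc}(\mathbb{R}^N)$ with $\int_{\mathbb{R}^N}\frac{|\phi(x)|}{1+|x|^{N+2s}}dx<+\infty$. Solutions are understood in the classical (pointwise) sense, and it is always assumed that $u(t,\cdot)\in\mathcal L^s(\mathbb{R}^N)$ for every $t>0$. $L^1_{loc}(0,\infty;X)$ means integrable on compact subintervals of the open interval $(0,\infty)$ with values in $X$. $\mathcal G^{-1}$ denotes the inverse function of $\mathcal G$; $U$ is the maximal solution of $U'+t^\beta g(U)=0$ on $(0,\infty)$ with $U(0)=+\infty$. *)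

theory Defs
  imports "HOL-Analysis.Analysis"
begin

text \<open>The space \<open>\<real>\<^sup>N\<close> is \<^typ>\<open>real ^ 'n\<close> with \<open>N = CARD('n)\<close>.\<close>

definition frac_const :: "nat \<Rightarrow> real \<Rightarrow> real" where
  "frac_const N s =
     Gamma (real N / 2 + s) / (pi powr (real N / 2) * Gamma (2 - s)) * s * (1 - s)"

definition frac_kernel_diff :: "real \<Rightarrow> (real ^ 'n \<Rightarrow> real) \<Rightarrow> real ^ 'n \<Rightarrow> real ^ 'n \<Rightarrow> real" where
  "frac_kernel_diff s \<phi> x z = (\<phi> x - \<phi> z) / norm (z - x) powr (real CARD('n) + 2 * s)"

text \<open>\<open>has_frac_laplacian s \<phi> x l\<close>: the principal value defining \<open>(- \<Delta>)\<^sup>s \<phi>\<close> at \<open>x\<close> exists and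
  equals \<open>l\<close>. The Bochner integral of a non-integrable function is 0 by convention, so the
  existence of the truncated integrals is required explicitly; it is automatic for \<open>\<phi>\<close> in
  \<open>frac_space s\<close> below.\<close>

definition has_frac_laplacian ::
    "real \<Rightarrow> (real ^ 'n \<Rightarrow> real) \<Rightarrow> real ^ 'n \<Rightarrow> real \<Rightarrow> bool" where
  "has_frac_laplacian s \<phi> x l \<longleftrightarrow>
     (\<forall>\<epsilon>>0. set_integrable lebesgue {z. norm (z - x) > \<epsilon>} (frac_kernel_diff s \<phi> x)) \<and>
     ((\<lambda>\<epsilon>. frac_const CARD('n) s *
            (LINT z:{z. norm (z - x) > \<epsilon>}|lebesgue. frac_kernel_diff s \<phi> x z)) \<longlongrightarrow> l)
       (at_right 0)"

definition frac_weighted :: "real \<Rightarrow> (real ^ 'n \<Rightarrow> real) \<Rightarrow> real ^ 'n \<Rightarrow> real" where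
  "frac_weighted s \<phi> x = \<bar>\<phi> x\<bar> / (1 + norm x powr (real CARD('n) + 2 * s))"

definition frac_space :: "real \<Rightarrow> (real ^ 'n \<Rightarrow> real) set" where
  "frac_space s = {\<phi>. (\<forall>K. compact K \<longrightarrow> \<phi> absolutely_integrable_on K) \<and>
                       integrable lebesgue (frac_weighted s \<phi>)}"

definition frac_space_norm :: "real \<Rightarrow> (real ^ 'n \<Rightarrow> real) \<Rightarrow> real" where
  "frac_space_norm s \<phi> = (LINT x|lebesgue. frac_weighted s \<phi> x)"

text \<open>\<open>L\<^sup>1\<^sub>l\<^sub>o\<^sub>c(0,\<infinity>; frac_space s)\<close>: since \<open>frac_space s\<close> is a weighted \<open>L\<^sup>1\<close> space, (strong) measurability
  of \<open>t \<mapsto> u t\<close> is expressed as joint measurability of \<open>(t, x) \<mapsto> u t x\<close>.\<close>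

definition L1_loc_frac_space :: "real \<Rightarrow> (real \<Rightarrow> real ^ 'n \<Rightarrow> real) \<Rightarrow> bool" where
  "L1_loc_frac_space s u \<longleftrightarrow>
     set_borel_measurable lebesgue ({0<..} \<times> UNIV) (\<lambda>(t, x). u t x) \<and>
     (\<forall>t>0. u t \<in> frac_space s) \<and>
     (\<forall>a b. 0 < a \<and> a \<le> b \<longrightarrow> set_integrable lebesgue {a..b} (\<lambda>t. frac_space_norm s (u t)))"

text \<open>Classical solutions of \<open>\<partial>\<^sub>t u + (- \<Delta>)\<^sup>s u + t\<^sup>\<beta> g(u) = 0\<close> in \<open>(0,\<infinity>) \<times> \<real>\<^sup>N\<close>: \<open>u\<close> is continuous,
  \<open>\<partial>\<^sub>t u\<close> and \<open>(- \<Delta>)\<^sup>s u\<close> exist at every point, and the equation holds there. The values of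
  \<open>u t\<close> for \<open>t \<le> 0\<close> are irrelevant.\<close>

definition classical_solution ::
    "real \<Rightarrow> real \<Rightarrow> (real \<Rightarrow> real) \<Rightarrow> (real \<Rightarrow> real ^ 'n \<Rightarrow> real) \<Rightarrow> bool" where
  "classical_solution s \<beta> g u \<longleftrightarrow>
     continuous_on ({0<..} \<times> UNIV) (\<lambda>(t, x). u t x) \<and>
     (\<forall>t>0. u t \<in> frac_space s) \<and>
     (\<forall>t>0. \<forall>x. \<exists>D L. ((\<lambda>\<tau>. u \<tau> x) has_real_derivative D) (at t) \<and>
                     has_frac_laplacian s (u t) x L \<and>
                     D + L + t powr \<beta> * g (u t x) = 0)"

text \<open>The integral \<open>\<integral>\<^sub>r\<^sup>\<infinity> d\<sigma> / g(\<sigma>)\<close> is taken in \<^typ>\<open>ennreal\<close>, where \<open>1 / 0 = \<infinity>\<close>; its finiteness for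
  all \<open>r > 0\<close> therefore includes \<open>g > 0\<close> on \<open>(0,\<infinity>)\<close>.\<close>

definition recip_tail :: "(real \<Rightarrow> real) \<Rightarrow> real \<Rightarrow> ennreal" where
  "recip_tail g r = (\<integral>\<^sup>+\<sigma>\<in>{r<..}. 1 / ennreal (g \<sigma>) \<partial>lborel)"

text \<open>\<open>flat_sol g \<beta> t = \<G>\<^sup>-\<^sup>1(t\<^sup>\<beta>\<^sup>+\<^sup>1 / (\<beta> + 1))\<close> with \<open>\<G> = recip_tail g\<close>. For \<open>g\<close> locally Lipschitz
  and nondecreasing with \<open>g 0 = 0\<close> and \<open>\<G>\<close> finite on \<open>(0,\<infinity>)\<close>, \<open>\<G>\<close> is a bijection of \<open>(0,\<infinity>)\<close>
  onto itself.\<close>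

definition flat_sol :: "(real \<Rightarrow> real) \<Rightarrow> real \<Rightarrow> real \<Rightarrow> real" where
  "flat_sol g \<beta> t =
     the_inv_into {0<..} (recip_tail g) (ennreal (t powr (\<beta> + 1) / (\<beta> + 1)))"

end

theory Submission
  imports Defs
begin

text \<open>
  The flat solutions \<open>U\<^sub>a\<close> that blow up at time \<open>a > 0\<close> dominate \<open>u\<close>, and \<open>U\<^sub>a \<rightarrow> U\<close> as \<open>a \<rightarrow> 0\<close>. For the
  comparison, \<open>w = u - U\<^sub>a\<close> satisfies \<open>\<partial>\<^sub>t w + (- \<Delta>)\<^sup>s w \<le> 0\<close> where it is positive, but only pointwise, and
  nothing is known about its regularity beyond continuity. After subtracting a time integral that
  absorbs the contribution of the nonlocal tail outside a large ball, a sup-convolution of the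
  positive part is semiconvex and still a pointwise subsolution; semiconvexity bounds its truncated
  fractional Laplacians from one side, so that one may integrate against a test function and move
  the operator onto it. For weights of order \<open>\<bar>x\<bar>\<^sup>-\<^sup>N\<^sup>-\<^sup>2\<^sup>s\<close> the result is
  bounded by a multiple of the weight itself, and this yields a Gronwall inequality for the weighted mass of the
  positive part of \<open>w\<close>, which therefore vanishes.

  If \<open>u\<close> touches \<open>U\<close> at some point, the equation forces \<open>(- \<Delta>)\<^sup>s u = 0\<close> there, so \<open>u = U\<close> at that time. The equality
  persists at later times by the same comparison applied to \<open>U - u\<close>, and at earlier times because
  a positive gap \<open>U - u\<close> is bounded below by an exponentially decaying multiple of a bump function.
\<close>

section \<open>The flat solution\<close>

text \<open>Two obstacles shape the comparison. The principal value is a mere pointwise limit,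
  without a bound that would survive integration, and nothing restrains \<open>u\<close> at infinity
  beyond a weighted integral, so no maximum need be attained. The weight
  \<open>decay (p / 2)\<close> with \<open>p = N + 2 s\<close> meets the second: it decays like the
  kernel, so it is the natural weight of the function space, and seen from a fixed ball it bounds
  the kernel, which turns the far field into a tail of the mass. Sup-convolution meets the first,
  but it lives on a compact cylinder; compactly supported test functions keep the relevant
  maximizers inside, and the full weight appears only as the supports grow. The blow-up time
  \<open>a\<close> is positive because \<open>u\<close> is bounded on compact sets near time
  \<open>a\<close>, whereas its behaviour as \<open>t\<close> tends to \<open>0\<close> is unknown.
  The barrier for earlier times must vanish outside a ball and yet have an operator value controlled
  by the barrier itself up to the boundary; this rests on the positive contribution of long jumps
  into the ball.\<close>

locale absorption =
  fixes g :: "real \<Rightarrow> real"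
  assumes g_nonneg: "\<And>r. g r \<ge> 0"
    and g_mono: "mono g"
    and g_lip: "\<And>r. \<exists>d>0. \<exists>L. L-lipschitz_on (cball r d) g"
    and g_sign: "\<And>r. g r * r \<ge> 0"
    and recip_tail_finite: "\<And>r. r > 0 \<Longrightarrow> recip_tail g r < \<infinity>"
begin

lemma g_isCont: "isCont g r"
proof -
  obtain d L where d: "d > 0" "L-lipschitz_on (cball r d) g" using g_lip by blast
  then have "continuous_on (cball r d) g" by (blast intro: lipschitz_on_continuous_on)
  then have "continuous_on (ball r d) g" using ball_subset_cball continuous_on_subset by blast
  with d(1) show ?thesis by (simp add: continuous_on_eq_continuous_at)
qed

lemma g_cont: "continuous_on A g"
  by (simp add: continuous_at_imp_continuous_on g_isCont)

text \<open>The sign condition and \<open>g \<ge> 0\<close> make \<open>g\<close> vanish on the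
  negative half-line; continuity carries this to \<open>0\<close>.\<close>

lemma g_zero: "g 0 = 0"
proof -
  have "g r = 0" if "r < 0" for r
    using g_sign[of r] g_nonneg[of r] that by (simp add: mult_less_0_iff zero_le_mult_iff)
  then have "(g \<longlongrightarrow> 0) (at_left 0)"
    by (intro tendsto_eventually) (auto simp: eventually_at_left_field intro: exI[of _ "-1"])
  moreover have "(g \<longlongrightarrow> g 0) (at_left 0)"
    using g_isCont[of 0] by (simp add: isCont_def filterlim_at_split)
  ultimately show ?thesis using tendsto_unique trivial_limit_at_left_real by blast
qed

lemma g_measurable [measurable]: "g \<in> borel_measurable borel"
  by (intro borel_measurable_continuous_onI g_cont)

lemma recip_tail_split:
  assumes "r \<le> r'"
  shows "recip_tail g r = (\<integral>\<^sup>+\<sigma>\<in>{r<..r'}. 1 / ennreal (g \<sigma>) \<partial>lborel) + recip_tail g r'"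
proof -
  have "recip_tail g r
      = (\<integral>\<^sup>+\<sigma>. (1 / ennreal (g \<sigma>)) * indicator {r<..r'} \<sigma> + (1 / ennreal (g \<sigma>)) * indicator {r'<..} \<sigma> \<partial>lborel)"
    unfolding recip_tail_def by (intro nn_integral_cong) (use assms in \<open>auto simp: indicator_def\<close>)
  also have "\<dots> = (\<integral>\<^sup>+\<sigma>\<in>{r<..r'}. 1 / ennreal (g \<sigma>) \<partial>lborel) + recip_tail g r'"
    unfolding recip_tail_def by (intro nn_integral_add) simp_all
  finally show ?thesis .
qed

text \<open>A zero at \<open>r\<close> would spread by monotonicity to all of
  \<open>(r/2, r]\<close>, where the integrand \<open>1 / 0\<close> is infinite on a set of positive
  length, against finiteness of the tail integral at \<open>r/2\<close>.\<close>

lemma g_pos: "g r > 0" if "r > 0"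
proof (rule ccontr)
  assume "\<not> g r > 0"
  then have "g r = 0" using g_nonneg[of r] by simp
  then have z: "g x = 0" if "x \<le> r" for x
    using monoD[OF g_mono that] g_nonneg[of x] \<open>g r = 0\<close> by simp
  have "(\<integral>\<^sup>+\<sigma>\<in>{r/2<..r}. 1 / ennreal (g \<sigma>) \<partial>lborel) = (\<integral>\<^sup>+\<sigma>\<in>{r/2<..r}. top \<partial>lborel)"
    by (intro nn_integral_cong) (auto simp: z indicator_def)
  also have "\<dots> = top" using \<open>r > 0\<close>
    by (subst nn_integral_cmult_indicator) (simp_all add: ennreal_top_mult)
  finally have "recip_tail g (r/2) = top"
    using recip_tail_split[of "r/2" r] \<open>r > 0\<close> by simp
  then show False using recip_tail_finite[of "r/2"] \<open>r > 0\<close> by simp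
qed

section \<open>The tail integral as a decreasing bijection of the positive half-line, and its
  inverse\<close>

definition rtail :: "real \<Rightarrow> real" where "rtail r = enn2real (recip_tail g r)"

lemma recip_tail_eq: "r > 0 \<Longrightarrow> recip_tail g r = ennreal (rtail r)"
  using recip_tail_finite unfolding rtail_def by (simp add: less_top)

text \<open>Since \<open>g\<close> is nondecreasing, the integrand on \<open>(r, r']\<close> lies
  between \<open>1 / g r'\<close> and \<open>1 / g r\<close>. These bounds play the part of the
  fundamental theorem of calculus: strict monotonicity, continuity and the derivative of the inverse
  are all read off from them.\<close>

lemma rtail_diff:
  assumes "0 < r" "r \<le> r'"
  shows "(r' - r) / g r' \<le> rtail r - rtail r'" "rtail r - rtail r' \<le> (r' - r) / g r"
proof -
  let ?I = "\<integral>\<^sup>+\<sigma>\<in>{r<..r'}. 1 / ennreal (g \<sigma>) \<partial>lborel"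
  have pos: "g r > 0" "g r' > 0" using g_pos assms by auto
  have inv: "1 / ennreal (g \<sigma>) = ennreal (1 / g \<sigma>)" if "\<sigma> > 0" for \<sigma>
    using g_pos[OF that] by (metis divide_ennreal ennreal_1 zero_le_one)
  have "?I \<le> (\<integral>\<^sup>+\<sigma>\<in>{r<..r'}. ennreal (1 / g r) \<partial>lborel)"
  proof (intro nn_integral_mono)
    fix \<sigma>
    show "1 / ennreal (g \<sigma>) * indicator {r<..r'} \<sigma> \<le> ennreal (1 / g r) * indicator {r<..r'} \<sigma>"
      using inv[of \<sigma>] assms(1) monoD[OF g_mono, of r \<sigma>] pos
      by (auto simp: indicator_def intro!: ennreal_leI divide_left_mono g_pos)
  qed
  also have "\<dots> = ennreal ((r' - r) / g r)"
    using assms pos by (simp add: nn_integral_cmult_indicator flip: ennreal_mult)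
  finally have up: "?I \<le> ennreal ((r' - r) / g r)" .
  have "ennreal ((r' - r) / g r') = (\<integral>\<^sup>+\<sigma>\<in>{r<..r'}. ennreal (1 / g r') \<partial>lborel)"
    using assms pos by (simp add: nn_integral_cmult_indicator flip: ennreal_mult)
  also have "\<dots> \<le> ?I"
  proof (intro nn_integral_mono)
    fix \<sigma>
    show "ennreal (1 / g r') * indicator {r<..r'} \<sigma> \<le> 1 / ennreal (g \<sigma>) * indicator {r<..r'} \<sigma>"
      using inv[of \<sigma>] assms(1) monoD[OF g_mono, of \<sigma> r'] g_pos[of \<sigma>] pos
      by (auto simp: indicator_def intro!: ennreal_leI divide_left_mono)
  qed
  finally have lo: "ennreal ((r' - r) / g r') \<le> ?I" .
  have "?I < \<infinity>" using up by (simp add: le_less_trans[OF _ ennreal_less_top])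
  then obtain I where I: "I \<ge> 0" "?I = ennreal I" by (cases ?I) auto
  have nn: "0 \<le> rtail r" "0 \<le> rtail r'" by (auto simp: rtail_def)
  have "ennreal (rtail r) = ennreal I + ennreal (rtail r')"
    using recip_tail_split[OF assms(2)] recip_tail_eq[of r] recip_tail_eq[of r'] assms I(2) by simp
  then have "rtail r = I + rtail r'"
    using I(1) nn by (simp flip: ennreal_plus)
  moreover have "(r' - r) / g r' \<le> I" using lo I assms pos by (simp add: ennreal_le_iff)
  moreover have "I \<le> (r' - r) / g r"
  proof -
    have "0 \<le> (r' - r) / g r" using assms pos by simp
    then show ?thesis using up I(2) by (simp add: ennreal_le_iff)
  qed
  ultimately show "(r' - r) / g r' \<le> rtail r - rtail r'" "rtail r - rtail r' \<le> (r' - r) / g r"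
    by linarith+
qed

lemma rtail_strict: "0 < r \<Longrightarrow> r < r' \<Longrightarrow> rtail r' < rtail r"
  using rtail_diff(1)[of r r'] g_pos[of r'] by (smt (verit) divide_pos_pos)

lemma rtail_isCont: "isCont rtail r" if "r > 0"
proof -
  let ?C = "1 / g (r/2)"
  have C: "?C > 0" using g_pos that by simp
  have *: "rtail a - rtail b \<le> (b - a) * ?C \<and> 0 \<le> rtail a - rtail b" if "r/2 < a" "a \<le> b" for a b
  proof -
    have "rtail a - rtail b \<le> (b - a) / g a" using rtail_diff(2)[of a b] that \<open>r > 0\<close> by simp
    also have "\<dots> \<le> (b - a) / g (r/2)"
      using monoD[OF g_mono, of "r/2" a] g_pos[of "r/2"] that \<open>r > 0\<close>
      by (intro divide_left_mono) (auto intro!: mult_pos_pos g_pos)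
    finally have "rtail a - rtail b \<le> (b - a) / g (r/2)" .
    moreover have "0 \<le> rtail a - rtail b" using rtail_strict[of a b] that \<open>r > 0\<close> by (cases "a = b") auto
    ultimately show ?thesis by simp
  qed
  have "dist (rtail a) (rtail b) \<le> ?C * dist a b" if "a \<in> {r/2<..}" "b \<in> {r/2<..}" for a b
    using *[of a b] *[of b a] that C by (cases "a \<le> b") (auto simp: dist_real_def mult.commute)
  then have "?C-lipschitz_on {r/2<..} rtail" using C by (intro lipschitz_onI) auto
  then have "continuous_on {r/2<..} rtail" by (rule lipschitz_on_continuous_on)
  then show ?thesis using that by (simp add: continuous_on_eq_continuous_at)
qed

lemma rtail_small: "\<exists>r>0. rtail r < y" if "y > 0"
proof -
  have dec: "decseq (\<lambda>n \<sigma>. (1 / ennreal (g \<sigma>)) * indicator {real (Suc n)<..} \<sigma>)"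
    by (intro antimonoI le_funI mult_left_mono) (auto simp: indicator_def)
  have "(INF n. recip_tail g (real (Suc n)))
      = (\<integral>\<^sup>+\<sigma>. (INF n. (1 / ennreal (g \<sigma>)) * indicator {real (Suc n)<..} \<sigma>) \<partial>lborel)"
    unfolding recip_tail_def
  proof (rule nn_integral_monotone_convergence_INF_decseq[OF dec, symmetric, where i=0])
    show "(\<integral>\<^sup>+\<sigma>. 1 / ennreal (g \<sigma>) * indicator {real (Suc 0)<..} \<sigma> \<partial>lborel) < \<infinity>"
      using recip_tail_finite[of 1] by (simp add: recip_tail_def)
  qed simp
  also have "\<dots> = (\<integral>\<^sup>+\<sigma>. 0 \<partial>(lborel :: real measure))"
  proof (intro nn_integral_cong)
    fix \<sigma> :: real
    obtain n where "\<sigma> \<le> real (Suc n)" using real_arch_simple[of \<sigma>] by (metis le_SucI of_nat_mono order.trans le_refl)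
    then show "(INF n. (1 / ennreal (g \<sigma>)) * indicator {real (Suc n)<..} \<sigma>) = 0"
      by (intro antisym INF_lower2[of n]) auto
  qed
  finally have "(INF n. recip_tail g (real (Suc n))) < ennreal y" using that by simp
  then obtain n where "recip_tail g (real (Suc n)) < ennreal y" by (auto simp: INF_less_iff)
  then have "rtail (real (Suc n)) < y"
    using recip_tail_eq[of "real (Suc n)"] that ennreal_less_iff[OF enn2real_nonneg] by (metis rtail_def of_nat_0_less_iff zero_less_Suc)
  then show ?thesis by (intro exI[of _ "real (Suc n)"]) auto
qed

text \<open>Lipschitz continuity at \<open>0\<close> and \<open>g 0 = 0\<close> give
  \<open>g \<sigma> \<le> L * \<sigma>\<close> near \<open>0\<close>, so the integral diverges at
  least logarithmically: each halving of the lower limit adds at least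
  \<open>1 / (2 * L)\<close>.\<close>

lemma rtail_large: "\<exists>r>0. rtail r > y"
proof -
  obtain d L where d: "d > 0" "L-lipschitz_on (cball 0 d) g" using g_lip by blast
  have gl: "g \<sigma> \<le> L * \<sigma>" if "0 \<le> \<sigma>" "\<sigma> \<le> d" for \<sigma>
    using lipschitz_onD[OF d(2), of \<sigma> 0] that g_zero g_nonneg[of \<sigma>] by (simp add: dist_real_def)
  have L: "L > 0" using gl[of d] g_pos[of d] d(1) by (smt (verit) mult_nonpos_nonneg)
  have "rtail (d / 2^n) \<ge> real n / (2 * L)" for n
  proof (induction n)
    case 0 then show ?case by (simp add: rtail_def)
  next
    case (Suc n)
    let ?r = "d / 2^Suc n"
    have r: "?r > 0" "2 * ?r \<le> d" using d(1) by (auto simp: field_simps)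
    have "1 / (2 * L) = (2 * ?r - ?r) / (L * (2 * ?r))" using L r(1) by (simp add: field_simps)
    also have "\<dots> \<le> (2 * ?r - ?r) / g (2 * ?r)"
      using gl[of "2 * ?r"] r g_pos[of "2 * ?r"] L by (intro divide_left_mono) auto
    also have "\<dots> \<le> rtail ?r - rtail (2 * ?r)" using r(1) by (intro rtail_diff(1)) auto
    finally show ?case using Suc by (simp add: field_simps add_divide_distrib)
  qed
  moreover obtain n :: nat where "real n > y * (2 * L)" using reals_Archimedean2 by blast
  ultimately have "rtail (d / 2^n) > y" using L
    by (smt (verit) less_divide_eq mult_pos_pos)
  then show ?thesis using d(1) by (intro exI[of _ "d / 2^n"]) auto
qed

lemma rtail_surj: "\<exists>r>0. rtail r = y" if "y > 0"
proof -
  obtain b where b: "b > 0" "rtail b < y" using rtail_small[OF \<open>y > 0\<close>] by blast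
  obtain a where a: "a > 0" "rtail a > y" using rtail_large by blast
  have "a < b" using rtail_strict[of b a] a b by (cases a b rule: linorder_cases) auto
  then obtain x where "a \<le> x" "rtail x = y"
    using IVT2[of rtail b y a] a b rtail_isCont by fastforce
  then show ?thesis using a(1) by (intro exI[of _ x]) simp
qed

definition rtail_inv :: "real \<Rightarrow> real" where
  "rtail_inv y = (THE r. r > 0 \<and> rtail r = y)"

lemma rtail_inj: "r > 0 \<Longrightarrow> r' > 0 \<Longrightarrow> rtail r = rtail r' \<Longrightarrow> r = r'"
  using rtail_strict[of r r'] rtail_strict[of r' r] by (cases r r' rule: linorder_cases) auto

lemma rtail_inv: "rtail_inv y > 0" "rtail (rtail_inv y) = y" if "y > 0"
proof -
  have "\<exists>!r. r > 0 \<and> rtail r = y" using rtail_surj[OF that] rtail_inj by metis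
  then show "rtail_inv y > 0" "rtail (rtail_inv y) = y"
    unfolding rtail_inv_def by (metis (mono_tags, lifting) theI')+
qed

lemma rtail_inv_rtail: "r > 0 \<Longrightarrow> rtail r > 0 \<Longrightarrow> rtail_inv (rtail r) = r"
  using rtail_inj rtail_inv by blast

lemma rtail_inv_less: "0 < y \<Longrightarrow> y < y' \<Longrightarrow> rtail_inv y' < rtail_inv y"
  using rtail_inv[of y] rtail_inv[of y'] rtail_strict[of "rtail_inv y" "rtail_inv y'"]
  by (cases "rtail_inv y" "rtail_inv y'" rule: linorder_cases) auto

lemma rtail_inv_diff:
  assumes "0 < y" "y < y'"
  shows "g (rtail_inv y') * (y' - y) \<le> rtail_inv y - rtail_inv y'"
    "rtail_inv y - rtail_inv y' \<le> g (rtail_inv y) * (y' - y)"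
proof -
  note i = rtail_inv[OF assms(1)] rtail_inv[of y'] rtail_inv_less[OF assms]
  note d = rtail_diff[of "rtail_inv y'" "rtail_inv y"]
  show "g (rtail_inv y') * (y' - y) \<le> rtail_inv y - rtail_inv y'"
    "rtail_inv y - rtail_inv y' \<le> g (rtail_inv y) * (y' - y)"
    using i d assms g_pos[of "rtail_inv y"] g_pos[of "rtail_inv y'"] by (auto simp: field_simps)
qed

lemma rtail_inv_isCont: "isCont rtail_inv y" if "y > 0"
proof -
  let ?C = "g (rtail_inv (y/2))"
  have *: "rtail_inv a - rtail_inv b \<le> ?C * (b - a) \<and> rtail_inv a \<ge> rtail_inv b" if "y/2 < a" "a < b" for a b
  proof -
    have "rtail_inv a - rtail_inv b \<le> g (rtail_inv a) * (b - a)"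
      using rtail_inv_diff(2)[of a b] that \<open>y > 0\<close> by simp
    also have "\<dots> \<le> ?C * (b - a)"
      using monoD[OF g_mono] rtail_inv_less[of "y/2" a] that \<open>y > 0\<close> by (intro mult_right_mono) auto
    finally show ?thesis using rtail_inv_less[of a b] that \<open>y > 0\<close> by auto
  qed
  have "dist (rtail_inv a) (rtail_inv b) \<le> ?C * dist a b" if "a \<in> {y/2<..}" "b \<in> {y/2<..}" for a b
    using *[of a b] *[of b a] that by (cases a b rule: linorder_cases) (auto simp: dist_real_def)
  then have "?C-lipschitz_on {y/2<..} rtail_inv" using g_nonneg by (intro lipschitz_onI) auto
  then have "continuous_on {y/2<..} rtail_inv" by (rule lipschitz_on_continuous_on)
  then show ?thesis using that by (simp add: continuous_on_eq_continuous_at)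
qed

text \<open>By \<open>rtail_inv_diff\<close> the negated difference quotient lies between the values
  of \<open>g\<close> at \<open>rtail_inv y\<close> and \<open>rtail_inv y'\<close>, which merge by
  continuity.\<close>

lemma rtail_inv_deriv: "(rtail_inv has_real_derivative - g (rtail_inv y)) (at y)" if "y > 0"
proof -
  have lim: "((\<lambda>y'. \<bar>g (rtail_inv y') - g (rtail_inv y)\<bar>) \<longlongrightarrow> 0) (at y)"
  proof -
    have "isCont (\<lambda>y'. g (rtail_inv y')) y"
      by (intro isCont_o2[OF rtail_inv_isCont[OF that]] g_isCont)
    then have "((\<lambda>y'. g (rtail_inv y')) \<longlongrightarrow> g (rtail_inv y)) (at y)" by (simp add: isCont_def)
    then show ?thesis by (auto intro: tendsto_rabs_zero simp: LIM_zero_iff)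
  qed
  have "eventually (\<lambda>y'. y' > 0 \<and> y' \<noteq> y) (at y)"
    using order_tendstoD(1)[OF tendsto_ident_at, of 0 y UNIV] that eventually_neq_at_within[of y y UNIV]
    by (simp add: eventually_conj_iff)
  then have ev: "eventually (\<lambda>y'. norm ((rtail_inv y' - rtail_inv y) / (y' - y) - - g (rtail_inv y))
          \<le> \<bar>g (rtail_inv y') - g (rtail_inv y)\<bar>) (at y)"
  proof (rule eventually_mono)
    fix y' assume y': "y' > 0 \<and> y' \<noteq> y"
    let ?q = "(rtail_inv y' - rtail_inv y) / (y' - y)"
    consider "y < y'" | "y' < y" using y' by linarith
    then have "min (g (rtail_inv y)) (g (rtail_inv y')) \<le> - ?q \<and> - ?q \<le> max (g (rtail_inv y)) (g (rtail_inv y'))"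
    proof cases
      case 1
      have "- ?q = (rtail_inv y - rtail_inv y') / (y' - y)"
        by (metis minus_diff_eq minus_divide_left)
      moreover have "g (rtail_inv y') \<le> (rtail_inv y - rtail_inv y') / (y' - y)"
        "(rtail_inv y - rtail_inv y') / (y' - y) \<le> g (rtail_inv y)"
        using 1 rtail_inv_diff[OF \<open>y > 0\<close> 1] by (simp_all add: pos_le_divide_eq pos_divide_le_eq)
      ultimately show ?thesis by linarith
    next
      case 2
      have "- ?q = (rtail_inv y' - rtail_inv y) / (y - y')"
        using 2 by (simp add: field_simps)
      moreover have "g (rtail_inv y) \<le> (rtail_inv y' - rtail_inv y) / (y - y')"
        "(rtail_inv y' - rtail_inv y) / (y - y') \<le> g (rtail_inv y')"
        using 2 rtail_inv_diff[of y' y] y' by (simp_all add: pos_le_divide_eq pos_divide_le_eq)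
      ultimately show ?thesis by linarith
    qed
    then show "norm (?q - - g (rtail_inv y)) \<le> \<bar>g (rtail_inv y') - g (rtail_inv y)\<bar>"
      by (auto simp: min_def max_def abs_if split: if_splits)
  qed
  have "((\<lambda>y'. (rtail_inv y' - rtail_inv y) / (y' - y)) \<longlongrightarrow> - g (rtail_inv y)) (at y)"
    using Lim_null_comparison[OF ev lim] by (simp only: LIM_zero_iff)
  then show ?thesis by (simp add: has_field_derivative_iff)
qed

lemma rtail_inv_at_0: "filterlim rtail_inv at_top (at_right 0)"
  unfolding filterlim_at_top
proof
  fix Z :: real
  define r where "r = max Z 1"
  have r: "r > 0" "r \<ge> Z" by (auto simp: r_def)
  have "rtail (r + 1) < rtail r" using rtail_strict[of r "r+1"] r by simp
  then have p: "rtail r > 0" using enn2real_nonneg[of "recip_tail g (r+1)"] unfolding rtail_def by linarith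
  have "Z \<le> rtail_inv y" if "0 < y" "y < rtail r" for y
    using rtail_inv_less[OF that] rtail_inv_rtail[OF r(1) p] r by simp
  then show "\<forall>\<^sub>F y in at_right 0. Z \<le> rtail_inv y"
    using p by (auto simp: eventually_at_right_field)
qed

section \<open>Flat solutions that blow up at a prescribed time\<close>

definition shifted_flat :: "real \<Rightarrow> real \<Rightarrow> real \<Rightarrow> real" where
  "shifted_flat \<beta> a t = rtail_inv ((t powr (\<beta> + 1) - a powr (\<beta> + 1)) / (\<beta> + 1))"

context
  fixes \<beta> :: real
  assumes \<beta>: "\<beta> > -1"
begin

lemma powr_gap_pos: "0 < (t powr (\<beta> + 1) - a powr (\<beta> + 1)) / (\<beta> + 1)" if "0 \<le> a" "a < t"
  using that \<beta> powr_less_mono2[of "\<beta> + 1" a t] by simp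

lemma flat_sol_eq: "flat_sol g \<beta> t = shifted_flat \<beta> 0 t" if "t > 0"
proof -
  let ?y = "t powr (\<beta> + 1) / (\<beta> + 1)"
  have y: "?y > 0" using that \<beta> by simp
  have inj: "inj_on (recip_tail g) {0<..}"
  proof (rule inj_onI)
    fix x y assume "x \<in> {0<..}" "y \<in> {0<..}" "recip_tail g x = recip_tail g y"
    then show "x = y" using rtail_inj[of x y] by (simp add: rtail_def)
  qed
  have "the_inv_into {0<..} (recip_tail g) (ennreal ?y) = rtail_inv ?y"
    using rtail_inv[OF y] by (intro the_inv_into_f_eq[OF inj]) (auto simp: recip_tail_eq)
  then show ?thesis by (simp add: flat_sol_def shifted_flat_def)
qed

lemma shifted_flat_pos: "0 \<le> a \<Longrightarrow> a < t \<Longrightarrow> shifted_flat \<beta> a t > 0"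
  unfolding shifted_flat_def by (intro rtail_inv powr_gap_pos)

lemma shifted_flat_deriv:
  assumes "0 \<le> a" "a < t"
  shows "(shifted_flat \<beta> a has_real_derivative - (t powr \<beta> * g (shifted_flat \<beta> a t))) (at t)"
proof -
  have "((\<lambda>t. (t powr (\<beta> + 1) - a powr (\<beta> + 1)) / (\<beta> + 1)) has_real_derivative t powr \<beta>) (at t)"
    using assms \<beta> by (auto intro!: derivative_eq_intros)
  from DERIV_chain2[OF rtail_inv_deriv[OF powr_gap_pos[OF assms]] this]
  show ?thesis unfolding shifted_flat_def by (simp add: mult.commute)
qed

text \<open>The argument of \<open>rtail_inv\<close> decreases to \<open>0\<close> as
  \<open>t\<close> decreases to \<open>a\<close>. This is the source of the initial ordering in the
  comparison, as \<open>u\<close> stays bounded on compact sets near a time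
  \<open>a > 0\<close>.\<close>

lemma shifted_flat_blowup:
  assumes "0 < a"
  shows "filterlim (shifted_flat \<beta> a) at_top (at_right a)"
proof -
  have "filterlim (\<lambda>t. (t powr (\<beta> + 1) - a powr (\<beta> + 1)) / (\<beta> + 1)) (at_right 0) (at_right a)"
    unfolding filterlim_at
  proof
    show "\<forall>\<^sub>F t in at_right a. (t powr (\<beta> + 1) - a powr (\<beta> + 1)) / (\<beta> + 1) \<in> {0<..} \<and>
            (t powr (\<beta> + 1) - a powr (\<beta> + 1)) / (\<beta> + 1) \<noteq> 0"
      unfolding eventually_at_filter
      using powr_gap_pos[of a] assms by (intro always_eventually) (force dest: less_imp_neq)
    have "((\<lambda>t. (t powr (\<beta> + 1) - a powr (\<beta> + 1)) / (\<beta> + 1)) \<longlongrightarrow>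
        (a powr (\<beta> + 1) - a powr (\<beta> + 1)) / (\<beta> + 1)) (at_right a)"
      using assms \<beta> by (intro tendsto_intros) auto
    then show "((\<lambda>t. (t powr (\<beta> + 1) - a powr (\<beta> + 1)) / (\<beta> + 1)) \<longlongrightarrow> 0) (at_right a)" by simp
  qed
  from filterlim_compose[OF rtail_inv_at_0 this] show ?thesis
    unfolding shifted_flat_def by simp
qed

lemma shifted_flat_tendsto:
  assumes "t > 0"
  shows "((\<lambda>a. shifted_flat \<beta> a t) \<longlongrightarrow> shifted_flat \<beta> 0 t) (at_right 0)"
proof -
  have *: "((\<lambda>a. a powr (\<beta> + 1)) \<longlongrightarrow> 0) (at_right 0)"
    using tendsto_zero_powrI[of "\<lambda>a. a" "at_right 0" "\<lambda>_. \<beta> + 1" "\<beta> + 1"] \<beta>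
    by (auto simp: eventually_at_filter intro!: always_eventually)
  have "((\<lambda>a. (t powr (\<beta> + 1) - a powr (\<beta> + 1)) / (\<beta> + 1)) \<longlongrightarrow> (t powr (\<beta> + 1) - 0) / (\<beta> + 1)) (at_right 0)"
    using \<beta> by (intro tendsto_intros *) auto
  then show ?thesis unfolding shifted_flat_def
    using \<beta> assms by (intro isCont_tendsto_compose[OF rtail_inv_isCont]) auto
qed

end

end

section \<open>Truncated fractional operators\<close>

text \<open>The exponent is left free: \<open>N + 2 s\<close> gives the kernel of the operator,
  while \<open>2 * q\<close> is used to dominate \<open>decay q\<close> away from the unit
  ball.\<close>

definition cut_kernel :: "real \<Rightarrow> real \<Rightarrow> 'a::euclidean_space \<Rightarrow> real" where
  "cut_kernel p h z = indicator {z. h < norm z} z * norm z powr - p"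

text \<open>A smooth weight of order \<open>|x|\<close> to the power \<open>- 2 * q\<close> at
  infinity. With \<open>p = N + 2 s\<close>, \<open>decay (p / 2)\<close> is of the order of the
  weight in \<open>frac_space s\<close>, and \<open>decay (p / 4)\<close> is its square
  root.\<close>

definition decay :: "real \<Rightarrow> 'a::euclidean_space \<Rightarrow> real" where
  "decay q x = (1 + (norm x)\<^sup>2) powr - q"

text \<open>The second moment of the kernel on a ball, finite for \<open>p < N + 2\<close>: the
  factor with which a quadratic bound on second differences enters the operator.\<close>

definition near_mass :: "'a::euclidean_space itself \<Rightarrow> real \<Rightarrow> real \<Rightarrow> real" where
  "near_mass _ p \<rho> = (LINT z:cball 0 \<rho>|lborel. (norm (z::'a))\<^sup>2 * norm z powr - p)"

text \<open>
  With \<open>p = N + 2 s\<close>, the truncated fractional Laplacian is \<open>- trunc_gen p h\<close> up to the factor \<open>a\<^sub>N\<^sub>,\<^sub>s\<close>.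
\<close>

definition trunc_gen :: "real \<Rightarrow> real \<Rightarrow> ('a::euclidean_space \<Rightarrow> real) \<Rightarrow> 'a \<Rightarrow> real" where
  "trunc_gen p h \<phi> x = (LINT z|lborel. (\<phi> (x + z) - \<phi> x) * cut_kernel p h z)"

section \<open>Measurability and integrability of the kernel and the weight\<close>

lemma cut_kernel_measurable [measurable]: "cut_kernel p h \<in> borel_measurable borel"
  unfolding cut_kernel_def by measurable

lemma cut_kernel_nonneg [simp]: "0 \<le> cut_kernel p h z"
  by (simp add: cut_kernel_def)

lemma cut_kernel_minus [simp]: "cut_kernel p h (- z) = cut_kernel p h z"
  by (simp add: cut_kernel_def indicator_def)

lemma cball_borel [measurable]: "cball (c::'a::euclidean_space) r \<in> sets borel"
  by (rule borel_closed) simp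

lemma decay_measurable [measurable]: "decay q \<in> borel_measurable borel"
  unfolding decay_def by measurable

lemma decay_pos [simp]: "0 < decay q x"
proof -
  have "1 + (norm x)\<^sup>2 > 0" by (simp add: add_pos_nonneg)
  then show ?thesis by (simp add: decay_def)
qed

lemma decay_nonneg [simp]: "0 \<le> decay q x"
  by (simp add: less_imp_le)

lemma decay_square: "(decay q x)\<^sup>2 = decay (2 * q) x"
  unfolding decay_def by (simp add: power2_eq_square flip: powr_add)

text \<open>On the shell of inner radius \<open>r * q^k\<close> the integrand is at most a constant
  times \<open>(r * q^k) powr - a\<close>, and the shell lies in a ball of volume proportional to
  the \<open>N\<close>-th power of that radius. The sum is a geometric series of ratio
  \<open>q powr (N - a)\<close>. The choice \<open>q = 2\<close> serves integrability at infinity,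
  \<open>q = 1/2\<close> integrability at the origin.\<close>

lemma nn_integral_dyadic_shells:
  fixes a q r :: real
  assumes "r > 0" "q > 0" and q: "q powr (DIM('a) - a) < 1"
  shows "(\<integral>\<^sup>+ z. ennreal (norm z powr - a) *
      indicator (\<Union>k. {z::'a::euclidean_space. r * q^k < norm z \<and> norm z \<le> 2 * (r * q^k)}) z \<partial>lborel) < \<infinity>"
proof -
  let ?A = "2 powr \<bar>a\<bar>" and ?w = "unit_ball_vol (real DIM('a))"
  define R where "R k = r * q ^ k" for k :: nat
  have R: "R k > 0" for k using assms by (simp add: R_def)
  define f where "f k z = ennreal (?A * R k powr - a) * indicator (cball 0 (2 * R k)) z" for k and z :: 'a
  have le: "norm z powr - a \<le> ?A * R k powr - a" if z: "R k < norm z" "norm z \<le> 2 * R k" for k and z :: 'a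
  proof (cases "a \<ge> 0")
    case True
    have "norm z powr - a \<le> R k powr - a" using z R[of k] True by (intro powr_mono2') auto
    also have "\<dots> \<le> ?A * R k powr - a" using ge_one_powr_ge_zero[of 2 "\<bar>a\<bar>"]
      by (simp add: mult_le_cancel_right1)
    finally show ?thesis .
  next
    case False
    have "norm z powr - a \<le> (2 * R k) powr - a" using z R[of k] False by (intro powr_mono2) auto
    also have "\<dots> = ?A * R k powr - a" using R[of k] False by (simp add: powr_mult)
    finally show ?thesis .
  qed
  have le_sum: "(\<integral>\<^sup>+ z. ennreal (norm z powr - a) *
      indicator (\<Union>k. {z::'a. r * q^k < norm z \<and> norm z \<le> 2 * (r * q^k)}) z \<partial>lborel)
      \<le> (\<integral>\<^sup>+ z. (\<Sum>k. f k z) \<partial>lborel)"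
  proof (intro nn_integral_mono)
    fix z :: 'a
    show "ennreal (norm z powr - a) *
      indicator (\<Union>k. {z::'a. r * q^k < norm z \<and> norm z \<le> 2 * (r * q^k)}) z \<le> (\<Sum>k. f k z)"
    proof (cases "z \<in> (\<Union>k. {z::'a. r * q^k < norm z \<and> norm z \<le> 2 * (r * q^k)})")
      case True
      then obtain k where k: "R k < norm z" "norm z \<le> 2 * R k" by (auto simp: R_def)
      have "ennreal (norm z powr - a) \<le> f k z"
        using le[OF k] k by (simp add: f_def ennreal_leI)
      also have "\<dots> = sum (\<lambda>k. f k z) {k}" by simp
      also have "\<dots> \<le> (\<Sum>k. f k z)" by (intro sum_le_suminf) auto
      finally show ?thesis using True by simp
    qed simp
  qed
  have "(\<integral>\<^sup>+ z. (\<Sum>k. f k z) \<partial>lborel) = (\<Sum>k. (\<integral>\<^sup>+ z. f k z \<partial>lborel))"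
    by (intro nn_integral_suminf) (simp add: f_def)
  also have "\<dots> = (\<Sum>k. ennreal (?A * ?w * 2 ^ DIM('a) * r powr (DIM('a) - a) * (q powr (DIM('a) - a)) ^ k))"
  proof (intro suminf_cong)
    fix k
    have e: "R k powr - a * R k ^ DIM('a) = r powr (DIM('a) - a) * (q powr (DIM('a) - a)) ^ k"
    proof -
      have "R k powr - a * R k ^ DIM('a) = R k powr (DIM('a) - a)"
        using R[of k] by (simp add: powr_add[symmetric] flip: powr_realpow)
      also have "\<dots> = r powr (DIM('a) - a) * (q ^ k) powr (DIM('a) - a)"
        using assms by (simp add: R_def powr_mult)
      also have "(q ^ k) powr (DIM('a) - a) = (q powr (DIM('a) - a)) ^ k"
        using assms by (simp add: powr_powr powr_realpow[symmetric] mult.commute)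
      finally show ?thesis .
    qed
    have "(\<integral>\<^sup>+ z. f k z \<partial>lborel) = ennreal (?A * R k powr - a) * emeasure lborel (cball (0::'a) (2 * R k))"
      by (simp add: f_def nn_integral_cmult_indicator)
    also have "\<dots> = ennreal (?A * R k powr - a) * ennreal (?w * (2 * R k) ^ DIM('a))"
      using R[of k] by (simp add: emeasure_cball)
    also have "\<dots> = ennreal (?A * ?w * 2 ^ DIM('a) * (R k powr - a * R k ^ DIM('a)))"
      using R[of k] by (simp add: power_mult_distrib mult_ac flip: ennreal_mult)
    finally show "(\<integral>\<^sup>+ z. f k z \<partial>lborel) = ennreal (?A * ?w * 2 ^ DIM('a) * r powr (DIM('a) - a) * (q powr (DIM('a) - a)) ^ k)"
      unfolding e by (simp add: mult.assoc)
  qed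
  also have "\<dots> \<noteq> top"
    using q by (intro ennreal_suminf_neq_top summable_mult summable_geometric) auto
  finally show ?thesis using le_sum by (auto simp: less_top top_unique)
qed

lemma integrable_cut_kernel:
  assumes "real DIM('a) < p" "h > 0"
  shows "integrable lborel (cut_kernel p h :: 'a::euclidean_space \<Rightarrow> real)"
proof (rule integrableI_nonneg)
  have "\<exists>k. h * 2 ^ k < norm z \<and> norm z \<le> 2 * (h * 2 ^ k)" if z: "h < norm z" for z :: 'a
  proof -
    obtain k :: nat where k: "norm z / (2 * h) < 2 ^ k" using real_arch_pow[of 2] by auto
    \<comment> \<open>The least \<open>k\<close> with \<open>P k\<close> is the shell of
      \<open>z\<close>: minimality yields the lower bound on \<open>norm z\<close>, and for
      \<open>k = 0\<close> the assumption \<open>h < norm z\<close> does.\<close>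
    define P where "P k \<longleftrightarrow> norm z \<le> 2 * (h * 2 ^ k)" for k :: nat
    have "P k" using k assms(2) by (simp add: P_def field_simps)
    then obtain m where m: "P m" "\<And>j. j < m \<Longrightarrow> \<not> P j" using exists_least_iff[of P] by blast
    have "h * 2 ^ m < norm z" using m(2)[of "m - 1"] z by (cases m) (auto simp: P_def)
    then show ?thesis using m(1) by (auto simp: P_def)
  qed
  then have "(\<integral>\<^sup>+ z. ennreal (cut_kernel p h (z::'a)) \<partial>lborel) \<le>
      (\<integral>\<^sup>+ z. ennreal (norm z powr - p) *
        indicator (\<Union>k. {z::'a. h * 2^k < norm z \<and> norm z \<le> 2 * (h * 2^k)}) z \<partial>lborel)"
    by (intro nn_integral_mono) (auto simp: cut_kernel_def indicator_def)
  also have "\<dots> < \<infinity>"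
  proof (rule nn_integral_dyadic_shells)
    show "2 powr (real DIM('a) - p) < 1" using assms powr_less_cancel_iff[of 2 "real DIM('a) - p" 0] by simp
  qed (use assms in auto)
  finally show "(\<integral>\<^sup>+ z. ennreal (cut_kernel p h (z::'a)) \<partial>lborel) < \<infinity>" .
qed auto

lemma set_integrable_near:
  assumes "p < real DIM('a) + 2"
  shows "set_integrable lborel (cball 0 \<rho>) (\<lambda>z. (norm (z::'a::euclidean_space))\<^sup>2 * norm z powr - p)"
proof (cases "\<rho> > 0")
  case True
  have cover: "\<exists>k. (\<rho>/2) * (1/2) ^ k < norm z \<and> norm z \<le> 2 * ((\<rho>/2) * (1/2) ^ k)"
    if z: "z \<noteq> 0" "norm z \<le> \<rho>" for z :: 'a
  proof -
    obtain k :: nat where k: "(1/2) ^ k < norm z / \<rho>"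
      using real_arch_pow_inv[of "norm z / \<rho>" "1/2"] True z by auto
    define P where "P k \<longleftrightarrow> (\<rho>/2) * (1/2) ^ k < norm z" for k :: nat
    have "(1/2) ^ k * \<rho> < norm z" using k True by (simp add: field_simps)
    moreover have "(\<rho>/2) * (1/2) ^ k \<le> (1/2) ^ k * \<rho>" using True by simp
    ultimately have "P k" unfolding P_def by linarith
    then obtain m where m: "P m" "\<And>j. j < m \<Longrightarrow> \<not> P j" using exists_least_iff[of P] by blast
    have "norm z \<le> 2 * ((\<rho>/2) * (1/2) ^ m)"
      using m(2)[of "m - 1"] z by (cases m) (auto simp: P_def)
    then show ?thesis using m(1) by (auto simp: P_def)
  qed
  show ?thesis unfolding set_integrable_def
  proof (rule integrableI_nonneg)
    have "(\<integral>\<^sup>+ z. ennreal (indicator (cball 0 \<rho>) z *\<^sub>R ((norm (z::'a))\<^sup>2 * norm z powr - p)) \<partial>lborel) \<le>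
      (\<integral>\<^sup>+ z. ennreal (norm z powr - (p - 2)) *
        indicator (\<Union>k. {z::'a. (\<rho>/2) * (1/2)^k < norm z \<and> norm z \<le> 2 * ((\<rho>/2) * (1/2)^k)}) z \<partial>lborel)"
    proof (intro nn_integral_mono)
      fix z :: 'a
      show "ennreal (indicator (cball 0 \<rho>) z *\<^sub>R ((norm z)\<^sup>2 * norm z powr - p)) \<le>
        ennreal (norm z powr - (p - 2)) *
        indicator (\<Union>k. {z::'a. (\<rho>/2) * (1/2)^k < norm z \<and> norm z \<le> 2 * ((\<rho>/2) * (1/2)^k)}) z"
      proof (cases "z \<noteq> 0 \<and> norm z \<le> \<rho>")
        case True
        then have "(norm z)\<^sup>2 * norm z powr - p = norm z powr - (p - 2)"
          by (simp add: powr_diff powr_minus field_simps)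
        then show ?thesis using cover[of z] True by (auto simp: indicator_def)
      qed auto
    qed
    also have "\<dots> < \<infinity>"
    proof (rule nn_integral_dyadic_shells)
      show "(1/2) powr (real DIM('a) - (p - 2)) < 1"
        using assms powr_less_mono'[of "1/2" 0 "real DIM('a) - (p - 2)"] by simp
    qed (use True in auto)
    finally show "(\<integral>\<^sup>+ z. ennreal (indicator (cball 0 \<rho>) z *\<^sub>R ((norm (z::'a))\<^sup>2 * norm z powr - p)) \<partial>lborel) < \<infinity>" .
  qed auto
next
  case False
  have "indicator (cball 0 \<rho>) z *\<^sub>R ((norm z)\<^sup>2 * norm z powr - p) = 0" for z :: 'a
  proof (cases "norm z \<le> \<rho>")
    case True
    then have "norm z = 0" using False norm_ge_zero[of z] by linarith
    then show ?thesis by simp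
  qed simp
  then show ?thesis by (simp only: set_integrable_def integrable_zero)
qed

lemma near_mass_nonneg: "0 \<le> near_mass TYPE('a::euclidean_space) p \<rho>"
  unfolding near_mass_def set_lebesgue_integral_def by (intro Bochner_Integration.integral_nonneg) auto

lemma near_mass_tendsto_0:
  assumes "p < real DIM('a::euclidean_space) + 2"
  shows "(near_mass TYPE('a) p \<longlongrightarrow> 0) (at_right 0)"
proof (rule tendsto_at_right_sequentially[of 0 1])
  fix S :: "nat \<Rightarrow> real"
  assume S: "\<And>n. 0 < S n" "\<And>n. S n < 1" "decseq S" "S \<longlonglongrightarrow> 0"
  have "(\<lambda>n. LINT z|lborel. indicator (cball 0 (S n)) z *\<^sub>R ((norm (z::'a))\<^sup>2 * norm z powr - p))
      \<longlonglongrightarrow> (LINT z|lborel. (0::real) * (norm (z::'a)))"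
  proof (rule integral_dominated_convergence)
    show "integrable lborel (\<lambda>z. indicator (cball 0 1) z *\<^sub>R ((norm (z::'a))\<^sup>2 * norm z powr - p))"
      using set_integrable_near[OF assms, of 1] by (simp add: set_integrable_def)
    show "AE z in lborel. (\<lambda>n. indicator (cball 0 (S n)) z *\<^sub>R ((norm (z::'a))\<^sup>2 * norm z powr - p))
        \<longlonglongrightarrow> 0 * norm z"
    proof (intro AE_I2)
      fix z :: 'a
      show "(\<lambda>n. indicator (cball 0 (S n)) z *\<^sub>R ((norm z)\<^sup>2 * norm z powr - p)) \<longlonglongrightarrow> 0 * norm z"
      proof (cases "z = 0")
        case False
        then have "eventually (\<lambda>n. S n < norm z) sequentially" using order_tendstoD(2)[OF S(4)] by simp
        then show ?thesis by (intro tendsto_eventually) (auto elim!: eventually_mono)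
      qed simp
    qed
    fix n
    show "AE z in lborel. norm (indicator (cball 0 (S n)) z *\<^sub>R ((norm (z::'a))\<^sup>2 * norm z powr - p))
        \<le> indicator (cball 0 1) z *\<^sub>R ((norm z)\<^sup>2 * norm z powr - p)"
      using S(2)[of n] by (intro AE_I2) (auto simp: indicator_def)
  qed auto
  then show "(\<lambda>n. near_mass TYPE('a) p (S n)) \<longlonglongrightarrow> 0"
    by (simp add: near_mass_def set_lebesgue_integral_def)
qed simp

lemma integrable_decay:
  assumes "real DIM('a) < 2 * q"
  shows "integrable lborel (decay q :: 'a::euclidean_space \<Rightarrow> real)"
proof (rule Bochner_Integration.integrable_bound)
  show "integrable lborel (\<lambda>z::'a. indicator (cball 0 1) z + cut_kernel (2 * q) 1 z)"
    using assms by (intro Bochner_Integration.integrable_add integrable_cut_kernel)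
      (auto simp: emeasure_cball)
  have q: "q > 0" using assms by (smt (verit) of_nat_0_le_iff)
  show "AE z in lborel. norm (decay q z) \<le> norm (indicator (cball 0 1) z + cut_kernel (2 * q) 1 (z::'a))"
  proof (intro AE_I2)
    fix z :: 'a
    show "norm (decay q z) \<le> norm (indicator (cball 0 1) z + cut_kernel (2 * q) 1 z)"
    proof (cases "norm z \<le> 1")
      case True
      have "decay q z \<le> 1 powr - q" unfolding decay_def using q by (intro powr_mono2') auto
      then show ?thesis using True by (simp add: cut_kernel_def)
    next
      case False
      have "decay q z \<le> ((norm z)\<^sup>2) powr - q" unfolding decay_def using q False
        by (intro powr_mono2') auto
      also have "\<dots> = norm z powr - (2 * q)" using False
        by (simp add: powr_powr flip: powr_numeral)
      finally show ?thesis using False by (simp add: cut_kernel_def)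
    qed
  qed
qed auto

lemma integrable_mult_bounded:
  fixes f v :: "'a::euclidean_space \<Rightarrow> real"
  assumes "integrable lborel f" "v \<in> borel_measurable borel" "\<And>x. \<bar>v x\<bar> \<le> M"
  shows "integrable lborel (\<lambda>x. v x * f x)"
proof (rule Bochner_Integration.integrable_bound)
  show "integrable lborel (\<lambda>x. M * f x)" using assms by simp
  show "AE x in lborel. norm (v x * f x) \<le> norm (M * f x)"
  proof (intro AE_I2)
    fix x
    have "\<bar>v x\<bar> \<le> \<bar>M\<bar>" using assms(3)[of x] by simp
    then show "norm (v x * f x) \<le> norm (M * f x)" by (simp add: abs_mult mult_right_mono)
  qed
qed (use assms in measurable)

lemma integral_reflect:
  fixes f :: "'a::euclidean_space \<Rightarrow> real"
  assumes [measurable]: "f \<in> borel_measurable borel"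
  shows "(LINT z|lborel. f (- z)) = (LINT z|lborel. f z)"
proof -
  have "distr lborel borel (\<lambda>z::'a. - z) = lborel"
    using lborel_affine[of "-1" "0::'a"] by (simp add: density_1)
  then have "(LINT z|lborel. f z) = (LINT z|distr lborel borel (\<lambda>z::'a. - z). f z)" by simp
  also have "\<dots> = (LINT z|lborel. f (- z))" by (subst integral_distr) auto
  finally show ?thesis by simp
qed

lemma integral_translate:
  fixes f :: "'a::euclidean_space \<Rightarrow> real"
  assumes [measurable]: "f \<in> borel_measurable borel"
  shows "(LINT z|lborel. f (a + z)) = (LINT z|lborel. f z)"
proof -
  have "(LINT z|lborel. f z) = (LINT z|distr lborel borel ((+) a). f z)" by (simp add: lborel_distr_plus)
  also have "\<dots> = (LINT z|lborel. f (a + z))" by (subst integral_distr) auto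
  finally show ?thesis by simp
qed

section \<open>One-sided bounds and symmetry of the truncated operator\<close>

context
  fixes p :: real and M :: real and \<phi> :: "'a::euclidean_space \<Rightarrow> real"
  assumes p: "real DIM('a) < p"
    and \<phi> [measurable]: "\<phi> \<in> borel_measurable borel" and bnd: "\<And>x. \<bar>\<phi> x\<bar> \<le> M"
begin

lemma integrable_shift_kernel:
  assumes "h > 0"
  shows "integrable lborel (\<lambda>z. \<phi> (x + z) * cut_kernel p h z)"
  by (rule integrable_mult_bounded[OF integrable_cut_kernel[OF p assms] _ bnd]) simp

lemma integrable_trunc_gen:
  assumes "h > 0"
  shows "integrable lborel (\<lambda>z. (\<phi> (x + z) - \<phi> x) * cut_kernel p h z)"
  using Bochner_Integration.integrable_diff[OF integrable_shift_kernel[OF assms, of x]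
      integrable_mult_right[OF integrable_cut_kernel[OF p assms], of "\<phi> x"]]
  by (simp add: left_diff_distrib)

text \<open>The kernel is even, so on the shell between \<open>h\<close> and \<open>\<rho>\<close>
  the first difference may be averaged with its reflection, which leaves half a second difference.
  Its quadratic upper bound is integrable against the kernel down to the origin, hence the estimate
  does not deteriorate as \<open>h\<close> tends to \<open>0\<close>.\<close>

lemma trunc_gen_le:
  assumes h: "0 < h" "h \<le> \<rho>" and A: "A \<ge> 0" and p2: "p < real DIM('a) + 2"
    and conc: "\<And>z. norm z \<le> \<rho> \<Longrightarrow> \<phi> (x + z) + \<phi> (x - z) - 2 * \<phi> x \<le> 2 * A * (norm z)\<^sup>2"
  shows "trunc_gen p h \<phi> x \<le> A * near_mass TYPE('a) p \<rho> + trunc_gen p \<rho> \<phi> x"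
proof -
  define j where "j z = (if h < norm z \<and> norm z \<le> \<rho> then norm z powr - p else 0)" for z :: 'a
  have [measurable]: "j \<in> borel_measurable borel" unfolding j_def by measurable
  have j: "0 \<le> j z" "j (- z) = j z" "j z \<le> cut_kernel p h z" for z
    by (auto simp: j_def cut_kernel_def)
  have split: "cut_kernel p h z = j z + cut_kernel p \<rho> z" for z
    using h by (auto simp: j_def cut_kernel_def indicator_def)
  have ij: "integrable lborel j"
    by (rule Bochner_Integration.integrable_bound[OF integrable_cut_kernel[OF p h(1)]])
      (use j in auto)
  have i1: "integrable lborel (\<lambda>z. (\<phi> (x + z) - \<phi> x) * j z)"
  proof (rule integrable_mult_bounded[OF ij])
    fix z show "\<bar>\<phi> (x + z) - \<phi> x\<bar> \<le> 2 * M" using bnd[of "x+z"] bnd[of x] by linarith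
  qed simp
  have i2: "integrable lborel (\<lambda>z. (\<phi> (x - z) - \<phi> x) * j z)"
  proof (rule integrable_mult_bounded[OF ij])
    fix z show "\<bar>\<phi> (x - z) - \<phi> x\<bar> \<le> 2 * M" using bnd[of "x-z"] bnd[of x] by linarith
  qed simp
  have "(LINT z|lborel. (\<phi> (x + z) - \<phi> x) * j z) = (LINT z|lborel. (\<phi> (x - z) - \<phi> x) * j z)"
    using integral_reflect[of "\<lambda>z. (\<phi> (x + z) - \<phi> x) * j z"] by (simp add: j)
  then have "2 * (LINT z|lborel. (\<phi> (x + z) - \<phi> x) * j z)
      = (LINT z|lborel. (\<phi> (x + z) - \<phi> x) * j z + (\<phi> (x - z) - \<phi> x) * j z)"
    using i1 i2 by simp
  also have "\<dots> \<le> (LINT z|lborel. 2 * A * (indicator (cball 0 \<rho>) z *\<^sub>R ((norm (z::'a))\<^sup>2 * norm z powr - p)))"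
  proof (rule Bochner_Integration.integral_mono)
    show "integrable lborel (\<lambda>z. 2 * A * (indicator (cball 0 \<rho>) z *\<^sub>R ((norm (z::'a))\<^sup>2 * norm z powr - p)))"
      using set_integrable_near[OF p2, of \<rho>] unfolding set_integrable_def by (rule integrable_mult_right)
    fix z :: 'a
    show "(\<phi> (x + z) - \<phi> x) * j z + (\<phi> (x - z) - \<phi> x) * j z
        \<le> 2 * A * (indicator (cball 0 \<rho>) z *\<^sub>R ((norm z)\<^sup>2 * norm z powr - p))"
    proof (cases "h < norm z \<and> norm z \<le> \<rho>")
      case True
      have "(\<phi> (x + z) + \<phi> (x - z) - 2 * \<phi> x) * norm z powr - p \<le> 2 * A * (norm z)\<^sup>2 * norm z powr - p"
        using True by (intro mult_right_mono conc) auto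
      then show ?thesis using True by (simp add: j_def algebra_simps)
    next
      case False
      then show ?thesis using A by (auto simp: j_def)
    qed
  qed (use i1 i2 in auto)
  also have "\<dots> = 2 * (A * near_mass TYPE('a) p \<rho>)"
    by (simp add: near_mass_def set_lebesgue_integral_def)
  finally have "(LINT z|lborel. (\<phi> (x + z) - \<phi> x) * j z) \<le> A * near_mass TYPE('a) p \<rho>" by simp
  moreover have "trunc_gen p h \<phi> x = (LINT z|lborel. (\<phi> (x + z) - \<phi> x) * j z) + trunc_gen p \<rho> \<phi> x"
    unfolding trunc_gen_def split distrib_left
    using i1 integrable_trunc_gen[of \<rho> x] h by (intro Bochner_Integration.integral_add) auto
  ultimately show ?thesis by simp
qed

end

text \<open>Truncation makes all integrands absolutely integrable, so Fubini applies. The operator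
  is a convolution with the even kernel minus multiplication by the total mass
  \<open>\<kappa>\<close>. The multiplication is symmetric at once; the convolution is moved by a
  translation in \<open>x\<close> followed by a reflection in \<open>z\<close>.\<close>

lemma trunc_gen_symmetric:
  fixes \<psi> v :: "'a::euclidean_space \<Rightarrow> real"
  assumes p: "real DIM('a) < p" and h: "h > 0"
    and \<psi>: "integrable lborel \<psi>" "\<And>x. \<bar>\<psi> x\<bar> \<le> B"
    and v [measurable]: "v \<in> borel_measurable borel" and bnd: "\<And>x. \<bar>v x\<bar> \<le> M"
  shows "(LINT x|lborel. \<psi> x * trunc_gen p h v x) = (LINT x|lborel. v x * trunc_gen p h \<psi> x)"
proof -
  have \<psi>m [measurable]: "\<psi> \<in> borel_measurable borel" using \<psi>(1) by auto
  let ?k = "cut_kernel p h :: 'a \<Rightarrow> real"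
  define \<kappa> where "\<kappa> = (LINT z|lborel. ?k z)"
  note ik = integrable_cut_kernel[OF p h]
  have expand: "trunc_gen p h f x = (LINT z|lborel. f (x + z) * ?k z) - \<kappa> * f x"
    if [measurable]: "f \<in> borel_measurable borel" and "\<And>x. \<bar>f x\<bar> \<le> C" for f :: "'a \<Rightarrow> real" and C x
    unfolding trunc_gen_def \<kappa>_def left_diff_distrib
    using integrable_shift_kernel[OF p that h, of x] ik
    by (simp add: Bochner_Integration.integral_diff mult.commute)
  define F where "F = (\<lambda>(x, z). \<psi> x * (v (x + z) * ?k z))"
  have Fm [measurable]: "F \<in> borel_measurable (lborel \<Otimes>\<^sub>M lborel)" unfolding F_def by measurable
  have iv: "integrable lborel (\<lambda>z. v (x + z) * ?k z)" for x
    using integrable_shift_kernel[OF p v bnd h] .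
  have I_le: "\<bar>LINT z|lborel. v (x + z) * ?k z\<bar> \<le> M * \<kappa>" for x
  proof -
    have "\<bar>LINT z|lborel. v (x + z) * ?k z\<bar> \<le> (LINT z|lborel. \<bar>v (x + z) * ?k z\<bar>)"
      using integral_norm_bound[of lborel "\<lambda>z. v (x + z) * ?k z"] by simp
    also have "\<dots> \<le> (LINT z|lborel. M * ?k z)"
    proof (rule Bochner_Integration.integral_mono)
      show "integrable lborel (\<lambda>z. \<bar>v (x + z) * ?k z\<bar>)" using integrable_abs[OF iv] .
      show "\<bar>v (x + z) * ?k z\<bar> \<le> M * ?k z" for z
        using bnd by (simp add: abs_mult mult_right_mono)
    qed (use ik in simp)
    finally show ?thesis by (simp add: \<kappa>_def)
  qed
  have nI_le: "(LINT z|lborel. norm (F (x, z))) \<le> M * \<kappa> * \<bar>\<psi> x\<bar>" for x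
  proof -
    have "(LINT z|lborel. norm (F (x, z))) \<le> (LINT z|lborel. \<bar>\<psi> x\<bar> * (M * ?k z))"
    proof (rule Bochner_Integration.integral_mono)
      show "integrable lborel (\<lambda>z. norm (F (x, z)))"
        using integrable_mult_right[OF integrable_abs[OF iv], of "\<bar>\<psi> x\<bar>"] by (simp add: F_def abs_mult)
      show "norm (F (x, z)) \<le> \<bar>\<psi> x\<bar> * (M * ?k z)" for z
        using bnd by (simp add: F_def abs_mult mult_left_mono mult_right_mono)
    qed (use ik in simp)
    then show ?thesis by (simp add: \<kappa>_def mult_ac)
  qed
  have iF: "integrable (lborel \<Otimes>\<^sub>M lborel) F"
  proof (rule lborel_pair.Fubini_integrable)
    show "integrable lborel (\<lambda>x. LINT z|lborel. norm (F (x, z)))"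
    proof (rule Bochner_Integration.integrable_bound)
      show "integrable lborel (\<lambda>x. M * \<kappa> * \<psi> x)" using \<psi>(1) by simp
      show "AE x in lborel. norm (LINT z|lborel. norm (F (x, z))) \<le> norm (M * \<kappa> * \<psi> x)"
      proof (intro AE_I2)
        fix x
        have "M * \<kappa> * \<bar>\<psi> x\<bar> \<le> \<bar>M * \<kappa> * \<psi> x\<bar>" by (metis abs_ge_self abs_mult abs_ge_zero mult_right_mono)
        moreover have "0 \<le> (LINT z|lborel. norm (F (x, z)))" by (intro Bochner_Integration.integral_nonneg) auto
        ultimately show "norm (LINT z|lborel. norm (F (x, z))) \<le> norm (M * \<kappa> * \<psi> x)"
          using nI_le[of x] by simp
      qed
    qed simp
    show "AE x in lborel. integrable lborel (\<lambda>z. F (x, z))"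
      using iv by (auto simp: F_def)
  qed (fact Fm)
  have "(LINT x|lborel. \<psi> x * (LINT z|lborel. v (x + z) * ?k z)) = (LINT x|lborel. LINT z|lborel. F (x, z))"
    by (simp add: F_def)
  also have "\<dots> = (LINT z|lborel. LINT x|lborel. F (x, z))"
    using lborel_pair.Fubini_integral[of "\<lambda>x z. F (x, z)"] iF by simp
  also have "\<dots> = (LINT z|lborel. LINT x|lborel. \<psi> (x - z) * (v x * ?k z))"
  proof (rule Bochner_Integration.integral_cong)
    fix z
    show "(LINT x|lborel. F (x, z)) = (LINT x|lborel. \<psi> (x - z) * (v x * ?k z))"
      using integral_translate[of "\<lambda>x. \<psi> (x - z) * (v x * ?k z)" z]
      by (simp add: F_def add.commute)
  qed simp
  also have "\<dots> = (LINT z|lborel. LINT x|lborel. \<psi> (x + z) * (v x * ?k z))"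
    using integral_reflect[of "\<lambda>z. LINT x|lborel. \<psi> (x + z) * (v x * ?k z)"] by simp
  finally have 1: "(LINT x|lborel. \<psi> x * (LINT z|lborel. v (x + z) * ?k z))
      = (LINT z|lborel. LINT x|lborel. \<psi> (x + z) * (v x * ?k z))" .
  define G where "G = (\<lambda>(x, z). v x * (\<psi> (x + z) * ?k z))"
  have Gm [measurable]: "G \<in> borel_measurable (lborel \<Otimes>\<^sub>M lborel)" unfolding G_def by measurable
  have i\<psi>: "integrable lborel (\<lambda>x. \<psi> (x + z))" for z
  proof -
    have "integrable (distr lborel borel ((+) z)) \<psi>" using \<psi>(1) by (simp add: lborel_distr_plus)
    then show ?thesis by (simp add: integrable_distr_eq add.commute)
  qed
  have iG0: "integrable lborel (\<lambda>x. v x * \<psi> (x + z))" for z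
    using integrable_mult_bounded[OF i\<psi> v bnd] .
  have "integrable (lborel \<Otimes>\<^sub>M lborel) (\<lambda>(z, x). G (x, z))"
  proof (rule lborel_pair.Fubini_integrable)
    show "integrable lborel (\<lambda>z. LINT x|lborel. norm (case (z, x) of (z, x) \<Rightarrow> G (x, z)))"
    proof (rule Bochner_Integration.integrable_bound)
      show "integrable lborel (\<lambda>z. M * (LINT x|lborel. \<bar>\<psi> x\<bar>) * ?k z)" using ik by simp
      show "AE z in lborel. norm (LINT x|lborel. norm (case (z, x) of (z, x) \<Rightarrow> G (x, z)))
          \<le> norm (M * (LINT x|lborel. \<bar>\<psi> x\<bar>) * ?k z)"
      proof (intro AE_I2)
        fix z
        have "(LINT x|lborel. norm (G (x, z))) \<le> (LINT x|lborel. ?k z * (M * \<bar>\<psi> (x + z)\<bar>))"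
        proof (rule Bochner_Integration.integral_mono)
          show "integrable lborel (\<lambda>x. norm (G (x, z)))"
            using integrable_mult_left[OF integrable_norm[OF iG0], where c="?k z"]
            by (simp add: G_def abs_mult mult_ac)
          show "integrable lborel (\<lambda>x. ?k z * (M * \<bar>\<psi> (x + z)\<bar>))"
            using integrable_abs[OF i\<psi>[of z]] by simp
          show "norm (G (x, z)) \<le> ?k z * (M * \<bar>\<psi> (x + z)\<bar>)" for x
            using mult_right_mono[OF bnd, of "\<bar>\<psi> (x + z)\<bar> * ?k z" x] by (simp add: G_def abs_mult mult_ac)
        qed
        also have "\<dots> = M * (LINT x|lborel. \<bar>\<psi> x\<bar>) * ?k z"
          using integral_translate[of "\<lambda>x. \<bar>\<psi> x\<bar>" z] by (simp add: add.commute)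
        finally have "(LINT x|lborel. norm (G (x, z))) \<le> M * (LINT x|lborel. \<bar>\<psi> x\<bar>) * ?k z" .
        moreover have "0 \<le> (LINT x|lborel. norm (G (x, z)))"
          by (intro Bochner_Integration.integral_nonneg) auto
        ultimately show "norm (LINT x|lborel. norm (case (z, x) of (z, x) \<Rightarrow> G (x, z)))
          \<le> norm (M * (LINT x|lborel. \<bar>\<psi> x\<bar>) * ?k z)" by simp
      qed
    qed simp
    show "AE z in lborel. integrable lborel (\<lambda>x. case (z, x) of (z, x) \<Rightarrow> G (x, z))"
      using integrable_mult_left[OF iG0] by (intro AE_I2) (simp add: G_def mult.assoc)
  qed simp
  from lborel_pair.integrable_product_swap[OF this]
  have iG: "integrable (lborel \<Otimes>\<^sub>M lborel) G" by (simp add: split_def)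
  have "(LINT z|lborel. LINT x|lborel. \<psi> (x + z) * (v x * ?k z)) = (LINT z|lborel. LINT x|lborel. G (x, z))"
    by (simp add: G_def mult_ac)
  also have "\<dots> = (LINT x|lborel. LINT z|lborel. G (x, z))"
    using lborel_pair.Fubini_integral[of "\<lambda>x z. G (x, z)"] iG by simp
  also have "\<dots> = (LINT x|lborel. v x * (LINT z|lborel. \<psi> (x + z) * ?k z))"
    by (simp add: G_def)
  finally have 2: "(LINT x|lborel. \<psi> x * (LINT z|lborel. v (x + z) * ?k z))
      = (LINT x|lborel. v x * (LINT z|lborel. \<psi> (x + z) * ?k z))" using 1 by simp
  have "(LINT x|lborel. \<psi> x * trunc_gen p h v x)
      = (LINT x|lborel. \<psi> x * (LINT z|lborel. v (x + z) * ?k z) - \<kappa> * (v x * \<psi> x))"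
    by (simp add: expand[OF v bnd] right_diff_distrib mult.left_commute mult.commute[of "\<psi> _" "v _"])
  also have "\<dots> = (LINT x|lborel. \<psi> x * (LINT z|lborel. v (x + z) * ?k z)) - (LINT x|lborel. \<kappa> * (v x * \<psi> x))"
  proof (rule Bochner_Integration.integral_diff)
    show "integrable lborel (\<lambda>x. \<psi> x * (LINT z|lborel. v (x + z) * ?k z))"
      using integrable_mult_bounded[OF \<psi>(1) _ I_le] by (simp add: mult.commute)
    show "integrable lborel (\<lambda>x. \<kappa> * (v x * \<psi> x))"
      using integrable_mult_bounded[OF \<psi>(1) v bnd] by simp
  qed
  also have "\<dots> = (LINT x|lborel. v x * (LINT z|lborel. \<psi> (x + z) * ?k z)) - (LINT x|lborel. \<kappa> * (v x * \<psi> x))"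
    unfolding 2 ..
  also have "\<dots> = (LINT x|lborel. v x * (LINT z|lborel. \<psi> (x + z) * ?k z) - \<kappa> * (v x * \<psi> x))"
  proof (rule Bochner_Integration.integral_diff[symmetric])
    show "integrable lborel (\<lambda>x. \<kappa> * (v x * \<psi> x))"
      using integrable_mult_bounded[OF \<psi>(1) v bnd] by simp
    have "integrable lborel (\<lambda>x. LINT z|lborel. G (x, z))"
      using lborel_pair.integrable_fst'[OF iG] .
    then show "integrable lborel (\<lambda>x. v x * (LINT z|lborel. \<psi> (x + z) * ?k z))"
      by (simp add: G_def)
  qed
  also have "\<dots> = (LINT x|lborel. v x * trunc_gen p h \<psi> x)"
    by (simp add: expand[OF \<psi>m \<psi>(2)] right_diff_distrib mult.left_commute)
  finally show ?thesis .
qed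

section \<open>Test functions\<close>

text \<open>Taylor expansion at \<open>0\<close>; \<open>B0\<close> is the second derivative at
  \<open>- 1/2\<close>, its largest value on the range considered. The linear term is kept exactly
  because in a second difference two such terms combine to a favourable sign.\<close>

lemma powr_second_order:
  fixes \<kappa> :: real
  assumes "\<kappa> > 0"
  shows "\<exists>B\<ge>0. \<forall>\<theta>. \<bar>\<theta>\<bar> \<le> 1/2 \<longrightarrow> (1 + \<theta>) powr - \<kappa> \<le> 1 - \<kappa> * \<theta> + B * \<theta>\<^sup>2 \<and>
    \<bar>(1 + \<theta>) powr - \<kappa> - 1\<bar> \<le> B * \<bar>\<theta>\<bar>"
proof -
  define B0 where "B0 = \<kappa> * (\<kappa> + 1) * (1/2) powr (- \<kappa> - 2)"
  define diff where "diff m \<theta> = (if m = 0 then (1 + \<theta>) powr - \<kappa>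
    else if m = 1 then - \<kappa> * (1 + \<theta>) powr (- \<kappa> - 1)
    else \<kappa> * (\<kappa> + 1) * (1 + \<theta>) powr (- \<kappa> - 2))" for m :: nat and \<theta> :: real
  have B0: "B0 \<ge> 0" using assms by (simp add: B0_def)
  have tay: "\<exists>e. 0 \<le> e \<and> e \<le> B0 \<and> (1 + \<theta>) powr - \<kappa> = 1 - \<kappa> * \<theta> + e / 2 * \<theta>\<^sup>2" if \<theta>: "\<bar>\<theta>\<bar> \<le> 1/2" for \<theta>
  proof (cases "\<theta> = 0")
    case True
    then show ?thesis using B0 by (intro exI[of _ 0]) simp
  next
    case False
    have "\<exists>t. (if \<theta> < 0 then \<theta> < t \<and> t < 0 else 0 < t \<and> t < \<theta>) \<and>
      (\<lambda>\<theta>. (1 + \<theta>) powr - \<kappa>) \<theta> = (\<Sum>m<2. (diff m 0 / fact m) * (\<theta> - 0)^m) + (diff 2 t / fact 2) * (\<theta> - 0)^2"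
    proof (rule Taylor[where a="-1/2" and b="1/2"])
      show "\<forall>m t. m < 2 \<and> - 1 / 2 \<le> t \<and> t \<le> 1 / 2 \<longrightarrow> (diff m has_real_derivative diff (Suc m) t) (at t)"
      proof (intro allI impI)
        fix m :: nat and t :: real
        assume "m < 2 \<and> - 1 / 2 \<le> t \<and> t \<le> 1 / 2"
        then consider "m = 0" | "m = 1" and "- 1 < t" by linarith
        then show "(diff m has_real_derivative diff (Suc m) t) (at t)"
          using \<open>m < 2 \<and> - 1 / 2 \<le> t \<and> t \<le> 1 / 2\<close>
          by cases (auto simp: diff_def[abs_def] algebra_simps intro!: derivative_eq_intros)
      qed
    qed (use \<theta> False in \<open>auto simp: diff_def\<close>)
    then obtain t where t: "if \<theta> < 0 then \<theta> < t \<and> t < 0 else 0 < t \<and> t < \<theta>"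
      "(1 + \<theta>) powr - \<kappa> = (\<Sum>m<2. (diff m 0 / fact m) * (\<theta> - 0)^m) + (diff 2 t / fact 2) * (\<theta> - 0)^2"
      by blast
    have "t \<ge> - 1/2" using t(1) \<theta> by (auto split: if_splits)
    then have "(1 + t) powr (- \<kappa> - 2) \<le> (1/2) powr (- \<kappa> - 2)"
      using assms by (intro powr_mono2') auto
    then have "diff 2 t \<le> B0" using assms by (auto simp: diff_def B0_def intro!: mult_left_mono)
    moreover have "0 \<le> diff 2 t" using assms by (simp add: diff_def)
    moreover have "(1 + \<theta>) powr - \<kappa> = 1 - \<kappa> * \<theta> + diff 2 t / 2 * \<theta>\<^sup>2"
      using t(2) by (simp add: diff_def numeral_2_eq_2)
    ultimately show ?thesis by blast
  qed
  show ?thesis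
  proof (intro exI[of _ "\<kappa> + B0"] conjI allI impI)
    fix \<theta> :: real assume \<theta>: "\<bar>\<theta>\<bar> \<le> 1/2"
    obtain e where e: "0 \<le> e" "e \<le> B0" "(1 + \<theta>) powr - \<kappa> = 1 - \<kappa> * \<theta> + e / 2 * \<theta>\<^sup>2"
      using tay[OF \<theta>] by blast
    have "e / 2 * \<theta>\<^sup>2 \<le> (\<kappa> + B0) * \<theta>\<^sup>2" using e assms by (intro mult_right_mono) auto
    then show "(1 + \<theta>) powr - \<kappa> \<le> 1 - \<kappa> * \<theta> + (\<kappa> + B0) * \<theta>\<^sup>2" using e by simp
    have "\<theta>\<^sup>2 \<le> \<bar>\<theta>\<bar>" using \<theta> mult_left_le[of "\<bar>\<theta>\<bar>" "\<bar>\<theta>\<bar>"]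
      by (metis abs_ge_zero abs_mult_self_eq order_trans power2_eq_square one_le_numeral divide_le_eq_1_pos mult_1 half_bounded_equal zero_less_numeral)
    then have "e / 2 * \<theta>\<^sup>2 \<le> B0 * \<bar>\<theta>\<bar>" using e by (intro mult_mono) auto
    moreover have "0 \<le> e / 2 * \<theta>\<^sup>2" using e by simp
    moreover have "\<bar>\<kappa> * \<theta>\<bar> = \<kappa> * \<bar>\<theta>\<bar>" using assms by (simp add: abs_mult)
    ultimately show "\<bar>(1 + \<theta>) powr - \<kappa> - 1\<bar> \<le> (\<kappa> + B0) * \<bar>\<theta>\<bar>"
      unfolding e(3) distrib_right by linarith
  qed (use assms B0 in simp)
qed

text \<open>A shift by \<open>z\<close> multiplies \<open>1 + |x|^2\<close> by a factor close to
  \<open>1\<close> uniformly in \<open>x\<close>. All increments are therefore bounded relative to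
  the weight at \<open>x\<close> itself, which is the form in which a Gronwall inequality can use
  them.\<close>

lemma decay_perturb:
  fixes \<kappa> :: real
  assumes "\<kappa> > 0"
  shows "\<exists>B\<ge>0. \<forall>(x::'a::euclidean_space) z. norm z \<le> 1/4 \<longrightarrow>
    decay \<kappa> (x + z) + decay \<kappa> (x - z) - 2 * decay \<kappa> x \<le> B * (norm z)\<^sup>2 * decay \<kappa> x \<and>
    \<bar>decay \<kappa> (x + z) - decay \<kappa> x\<bar> \<le> B * norm z * decay \<kappa> x"
proof -
  obtain B where B: "B \<ge> 0" "\<And>\<theta>. \<bar>\<theta>\<bar> \<le> 1/2 \<Longrightarrow> (1 + \<theta>) powr - \<kappa> \<le> 1 - \<kappa> * \<theta> + B * \<theta>\<^sup>2"
    "\<And>\<theta>. \<bar>\<theta>\<bar> \<le> 1/2 \<Longrightarrow> \<bar>(1 + \<theta>) powr - \<kappa> - 1\<bar> \<le> B * \<bar>\<theta>\<bar>"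
    using powr_second_order[OF assms] by blast
  \<comment> \<open>The relative change of \<open>1 + |x|^2\<close> under the shift. It is at most
    \<open>2 * norm z\<close>, so \<open>norm z \<le> 1/4\<close> keeps it in the range of the
    expansion.\<close>
  define \<theta> where "\<theta> x z = ((norm z)\<^sup>2 + 2 * (x \<bullet> z)) / (1 + (norm x)\<^sup>2)" for x z :: 'a
  have pos: "1 + (norm x)\<^sup>2 > 0" for x :: 'a by (simp add: add_pos_nonneg)
  have \<theta>: "\<bar>\<theta> x z\<bar> \<le> 2 * norm z" if "norm z \<le> 1/4" for x z :: 'a
  proof -
    have "\<bar>(norm z)\<^sup>2 + 2 * (x \<bullet> z)\<bar> \<le> norm z * norm z + 2 * (norm x * norm z)"
      using Cauchy_Schwarz_ineq2[of x z] unfolding power2_eq_square by (smt (verit) norm_ge_zero mult_nonneg_nonneg)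
    also have "norm z * norm z \<le> 1 * norm z" using that by (intro mult_right_mono) auto
    also have "1 * norm z + 2 * (norm x * norm z) \<le> 2 * norm z * (1 + (norm x)\<^sup>2)"
    proof -
      have "0 \<le> (1 - norm x)\<^sup>2 + (norm x)\<^sup>2" by simp
      then have "1 + 2 * norm x \<le> 2 * (1 + (norm x)\<^sup>2)" by (simp add: power2_eq_square algebra_simps)
      then have "norm z * (1 + 2 * norm x) \<le> norm z * (2 * (1 + (norm x)\<^sup>2))"
        by (intro mult_left_mono) auto
      then show ?thesis by (simp add: algebra_simps)
    qed
    finally show ?thesis using pos[of x] by (simp add: \<theta>_def pos_divide_le_eq)
  qed
  have eq: "decay \<kappa> (x + z) = decay \<kappa> x * (1 + \<theta> x z) powr - \<kappa>" if "norm z \<le> 1/4" for x z :: 'a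
  proof -
    have "(norm (x + z))\<^sup>2 = (norm x)\<^sup>2 + 2 * (x \<bullet> z) + (norm z)\<^sup>2"
      by (simp add: power2_norm_eq_inner inner_add inner_commute)
    then have "1 + (norm (x + z))\<^sup>2 = (1 + (norm x)\<^sup>2) * (1 + \<theta> x z)"
      using pos[of x] by (simp add: \<theta>_def field_simps)
    moreover have "1 + \<theta> x z \<ge> 0" using \<theta>[OF that, of x] that by linarith
    ultimately show ?thesis using pos[of x] by (simp add: decay_def powr_mult)
  qed
  show ?thesis
  proof (intro exI[of _ "8 * B"] conjI allI impI)
    fix x z :: 'a assume z: "norm z \<le> 1/4"
    have z': "norm (- z) \<le> 1/4" using z by simp
    have half: "\<bar>\<theta> x z\<bar> \<le> 1/2" "\<bar>\<theta> x (- z)\<bar> \<le> 1/2" using \<theta>[OF z, of x] \<theta>[OF z', of x] z by auto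
    have sq: "(\<theta> x z)\<^sup>2 \<le> 4 * (norm z)\<^sup>2" "(\<theta> x (- z))\<^sup>2 \<le> 4 * (norm z)\<^sup>2"
      using \<theta>[OF z, of x] \<theta>[OF z', of x] abs_le_square_iff[of "\<theta> x z" "2 * norm z"]
        abs_le_square_iff[of "\<theta> x (- z)" "2 * norm z"] by (auto simp: power_mult_distrib)
    \<comment> \<open>The inner products cancel and leave \<open>2 |z|^2 / (1 + |x|^2)\<close>. The
      linear terms enter with the factor \<open>- \<kappa>\<close> and can thus be dropped.\<close>
    have sum: "0 \<le> \<theta> x z + \<theta> x (- z)" using pos[of x]
      by (simp add: \<theta>_def add_divide_distrib[symmetric] divide_nonneg_pos)
    have "decay \<kappa> (x + z) + decay \<kappa> (x - z) - 2 * decay \<kappa> x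
        = decay \<kappa> x * ((1 + \<theta> x z) powr - \<kappa> + (1 + \<theta> x (- z)) powr - \<kappa> - 2)"
      using eq[OF z, of x] eq[OF z', of x] by (simp add: algebra_simps)
    also have "\<dots> \<le> decay \<kappa> x * (8 * B * (norm z)\<^sup>2)"
    proof (rule mult_left_mono)
      have "(1 + \<theta> x z) powr - \<kappa> + (1 + \<theta> x (- z)) powr - \<kappa> - 2
          \<le> - \<kappa> * (\<theta> x z + \<theta> x (- z)) + (B * (\<theta> x z)\<^sup>2 + B * (\<theta> x (- z))\<^sup>2)"
        using B(2)[OF half(1)] B(2)[OF half(2)] by (simp add: algebra_simps)
      also have "\<dots> \<le> 0 + (B * (4 * (norm z)\<^sup>2) + B * (4 * (norm z)\<^sup>2))"
        using sum sq B(1) assms by (intro add_mono mult_left_mono) (auto simp: mult_nonneg_nonneg)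
      finally show "(1 + \<theta> x z) powr - \<kappa> + (1 + \<theta> x (- z)) powr - \<kappa> - 2 \<le> 8 * B * (norm z)\<^sup>2" by simp
    qed simp
    finally show "decay \<kappa> (x + z) + decay \<kappa> (x - z) - 2 * decay \<kappa> x \<le> 8 * B * (norm z)\<^sup>2 * decay \<kappa> x"
      by (simp add: mult.commute)
    have "\<bar>decay \<kappa> (x + z) - decay \<kappa> x\<bar> = decay \<kappa> x * \<bar>(1 + \<theta> x z) powr - \<kappa> - 1\<bar>"
    proof -
      have "decay \<kappa> (x + z) - decay \<kappa> x = decay \<kappa> x * ((1 + \<theta> x z) powr - \<kappa> - 1)"
        unfolding eq[OF z] by (simp add: algebra_simps)
      then show ?thesis by (simp add: abs_mult abs_of_nonneg[OF decay_nonneg])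
    qed
    also have "\<dots> \<le> decay \<kappa> x * (8 * B * norm z)"
    proof (rule mult_left_mono)
      have "\<bar>(1 + \<theta> x z) powr - \<kappa> - 1\<bar> \<le> B * (2 * norm z)"
        using B(3)[OF half(1)] mult_left_mono[OF \<theta>[OF z, of x] B(1)] by linarith
      also have "\<dots> \<le> 8 * B * norm z" using B(1) by simp
      finally show "\<bar>(1 + \<theta> x z) powr - \<kappa> - 1\<bar> \<le> 8 * B * norm z" .
    qed simp
    finally show "\<bar>decay \<kappa> (x + z) - decay \<kappa> x\<bar> \<le> 8 * B * norm z * decay \<kappa> x"
      by (simp add: mult.commute)
  qed (use B(1) in simp)
qed

text \<open>
  Squaring the positive part of \<open>decay (p / 4) - c\<close> keeps the second differences bounded from above by
  \<open>decay (p / 2)\<close>, uniformly in \<open>c\<close>, while making the support compact for \<open>c > 0\<close>.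
\<close>

definition test_fun :: "real \<Rightarrow> real \<Rightarrow> 'a::euclidean_space \<Rightarrow> real" where
  "test_fun p c x = (max 0 (decay (p / 4) x - c))\<^sup>2"

lemma test_fun_measurable [measurable]: "test_fun p c \<in> borel_measurable borel"
  unfolding test_fun_def by measurable

lemma test_fun_nonneg [simp]: "0 \<le> test_fun p c x"
  by (simp add: test_fun_def)

lemma test_fun_le: "c \<ge> 0 \<Longrightarrow> test_fun p c x \<le> decay (p / 2) x"
  using power_mono[of "max 0 (decay (p / 4) x - c)" "decay (p / 4) x" 2] decay_square[of "p/4" x]
  by (simp add: test_fun_def)

lemma decay_le_1: "q \<ge> 0 \<Longrightarrow> decay q x \<le> 1"
  using powr_mono2'[of "- q" 1 "1 + (norm x)\<^sup>2"] by (simp add: decay_def)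

lemma test_fun_tendsto: "((\<lambda>c. test_fun p c x) \<longlongrightarrow> decay (p / 2) x) (at_right 0)"
proof -
  have "((\<lambda>c. test_fun p c x) \<longlongrightarrow> (max 0 (decay (p / 4) x - 0))\<^sup>2) (at_right 0)"
    unfolding test_fun_def by (intro tendsto_intros)
  then show ?thesis using decay_square[of "p/4" x] by (simp add: max_def)
qed

lemma test_fun_support:
  assumes "p > 0" "c > 0"
  shows "\<exists>R>0. \<forall>x::'a::euclidean_space. norm x > R \<longrightarrow> test_fun p c x = 0"
proof -
  \<comment> \<open>At radius \<open>c powr (- 2 / p)\<close> the upper bound
    \<open>|x| powr (- p / 2)\<close> for \<open>decay (p / 4) x\<close> has fallen to
    \<open>c\<close>.\<close>
  define R where "R = c powr (- 2 / p) + 1"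
  have R: "R > 0" by (simp add: R_def add_nonneg_pos)
  have "test_fun p c x = 0" if "norm x > R" for x :: 'a
  proof -
    have "c powr (- 2 / p) \<le> norm x" using that by (simp add: R_def)
    then have "(c powr (- 2 / p))\<^sup>2 \<le> (norm x)\<^sup>2" by (intro power_mono) auto
    then have "c powr (- 4 / p) \<le> 1 + (norm x)\<^sup>2"
      using assms by (simp add: powr_powr flip: powr_numeral)
    then have "(1 + (norm x)\<^sup>2) powr - (p/4) \<le> (c powr (- 4 / p)) powr - (p/4)"
      using assms by (intro powr_mono2') auto
    also have "\<dots> = c" using assms by (simp add: powr_powr)
    finally show ?thesis by (simp add: test_fun_def decay_def)
  qed
  then show ?thesis using R by blast
qed

text \<open>A second-order Taylor bound from above for \<open>Y \<mapsto> (max 0 (Y - c))^2\<close>,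
  with constants independent of \<open>c\<close>. The coefficient of the linear term is nonnegative,
  so after adding the bounds for two opposite shifts an upper bound on the second difference of the
  argument is enough.\<close>

lemma square_pos_part_le:
  fixes X Y c :: real
  shows "(max 0 (Y - c))\<^sup>2 \<le> (max 0 (X - c))\<^sup>2 + 2 * max 0 (X - c) * (Y - X) + (Y - X)\<^sup>2"
proof (cases "X \<ge> c")
  case True
  have "(max 0 (Y - c))\<^sup>2 \<le> (Y - c)\<^sup>2" by (auto simp: max_def)
  also have "\<dots> = (X - c)\<^sup>2 + 2 * (X - c) * (Y - X) + (Y - X)\<^sup>2" by (simp add: power2_eq_square algebra_simps)
  finally show ?thesis using True by (simp add: max_def)
next
  case False
  show ?thesis
  proof (cases "Y \<ge> c")
    case True
    then have "(Y - c)\<^sup>2 \<le> (Y - X)\<^sup>2" using False by (intro power_mono) auto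
    then show ?thesis using True False by (simp add: max_def)
  qed (use False in \<open>simp add: max_def\<close>)
qed

text \<open>By the triangle inequality at least one of \<open>x + z\<close> and \<open>z\<close> is
  about as far from the origin as \<open>x\<close>, so one of the two factors is at most a multiple
  of \<open>decay (p / 2) x\<close>. The other factor remains and is integrable in
  \<open>z\<close>.\<close>

lemma decay_shift_kernel_le:
  fixes x z :: "'a::euclidean_space"
  assumes "p > 0"
  shows "decay (p / 2) (x + z) * cut_kernel p h z
    \<le> 4 powr (p / 2) * (cut_kernel p h z + decay (p / 2) (x + z)) * decay (p / 2) x"
proof (cases "h < norm z \<and> z \<noteq> 0")
  case True
  then have k: "cut_kernel p h z = norm z powr - p" by (simp add: cut_kernel_def)
  have "norm x \<le> norm (x + z) + norm z" by (metis add_diff_cancel_right' norm_triangle_ineq4)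
  then have "(norm x)\<^sup>2 \<le> (norm (x + z) + norm z)\<^sup>2" by (intro power_mono) auto
  also have "\<dots> \<le> 2 * (norm (x + z))\<^sup>2 + 2 * (norm z)\<^sup>2"
    using sum_squares_bound[of "norm (x + z)" "norm z"] by (simp add: power2_sum)
  finally have tri: "(norm x)\<^sup>2 \<le> 2 * (norm (x + z))\<^sup>2 + 2 * (norm z)\<^sup>2" .
  have x1: "1 + (norm x)\<^sup>2 > 0" by (simp add: add_pos_nonneg)
  have conv: "(A powr - (p/2)) \<le> 4 powr (p/2) * decay (p/2) x" if "A > 0" "1 + (norm x)\<^sup>2 \<le> 4 * A" for A
  proof -
    have "(4 * A) powr - (p/2) \<le> (1 + (norm x)\<^sup>2) powr - (p/2)"
      using that assms x1 by (intro powr_mono2') auto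
    then have "4 powr (p/2) * (4 * A) powr - (p/2) \<le> 4 powr (p/2) * decay (p/2) x"
      by (simp add: decay_def)
    moreover have "4 powr (p/2) * (4 * A) powr - (p/2) = A powr - (p/2)"
      using that by (simp add: powr_mult powr_minus)
    ultimately show ?thesis by (simp only:)
  qed
  consider "1 + (norm x)\<^sup>2 \<le> 4 * (1 + (norm (x + z))\<^sup>2)" | "1 + (norm x)\<^sup>2 \<le> 4 * (norm z)\<^sup>2"
    using tri by fastforce
  then show ?thesis
  proof cases
    case 1
    have "decay (p / 2) (x + z) \<le> 4 powr (p/2) * decay (p/2) x"
      using conv[OF _ 1] by (simp add: decay_def add_pos_nonneg)
    then have "decay (p / 2) (x + z) * cut_kernel p h z \<le> 4 powr (p/2) * decay (p/2) x * cut_kernel p h z"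
      by (intro mult_right_mono) auto
    also have "\<dots> \<le> 4 powr (p / 2) * (cut_kernel p h z + decay (p / 2) (x + z)) * decay (p / 2) x"
      by (simp add: algebra_simps)
    finally show ?thesis .
  next
    case 2
    have "norm z powr - p = ((norm z)\<^sup>2) powr - (p/2)" using True by (simp add: powr_powr flip: powr_numeral)
    also have "\<dots> \<le> 4 powr (p/2) * decay (p/2) x" using conv[OF _ 2] True by simp
    finally have "decay (p / 2) (x + z) * cut_kernel p h z \<le> decay (p / 2) (x + z) * (4 powr (p/2) * decay (p/2) x)"
      unfolding k by (intro mult_left_mono) auto
    also have "\<dots> \<le> 4 powr (p / 2) * (cut_kernel p h z + decay (p / 2) (x + z)) * decay (p / 2) x"
      by (simp add: algebra_simps)
    finally show ?thesis .
  qed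
qed (auto simp: cut_kernel_def)

text \<open>Shifts up to \<open>1/4\<close> are treated through second differences; for longer ones
  the negative term is dropped and \<open>decay_shift_kernel_le\<close> applies. An upper bound
  suffices because it gets multiplied by a nonnegative function. The constant is uniform in
  \<open>c\<close> and \<open>h\<close>, so both may later tend to \<open>0\<close>.\<close>

lemma trunc_gen_test_fun:
  assumes p: "real DIM('a) < p" "p < real DIM('a) + 2"
  shows "\<exists>C\<ge>0. \<forall>c\<ge>0. \<forall>h. 0 < h \<longrightarrow> h \<le> 1/4 \<longrightarrow> (\<forall>x::'a::euclidean_space.
    trunc_gen p h (test_fun p c) x \<le> C * decay (p / 2) x)"
proof -
  have p0: "p > 0" using p by (smt (verit) of_nat_0_le_iff)
  obtain B where B: "B \<ge> 0" "\<And>(x::'a) z. norm z \<le> 1/4 \<Longrightarrow>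
      decay (p/4) (x + z) + decay (p/4) (x - z) - 2 * decay (p/4) x \<le> B * (norm z)\<^sup>2 * decay (p/4) x"
    "\<And>(x::'a) z. norm z \<le> 1/4 \<Longrightarrow> \<bar>decay (p/4) (x + z) - decay (p/4) x\<bar> \<le> B * norm z * decay (p/4) x"
    using decay_perturb[of "p/4", where 'a='a] p0 by auto
  \<comment> \<open>\<open>B\<close> stems from the linear term acting on the second difference of
    \<open>decay (p / 4)\<close>, the square of \<open>B\<close> from the two squared
    increments.\<close>
  define A where "A = B + B\<^sup>2"
  have A: "A \<ge> 0" using B(1) by (simp add: A_def)
  define m where "m = near_mass TYPE('a) p (1/4)"
  define C1 where "C1 = (LINT z|lborel. cut_kernel p (1/4) (z::'a)) + (LINT z|lborel. decay (p/2) (z::'a))"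
  have ik: "integrable lborel (cut_kernel p (1/4) :: 'a \<Rightarrow> real)" using p by (intro integrable_cut_kernel) auto
  have idec: "integrable lborel (decay (p/2) :: 'a \<Rightarrow> real)" using p by (intro integrable_decay) auto
  have C1: "C1 \<ge> 0" unfolding C1_def by (intro add_nonneg_nonneg Bochner_Integration.integral_nonneg) auto
  show ?thesis
  proof (intro exI[of _ "A * m + 4 powr (p/2) * C1"] conjI allI impI)
    show "0 \<le> A * m + 4 powr (p/2) * C1" using A C1 near_mass_nonneg[where 'a='a, of p "1/4"] by (simp add: m_def)
    fix c h :: real and x :: 'a
    assume c: "0 \<le> c" and h: "0 < h" "h \<le> 1/4"
    let ?Q = "decay (p/4) :: 'a \<Rightarrow> real"
    have bnd: "\<bar>test_fun p c y\<bar> \<le> 1" for y :: 'a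
      using test_fun_le[OF c, of p y] decay_le_1[of "p/2" y] p0 by simp
    have sd: "test_fun p c (x + z) + test_fun p c (x - z) - 2 * test_fun p c x
        \<le> 2 * (A * decay (p/2) x) * (norm z)\<^sup>2" if z: "norm z \<le> 1/4" for z
    proof -
      let ?X = "?Q x" and ?P = "?Q (x + z)" and ?M = "?Q (x - z)" and ?g = "max 0 (?Q x - c)"
      have z': "norm (- z) \<le> 1/4" using z by simp
      have "test_fun p c (x + z) + test_fun p c (x - z) - 2 * test_fun p c x
          \<le> 2 * ?g * (?P + ?M - 2 * ?X) + ((?P - ?X)\<^sup>2 + (?M - ?X)\<^sup>2)"
        using square_pos_part_le[of ?P c ?X] square_pos_part_le[of ?M c ?X]
        unfolding test_fun_def by (simp add: algebra_simps)
      also have "\<dots> \<le> 2 * ?X * (B * (norm z)\<^sup>2 * ?X) + ((B * norm z * ?X)\<^sup>2 + (B * norm z * ?X)\<^sup>2)"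
      proof (intro add_mono)
        have "2 * ?g * (?P + ?M - 2 * ?X) \<le> 2 * ?g * (B * (norm z)\<^sup>2 * ?X)"
          using B(2)[OF z, of x] by (intro mult_left_mono) auto
        also have "\<dots> \<le> 2 * ?X * (B * (norm z)\<^sup>2 * ?X)"
          using c B(1) by (intro mult_right_mono) (auto simp: max_def)
        finally show "2 * ?g * (?P + ?M - 2 * ?X) \<le> 2 * ?X * (B * (norm z)\<^sup>2 * ?X)" .
        show "(?P - ?X)\<^sup>2 \<le> (B * norm z * ?X)\<^sup>2"
          using B(3)[OF z, of x] by (intro abs_le_square_iff[THEN iffD1]) simp
        show "(?M - ?X)\<^sup>2 \<le> (B * norm z * ?X)\<^sup>2"
          using B(3)[OF z', of x] by (intro abs_le_square_iff[THEN iffD1]) simp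
      qed
      also have "\<dots> = 2 * (A * ?X\<^sup>2) * (norm z)\<^sup>2"
        by (simp add: A_def power2_eq_square algebra_simps)
      finally show ?thesis using decay_square[of "p/4" x] by simp
    qed
    have "trunc_gen p h (test_fun p c) x
        \<le> A * decay (p/2) x * near_mass TYPE('a) p (1/4) + trunc_gen p (1/4) (test_fun p c) x"
      using h A p sd by (intro trunc_gen_le[OF p(1) _ bnd]) auto
    also have "trunc_gen p (1/4) (test_fun p c) x \<le> 4 powr (p/2) * C1 * decay (p/2) x"
    proof -
      have it: "integrable lborel (\<lambda>z. decay (p/2) (x + z))"
      proof -
        have "integrable (distr lborel borel ((+) x)) (decay (p/2))" using idec by (simp add: lborel_distr_plus)
        then show ?thesis by (simp add: integrable_distr_eq)
      qed
      have "trunc_gen p (1/4) (test_fun p c) x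
          \<le> (LINT z|lborel. 4 powr (p / 2) * decay (p / 2) x * (cut_kernel p (1/4) z + decay (p / 2) (x + z)))"
        unfolding trunc_gen_def
      proof (rule Bochner_Integration.integral_mono)
        show "integrable lborel (\<lambda>z. (test_fun p c (x + z) - test_fun p c x) * cut_kernel p (1/4) z)"
          by (intro integrable_trunc_gen[OF p(1) _ bnd]) auto
        show "integrable lborel (\<lambda>z. 4 powr (p / 2) * decay (p / 2) x * (cut_kernel p (1/4) z + decay (p / 2) (x + z)))"
          using ik it by simp
        fix z :: 'a
        have "(test_fun p c (x + z) - test_fun p c x) * cut_kernel p (1/4) z
            \<le> decay (p/2) (x + z) * cut_kernel p (1/4) z"
          using test_fun_le[OF c, of p "x + z"] test_fun_nonneg[of p c x]
          by (intro mult_right_mono cut_kernel_nonneg) linarith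
        also have "\<dots> \<le> 4 powr (p / 2) * (cut_kernel p (1/4) z + decay (p / 2) (x + z)) * decay (p / 2) x"
          by (rule decay_shift_kernel_le[OF p0])
        finally show "(test_fun p c (x + z) - test_fun p c x) * cut_kernel p (1/4) z
          \<le> 4 powr (p / 2) * decay (p / 2) x * (cut_kernel p (1/4) z + decay (p / 2) (x + z))"
          by (simp add: mult_ac)
      qed
      also have "\<dots> = 4 powr (p / 2) * decay (p / 2) x * (LINT z|lborel. cut_kernel p (1/4) z + decay (p / 2) (x + z))"
        by simp
      also have "(LINT z|lborel. cut_kernel p (1/4) z + decay (p / 2) (x + z)) = C1"
        using ik it integral_translate[of "decay (p/2)" x] unfolding C1_def by simp
      finally show ?thesis by (simp add: mult_ac)
    qed
    finally show "trunc_gen p h (test_fun p c) x \<le> (A * m + 4 powr (p/2) * C1) * decay (p/2) x"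
      by (simp add: m_def algebra_simps)
  qed
qed

section \<open>Sup-convolution\<close>

text \<open>The set where \<open>\<phi>\<close> is at least \<open>\<phi> \<beta>\<close> is closed
  and contains \<open>\<beta>\<close>. A left step from its infimum would produce a smaller member,
  so the infimum is \<open>\<alpha>\<close>. One step per point is all that an estimate of left
  difference quotients provides.\<close>

lemma nonincreasing_from_left_steps:
  fixes \<phi> :: "real \<Rightarrow> real"
  assumes "\<alpha> \<le> \<beta>" and cont: "continuous_on {\<alpha>..\<beta>} \<phi>"
    and step: "\<And>t. \<alpha> < t \<Longrightarrow> t \<le> \<beta> \<Longrightarrow> \<exists>h>0. h \<le> t - \<alpha> \<and> \<phi> t \<le> \<phi> (t - h)"
  shows "\<phi> \<beta> \<le> \<phi> \<alpha>"
proof -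
  define S where "S = {t \<in> {\<alpha>..\<beta>}. \<phi> \<beta> \<le> \<phi> t}"
  have "closed S" unfolding S_def
    using continuous_on_closed_Collect_le[of "{\<alpha>..\<beta>}" "\<lambda>_. \<phi> \<beta>" \<phi>] cont by auto
  have ne: "\<beta> \<in> S" using assms(1) by (simp add: S_def)
  have bdd: "bdd_below S" by (auto simp: S_def intro!: bdd_belowI[of _ \<alpha>])
  define t where "t = Inf S"
  have tS: "t \<in> S" unfolding t_def using closed_contains_Inf[OF _ bdd \<open>closed S\<close>] ne by auto
  have "t = \<alpha>"
  proof (rule ccontr)
    assume "t \<noteq> \<alpha>"
    then have "\<alpha> < t" "t \<le> \<beta>" using tS by (auto simp: S_def)
    then obtain h where h: "h > 0" "h \<le> t - \<alpha>" "\<phi> t \<le> \<phi> (t - h)" using step by blast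
    then have "t - h \<in> S" using tS \<open>t \<le> \<beta>\<close> by (auto simp: S_def)
    then show False using cInf_lower[OF _ bdd, of "t - h"] h(1) by (simp add: t_def)
  qed
  then show ?thesis using tS by (simp add: S_def)
qed

text \<open>The supremum runs over \<open>K\<close> only; the maximum with \<open>0\<close>
  regularises the positive part and gives a function on the whole space without destroying
  semiconvexity. It is applied with \<open>real \<times> 'a\<close> for \<open>'b\<close>, so that
  time and space are regularised together.\<close>

definition sup_conv :: "('b::euclidean_space) set \<Rightarrow> ('b \<Rightarrow> real) \<Rightarrow> real \<Rightarrow> 'b \<Rightarrow> real" where
  "sup_conv K V \<delta> z = max 0 (SUP k\<in>K. V k - (dist z k)\<^sup>2 / (2 * \<delta>))"

context
  fixes K :: "('b::euclidean_space) set" and V :: "'b \<Rightarrow> real"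
  assumes K: "compact K" "K \<noteq> {}" and V: "continuous_on K V"
begin

lemma sup_conv_attained:
  "\<exists>k\<in>K. (SUP k\<in>K. V k - (dist z k)\<^sup>2 / (2 * \<delta>)) = V k - (dist z k)\<^sup>2 / (2 * \<delta>)"
proof -
  have "continuous_on K (\<lambda>k. V k - (dist z k)\<^sup>2 / (2 * \<delta>))"
    using V by (cases "\<delta> = 0") (auto intro!: continuous_intros)
  then obtain k where k: "k \<in> K" "\<And>j. j \<in> K \<Longrightarrow> V j - (dist z j)\<^sup>2 / (2 * \<delta>) \<le> V k - (dist z k)\<^sup>2 / (2 * \<delta>)"
    using continuous_attains_sup[OF K] by blast
  have "(SUP k\<in>K. V k - (dist z k)\<^sup>2 / (2 * \<delta>)) = V k - (dist z k)\<^sup>2 / (2 * \<delta>)"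
    by (rule cSup_eq_maximum) (use k in auto)
  then show ?thesis using k(1) by blast
qed

lemma sup_conv_ge: "k \<in> K \<Longrightarrow> V k - (dist z k)\<^sup>2 / (2 * \<delta>) \<le> sup_conv K V \<delta> z"
proof -
  assume k: "k \<in> K"
  have "compact ((\<lambda>k. V k - (dist z k)\<^sup>2 / (2 * \<delta>)) ` K)"
    using V K(1) by (intro compact_continuous_image) (cases "\<delta> = 0"; auto intro!: continuous_intros)+
  then have "bdd_above ((\<lambda>k. V k - (dist z k)\<^sup>2 / (2 * \<delta>)) ` K)"
    by (simp add: bounded_imp_bdd_above compact_imp_bounded)
  then show ?thesis unfolding sup_conv_def
    using cSUP_upper[OF k, of "\<lambda>k. V k - (dist z k)\<^sup>2 / (2 * \<delta>)"] by (intro max.coboundedI2) simp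
qed

lemma sup_conv_nonneg [simp]: "0 \<le> sup_conv K V \<delta> z"
  by (simp add: sup_conv_def)

lemma sup_conv_cases:
  obtains "sup_conv K V \<delta> z = 0"
  | k where "k \<in> K" "sup_conv K V \<delta> z = V k - (dist z k)\<^sup>2 / (2 * \<delta>)" "sup_conv K V \<delta> z > 0"
  using sup_conv_attained[of z \<delta>] unfolding sup_conv_def by (smt (verit))

lemma sup_conv_le:
  assumes "\<delta> > 0" "M \<ge> 0" "\<And>k. k \<in> K \<Longrightarrow> V k \<le> M"
  shows "sup_conv K V \<delta> z \<le> M"
proof (cases rule: sup_conv_cases[of \<delta> z])
  case (2 k)
  have "0 \<le> (dist z k)\<^sup>2 / (2 * \<delta>)" using assms(1) by simp
  then show ?thesis using 2 assms(3)[of k] by linarith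
qed (use assms(2) in simp)

text \<open>The maximizer for \<open>z\<close> also competes at \<open>z'\<close>, so the values
  differ by at most the difference of the penalties. Continuity and the Lipschitz bound in time both
  come from this.\<close>

lemma sup_conv_diff_le:
  assumes "\<delta> > 0" "e \<ge> 0"
    and "\<And>k. k \<in> K \<Longrightarrow> (dist z' k)\<^sup>2 - (dist z k)\<^sup>2 \<le> 2 * \<delta> * e"
  shows "sup_conv K V \<delta> z - sup_conv K V \<delta> z' \<le> e"
proof (cases rule: sup_conv_cases[of \<delta> z])
  case 1
  then show ?thesis using assms(2) sup_conv_nonneg[of \<delta> z'] by linarith
next
  case (2 k)
  have "((dist z' k)\<^sup>2 - (dist z k)\<^sup>2) / (2 * \<delta>) \<le> e"
    using assms(3)[OF 2(1)] assms(1) by (simp add: pos_divide_le_eq mult.commute)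
  then show ?thesis using 2(2) sup_conv_ge[OF 2(1), of z' \<delta>] by (simp add: diff_divide_distrib)
qed

lemma sup_conv_continuous:
  assumes "\<delta> > 0"
  shows "continuous_on A (sup_conv K V \<delta>)"
proof -
  have "isCont (sup_conv K V \<delta>) z" for z
  proof -
    obtain B where B: "\<And>k. k \<in> K \<Longrightarrow> dist z k \<le> B"
      using compact_imp_bounded[OF K(1)] bounded_any_center[of K z] by auto
    have B0: "B \<ge> 0" using B K(2) zero_le_dist order_trans by blast
    have bound: "dist (sup_conv K V \<delta> z') (sup_conv K V \<delta> z) \<le> dist z' z * (2 * B + 1) / (2 * \<delta>)"
      if z': "dist z' z < 1" for z'
    proof -
      have "\<bar>(dist z' k)\<^sup>2 - (dist z k)\<^sup>2\<bar> \<le> dist z' z * (2 * B + 1)" if "k \<in> K" for k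
      proof -
        have t: "dist z' k \<le> dist z' z + dist z k" "dist z k \<le> dist z' z + dist z' k"
          by (metis dist_triangle, metis dist_commute dist_triangle)
        have "\<bar>(dist z' k)\<^sup>2 - (dist z k)\<^sup>2\<bar> = \<bar>dist z' k - dist z k\<bar> * (dist z' k + dist z k)"
          by (simp add: power2_eq_square square_diff_square_factored abs_mult mult.commute)
        also have "\<dots> \<le> dist z' z * (2 * B + 1)"
          using t B[OF that] z' by (intro mult_mono) auto
        finally show ?thesis .
      qed
      then have k: "(dist z' k)\<^sup>2 - (dist z k)\<^sup>2 \<le> 2 * \<delta> * (dist z' z * (2 * B + 1) / (2 * \<delta>))"
        "(dist z k)\<^sup>2 - (dist z' k)\<^sup>2 \<le> 2 * \<delta> * (dist z' z * (2 * B + 1) / (2 * \<delta>))" if "k \<in> K" for k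
        using that assms by (fastforce simp: abs_le_iff)+
      have "0 \<le> dist z' z * (2 * B + 1) / (2 * \<delta>)" using B0 assms by simp
      then show ?thesis
        using sup_conv_diff_le[OF assms _ k(1)] sup_conv_diff_le[OF assms _ k(2)]
        by (simp add: dist_real_def abs_le_iff)
    qed
    have "((\<lambda>z'. dist z' z * (2 * B + 1) / (2 * \<delta>)) \<longlongrightarrow> dist z z * (2 * B + 1) / (2 * \<delta>)) (at z)"
      by (intro tendsto_intros) (use assms in auto)
    then have lim: "((\<lambda>z'. dist z' z * (2 * B + 1) / (2 * \<delta>)) \<longlongrightarrow> 0) (at z)" by simp
    have "\<forall>\<^sub>F z' in at z. dist z' z < 1" by (auto simp: eventually_at intro!: exI[of _ 1])
    then have "\<forall>\<^sub>F z' in at z. norm (dist (sup_conv K V \<delta> z') (sup_conv K V \<delta> z)) \<le> dist z' z * (2 * B + 1) / (2 * \<delta>)"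
      by eventually_elim (use bound in simp)
    from Lim_null_comparison[OF this lim] show ?thesis unfolding isCont_def by (subst tendsto_dist_iff)
  qed
  then show ?thesis by (simp add: continuous_at_imp_continuous_on)
qed

text \<open>The maximizer for \<open>z\<close> is kept at both \<open>z + e\<close> and
  \<open>z - e\<close>; by the parallelogram identity the two penalties together exceed twice the
  old one by exactly \<open>(norm e)^2 / \<delta>\<close>. Where the value at \<open>z\<close> is
  \<open>0\<close>, nonnegativity is enough.\<close>

lemma sup_conv_semiconvex:
  assumes "\<delta> > 0"
  shows "sup_conv K V \<delta> (z + e) + sup_conv K V \<delta> (z - e) - 2 * sup_conv K V \<delta> z \<ge> - ((norm e)\<^sup>2 / \<delta>)"
proof (cases rule: sup_conv_cases[of \<delta> z])
  case 1
  have "0 \<le> (norm e)\<^sup>2 / \<delta>" using assms by simp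
  then show ?thesis using 1 sup_conv_nonneg[of \<delta> "z + e"] sup_conv_nonneg[of \<delta> "z - e"] by linarith
next
  case (2 k)
  have "(dist (z + e) k)\<^sup>2 + (dist (z - e) k)\<^sup>2 = 2 * (dist z k)\<^sup>2 + 2 * (norm e)\<^sup>2"
    by (simp add: dist_norm power2_norm_eq_inner inner_simps inner_commute)
  then have "(dist (z + e) k)\<^sup>2 / (2 * \<delta>) + (dist (z - e) k)\<^sup>2 / (2 * \<delta>)
      = 2 * ((dist z k)\<^sup>2 / (2 * \<delta>)) + (norm e)\<^sup>2 / \<delta>"
    using assms by (simp add: field_simps)
  then show ?thesis using sup_conv_ge[OF 2(1), of "z + e" \<delta>] sup_conv_ge[OF 2(1), of "z - e" \<delta>] 2(2)
    by linarith
qed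

lemma sup_conv_tendsto:
  assumes "\<And>n. \<delta> n > 0" "\<delta> \<longlonglongrightarrow> 0"
  shows "(\<lambda>n. sup_conv K V (\<delta> n) z) \<longlonglongrightarrow> (if z \<in> K then max 0 (V z) else 0)"
proof -
  obtain M where M: "M > 0" "\<And>k. k \<in> K \<Longrightarrow> V k \<le> M"
  proof -
    have "bounded (V ` K)" using K V compact_continuous_image compact_imp_bounded by blast
    then obtain M where "M > 0" "\<forall>x\<in>V ` K. norm x \<le> M" using bounded_pos by blast
    then show ?thesis using that[of M] by (auto simp: abs_le_iff)
  qed
  let ?l = "if z \<in> K then max 0 (V z) else 0"
  have up: "\<forall>\<^sub>F n in sequentially. sup_conv K V (\<delta> n) z < ?l + e" if "e > 0" for e
  proof -
    have "\<exists>d>0. \<forall>k\<in>K. dist z k < d \<longrightarrow> V k < ?l + e"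
    proof (cases "z \<in> K")
      case True
      then obtain d where "d > 0" "\<And>k. k \<in> K \<Longrightarrow> dist k z < d \<Longrightarrow> dist (V k) (V z) < e"
        using V \<open>e > 0\<close> unfolding continuous_on_iff by metis
      then show ?thesis using True
        by (intro exI[of _ d]) (fastforce simp: dist_commute dist_real_def)
    next
      case False
      have "open (- K)" using compact_imp_closed[OF K(1)] by auto
      then obtain d where "d > 0" "ball z d \<subseteq> - K" using False openE[of "- K" z] by auto
      then show ?thesis by (intro exI[of _ d]) auto
    qed
    then obtain d where d: "d > 0" "\<And>k. k \<in> K \<Longrightarrow> dist z k < d \<Longrightarrow> V k < ?l + e" by blast
    have "d\<^sup>2 / (2 * M) > 0" using d(1) M(1) by simp
    \<comment> \<open>Once \<open>2 * M * \<delta> n\<close> is below the square of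
      \<open>d\<close>, a maximizer with positive value has penalty less than \<open>M\<close>,
      hence lies within \<open>d\<close> of \<open>z\<close>, where \<open>V\<close> is already
      controlled.\<close>
    from order_tendstoD(2)[OF assms(2) this] show ?thesis
    proof eventually_elim
      case (elim n)
      have pos: "?l + e > 0" using \<open>e > 0\<close> by auto
      show ?case
      proof (cases rule: sup_conv_cases[of "\<delta> n" z])
        case 1
        then show ?thesis using pos by simp
      next
        case (2 k)
        have "(dist z k)\<^sup>2 / (2 * \<delta> n) < M" using 2 M(2)[OF 2(1)] by linarith
        then have "(dist z k)\<^sup>2 < M * (2 * \<delta> n)" using assms(1)[of n] by (simp add: pos_divide_less_eq)
        also have "\<dots> < d\<^sup>2" using elim M(1) by (simp add: field_simps)
        finally have "dist z k < d" using d(1) by (simp add: power_less_imp_less_base)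
        then have "V k < ?l + e" using d(2) 2(1) by blast
        moreover have "0 \<le> (dist z k)\<^sup>2 / (2 * \<delta> n)" using assms(1)[of n] by simp
        ultimately show ?thesis using 2(2) by linarith
      qed
    qed
  qed
  have lo: "?l \<le> sup_conv K V (\<delta> n) z" for n
    using sup_conv_ge[of z z "\<delta> n"] by auto
  show ?thesis
  proof (rule order_tendstoI)
    fix a assume "a < ?l" then show "\<forall>\<^sub>F n in sequentially. a < sup_conv K V (\<delta> n) z"
      using lo less_le_trans by (intro always_eventually) blast
  next
    fix a assume "?l < a" then show "\<forall>\<^sub>F n in sequentially. sup_conv K V (\<delta> n) z < a"
      using up[of "a - ?l"] by simp
  qed
qed

end

lemma AE_zero_continuous_imp_zero:
  fixes f :: "'a::euclidean_space \<Rightarrow> real"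
  assumes "continuous_on UNIV f" "AE x in lborel. f x = 0"
  shows "f x = 0"
proof (rule ccontr)
  assume "f x \<noteq> 0"
  have "open (f -` (- {0}))" using assms(1) by (simp add: open_vimage closed_singleton open_Compl)
  then obtain e where e: "e > 0" "ball x e \<subseteq> f -` (- {0})" using \<open>f x \<noteq> 0\<close> openE by (metis ComplI singletonD vimageI)
  have "AE y in lborel. y \<notin> ball x e" using assms(2) by eventually_elim (use e(2) in auto)
  then have "emeasure lborel (ball x e) = 0" by (subst (asm) AE_iff_measurable[of "ball x e"]) auto
  moreover have "emeasure lborel (ball x e) > 0"
    using e(1) by (simp add: emeasure_ball unit_ball_vol_pos)
  ultimately show False by simp
qed

lemma trunc_gen_measurable [measurable]:
  assumes [measurable]: "v \<in> borel_measurable borel"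
  shows "trunc_gen p h v \<in> borel_measurable borel"
  unfolding trunc_gen_def by measurable

lemma trunc_gen_abs_le:
  fixes v :: "'a::euclidean_space \<Rightarrow> real"
  assumes p: "real DIM('a) < p" and h: "h > 0"
    and v: "v \<in> borel_measurable borel" "\<And>x. \<bar>v x\<bar> \<le> M"
  shows "\<bar>trunc_gen p h v x\<bar> \<le> 2 * M * (LINT z|lborel. cut_kernel p h (z::'a))"
proof -
  have i: "integrable lborel (\<lambda>z. (v (x + z) - v x) * cut_kernel p h z)"
    by (rule integrable_trunc_gen[OF p v h])
  have "\<bar>trunc_gen p h v x\<bar> \<le> (LINT z|lborel. \<bar>(v (x + z) - v x) * cut_kernel p h z\<bar>)"
    unfolding trunc_gen_def using integral_norm_bound[of lborel "\<lambda>z. (v (x + z) - v x) * cut_kernel p h z"] by simp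
  also have "\<dots> \<le> (LINT z|lborel. 2 * M * cut_kernel p h (z::'a))"
  proof (rule Bochner_Integration.integral_mono)
    show "integrable lborel (\<lambda>z::'a. 2 * M * cut_kernel p h z)"
      using integrable_cut_kernel[OF p h] by simp
    show "\<bar>(v (x + z) - v x) * cut_kernel p h z\<bar> \<le> 2 * M * cut_kernel p h z" for z
      using v(2)[of "x + z"] v(2)[of x] by (simp add: abs_mult mult_right_mono)
  qed (use integrable_abs[OF i] in simp)
  finally show ?thesis by simp
qed

section \<open>Subsolutions of the fractional heat equation\<close>

text \<open>Seen from a point \<open>y\<close> of the ball of radius \<open>R + 1\<close>, a target
  \<open>y + z\<close> beyond twice that radius satisfies
  \<open>norm z \<ge> norm (y + z) / 2\<close>. This replacement costs \<open>2 powr p\<close>, and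
  passing from \<open>norm (y + z)\<close> to the weight costs
  \<open>2 powr (p / 2)\<close>.\<close>

lemma cut_kernel_far:
  fixes y z :: "'a::euclidean_space"
  assumes "p > 0" "norm y \<le> R + 1" "norm (y + z) > R'" "R' \<ge> 2 * (R + 1)" "R \<ge> 0"
  shows "cut_kernel p h z \<le> 2 powr (3 * p / 2) * decay (p / 2) (y + z)"
proof -
  let ?r = "norm (y + z)"
  have "2 * norm y \<le> 2 * (R + 1)" using assms(2) by simp
  then have r: "?r \<ge> 2 * norm y" "?r \<ge> 1" using assms(3-5) by auto
  have "?r \<le> norm y + norm z" by (rule norm_triangle_ineq)
  then have z: "norm z \<ge> ?r / 2" using r by linarith
  have r0: "0 < ?r / 2" using r(2) by linarith
  have "cut_kernel p h z \<le> norm z powr - p" by (simp add: cut_kernel_def indicator_def)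
  also have "\<dots> \<le> (?r / 2) powr - p" using z r0 assms(1) by (intro powr_mono2') auto
  also have "\<dots> = 2 powr p * ?r powr - p" using r(2) by (simp add: powr_divide powr_minus field_simps)
  also have "?r powr - p = 2 powr (p / 2) * (2 * ?r\<^sup>2) powr - (p / 2)"
  proof -
    have r1: "?r > 0" using r by linarith
    have "(2 * ?r\<^sup>2) powr - (p / 2) = 2 powr - (p / 2) * (?r\<^sup>2) powr - (p / 2)" by (simp add: powr_mult)
    also have "(?r\<^sup>2) powr - (p / 2) = ?r powr - p" using r1 by (simp add: powr_powr flip: powr_numeral)
    finally show ?thesis by (simp add: powr_minus)
  qed
  also have "(2 * ?r\<^sup>2) powr - (p / 2) \<le> decay (p / 2) (y + z)"
  proof -
    have "1 \<le> ?r\<^sup>2" using r(2) by (simp add: one_le_power)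
    then show ?thesis unfolding decay_def using assms(1)
      by (intro powr_mono2') (auto simp: add_pos_nonneg)
  qed
  also have "2 powr p * (2 powr (p / 2) * decay (p / 2) (y + z)) = 2 powr (3 * p / 2) * decay (p / 2) (y + z)"
    by (simp add: mult.assoc[symmetric] flip: powr_add)
  finally show ?thesis by simp
qed

lemma trunc_gen_uminus: "trunc_gen p h (\<lambda>x. - v x) x = - trunc_gen p h v x"
  unfolding trunc_gen_def by (simp flip: integral_minus) (simp add: algebra_simps)

text \<open>Made for \<open>u - shifted_flat \<beta> a\<close> and, after a contact time, for
  \<open>U - u\<close>. The inequality is asked only where \<open>w\<close> is positive, since there
  monotonicity of \<open>g\<close> fixes the sign of the absorption difference. The masses are
  integrable up to the initial time \<open>a\<close>, so far-field corrections may be accumulated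
  from \<open>a\<close> on.\<close>

locale frac_subsolution =
  fixes p c a :: real and w :: "real \<Rightarrow> 'a::euclidean_space \<Rightarrow> real"
  assumes p: "real DIM('a) < p" "p < real DIM('a) + 2" and c: "c > 0"
    and w_cont: "continuous_on ({a<..} \<times> UNIV) (\<lambda>(t, x). w t x)"
    and w_sub: "\<And>t x. a < t \<Longrightarrow> 0 < w t x \<Longrightarrow> \<exists>D L. ((\<lambda>\<tau>. w \<tau> x) has_real_derivative D) (at t) \<and>
      ((\<lambda>h. - (c * trunc_gen p h (w t) x)) \<longlongrightarrow> L) (at_right 0) \<and> D + L \<le> 0"
    and w_int: "\<And>t x h. a < t \<Longrightarrow> 0 < w t x \<Longrightarrow> 0 < h \<Longrightarrow> integrable lborel (\<lambda>z. (w t (x + z) - w t x) * cut_kernel p h z)"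
    and mass_finite: "\<And>t. a < t \<Longrightarrow> (\<integral>\<^sup>+x. ennreal (max 0 (w t x) * decay (p / 2) x) \<partial>lborel) < \<infinity>"
    and mass_integrable: "\<And>T. a < T \<Longrightarrow>
      (\<integral>\<^sup>+t\<in>{a<..<T}. (\<integral>\<^sup>+x. ennreal (max 0 (w t x) * decay (p / 2) x) \<partial>lborel) \<partial>lborel) < \<infinity>"
begin

lemma p_pos: "p > 0"
  using p(1) by (smt (verit) of_nat_0_le_iff)

section \<open>The positive part, its weighted mass and the far tail\<close>

definition wp :: "real \<Rightarrow> 'a \<Rightarrow> real" where
  "wp t x = (if a < t then max 0 (w t x) else 0)"

definition mass :: "real \<Rightarrow> ennreal" where
  "mass t = (\<integral>\<^sup>+x. ennreal (wp t x * decay (p / 2) x) \<partial>lborel)"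

definition mass_tail :: "real \<Rightarrow> real \<Rightarrow> ennreal" where
  "mass_tail R t = (\<integral>\<^sup>+x. ennreal (wp t x * decay (p / 2) x) * indicator {x. R < norm x} x \<partial>lborel)"

definition tail :: "real \<Rightarrow> real \<Rightarrow> real" where
  "tail R t = enn2real (mass_tail R t)"

lemma wp_nonneg [simp]: "0 \<le> wp t x"
  by (simp add: wp_def)

lemma wp_joint_measurable: "(\<lambda>q. wp (fst q) (snd q)) \<in> borel_measurable (borel \<Otimes>\<^sub>M borel)"
proof -
  let ?A = "{a<..} \<times> (UNIV :: 'a set)"
  have "open ?A" by (intro open_Times) auto
  then have "(\<lambda>q. indicator ?A q *\<^sub>R (case q of (t, x) \<Rightarrow> w t x)) \<in> borel_measurable borel"
    by (intro borel_measurable_continuous_on_indicator w_cont borel_open)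
  then have "(\<lambda>q. max 0 (indicator ?A q *\<^sub>R (case q of (t, x) \<Rightarrow> w t x))) \<in> borel_measurable borel"
    by measurable
  moreover have "(\<lambda>q. max 0 (indicator ?A q *\<^sub>R (case q of (t, x) \<Rightarrow> w t x))) = (\<lambda>q. wp (fst q) (snd q))"
    by (auto simp: fun_eq_iff wp_def indicator_def)
  ultimately show ?thesis by (simp add: borel_prod)
qed

lemma wp_measurable [measurable (raw)]:
  assumes [measurable]: "f \<in> borel_measurable M" "g \<in> borel_measurable M"
  shows "(\<lambda>y. wp (f y) (g y)) \<in> borel_measurable M"
  using measurable_compose[OF _ wp_joint_measurable, of "\<lambda>y. (f y, g y)" M] by simp

lemma mass_measurable [measurable]: "mass \<in> borel_measurable borel"
  unfolding mass_def by measurable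

lemma mass_tail_measurable [measurable]: "mass_tail R \<in> borel_measurable borel"
  unfolding mass_tail_def by measurable

lemma tail_measurable [measurable]: "tail R \<in> borel_measurable borel"
  unfolding tail_def by measurable

lemma w_cont_x:
  assumes "a < t"
  shows "continuous_on UNIV (w t)"
proof -
  have "continuous_on UNIV (\<lambda>x. case (t, x) of (t, x) \<Rightarrow> w t x)"
    by (rule continuous_on_compose2[OF w_cont]) (use assms in \<open>auto intro!: continuous_intros\<close>)
  then show ?thesis by simp
qed

lemma w_cont_t:
  assumes "a < t"
  shows "isCont (\<lambda>\<tau>. w \<tau> x) t"
proof -
  have "continuous_on {a<..} (\<lambda>\<tau>. case (\<tau>, x) of (t, x) \<Rightarrow> w t x)"
    by (rule continuous_on_compose2[OF w_cont]) (auto intro!: continuous_intros)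
  then show ?thesis using assms by (simp add: continuous_on_eq_continuous_at)
qed

lemma mass_fin: "mass t < \<infinity>"
proof (cases "a < t")
  case True
  then show ?thesis using mass_finite[of t] by (simp add: mass_def wp_def)
qed (simp add: mass_def wp_def)

lemma mass_int: "(\<integral>\<^sup>+t\<in>{a<..<T}. mass t \<partial>lborel) < \<infinity>"
proof (cases "a < T")
  case True
  have "(\<integral>\<^sup>+t\<in>{a<..<T}. mass t \<partial>lborel) =
      (\<integral>\<^sup>+t\<in>{a<..<T}. (\<integral>\<^sup>+x. ennreal (max 0 (w t x) * decay (p / 2) x) \<partial>lborel) \<partial>lborel)"
    by (intro nn_integral_cong) (auto simp: mass_def wp_def indicator_def)
  then show ?thesis using mass_integrable[OF True] by simp
next
  case False
  then show ?thesis by simp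
qed

lemma mass_tail_le: "mass_tail R t \<le> mass t"
  unfolding mass_tail_def mass_def by (intro nn_integral_mono) (auto simp: indicator_def)

lemma mass_tail_eq: "mass_tail R t = ennreal (tail R t)"
  using le_less_trans[OF mass_tail_le mass_fin] by (simp add: tail_def)

lemma tail_nonneg [simp]: "0 \<le> tail R t"
  by (simp add: tail_def)

text \<open>
  The tail mass is only integrable in time. Lower semicontinuity is what makes the difference
  quotients of its primitive dominate it at every single time.
\<close>

lemma tail_lsc:
  assumes t: "a < t" and e: "e > 0"
  shows "\<exists>d>0. \<forall>\<tau>. \<bar>\<tau> - t\<bar> < d \<longrightarrow> tail R t - e \<le> tail R \<tau>"
proof (rule ccontr)
  assume "\<not> ?thesis"
  then have "\<forall>n::nat. \<exists>\<tau>. \<bar>\<tau> - t\<bar> < 1 / real (Suc n) \<and> tail R \<tau> < tail R t - e"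
    by (metis of_nat_0_less_iff zero_less_Suc zero_less_divide_1_iff not_le)
  then obtain \<tau> where \<tau>: "\<And>n. \<bar>\<tau> n - t\<bar> < 1 / real (Suc n)" "\<And>n. tail R (\<tau> n) < tail R t - e" by metis
  have lim: "\<tau> \<longlonglongrightarrow> t"
  proof (rule LIM_zero_cancel, rule Lim_null_comparison)
    show "\<forall>\<^sub>F n in sequentially. norm (\<tau> n - t) \<le> 1 / real (Suc n)" using \<tau>(1) by (auto intro!: always_eventually less_imp_le)
    show "(\<lambda>n. 1 / real (Suc n)) \<longlonglongrightarrow> 0" using LIMSEQ_inverse_real_of_nat by (simp add: inverse_eq_divide)
  qed
  have pos: "tail R t - e > 0" using \<tau>(2)[of 0] tail_nonneg[of R "\<tau> 0"] by linarith
  let ?f = "\<lambda>\<tau> x. ennreal (wp \<tau> x * decay (p / 2) x) * indicator {x. R < norm x} x"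
  \<comment> \<open>The integrands converge pointwise by continuity of \<open>w\<close> in time;
    Fatou's lemma bounds the limit by the lower limit of the tails.\<close>
  have "mass_tail R t = (\<integral>\<^sup>+x. liminf (\<lambda>n. ?f (\<tau> n) x) \<partial>lborel)"
    unfolding mass_tail_def
  proof (intro nn_integral_cong)
    fix x
    have "\<forall>\<^sub>F n in sequentially. a < \<tau> n" using order_tendstoD(1)[OF lim t] .
    then have "\<forall>\<^sub>F n in sequentially. wp (\<tau> n) x = max 0 (w (\<tau> n) x)" by eventually_elim (simp add: wp_def)
    moreover have "(\<lambda>n. max 0 (w (\<tau> n) x)) \<longlonglongrightarrow> max 0 (w t x)"
      using isCont_tendsto_compose[OF w_cont_t[OF t] lim] by (intro tendsto_max tendsto_const) auto
    moreover have "wp t x = max 0 (w t x)" using t by (simp add: wp_def)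
    ultimately have "(\<lambda>n. wp (\<tau> n) x) \<longlonglongrightarrow> wp t x"
      by (simp only: tendsto_cong)
    then have "(\<lambda>n. ennreal (wp (\<tau> n) x * decay (p / 2) x * indicator {x. R < norm x} x))
        \<longlonglongrightarrow> ennreal (wp t x * decay (p / 2) x * indicator {x. R < norm x} x)"
      by (intro tendsto_ennrealI tendsto_mult_right)
    then have "(\<lambda>n. ?f (\<tau> n) x) \<longlonglongrightarrow> ?f t x"
      by (cases "R < norm x") simp_all
    then show "?f t x = liminf (\<lambda>n. ?f (\<tau> n) x)" by (metis lim_imp_Liminf trivial_limit_sequentially)
  qed
  also have "\<dots> \<le> liminf (\<lambda>n. mass_tail R (\<tau> n))"
    unfolding mass_tail_def by (intro nn_integral_liminf) measurable
  also have "\<dots> \<le> ennreal (tail R t - e)"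
    unfolding mass_tail_eq
    by (intro Liminf_le always_eventually allI ennreal_leI less_imp_le \<tau>(2) sequentially_bot)
  finally have "tail R t \<le> tail R t - e" using pos by (simp add: mass_tail_eq)
  then show False using e by simp
qed

lemma tail_set_integrable:
  assumes "a < t0"
  shows "set_integrable lborel {t0..T} (tail R)"
  unfolding set_integrable_def
proof (rule integrableI_nonneg)
  have "(\<integral>\<^sup>+t. ennreal (indicator {t0..T} t *\<^sub>R tail R t) \<partial>lborel) \<le> (\<integral>\<^sup>+t\<in>{a<..<T+1}. mass t \<partial>lborel)"
    using assms mass_tail_le[of R] by (intro nn_integral_mono) (auto simp: indicator_def mass_tail_eq)
  also have "\<dots> < \<infinity>" by (rule mass_int)
  finally show "(\<integral>\<^sup>+t. ennreal (indicator {t0..T} t *\<^sub>R tail R t) \<partial>lborel) < \<infinity>" .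
qed auto

lemma tail_integrable_on: "a < t0 \<Longrightarrow> tail R integrable_on {t0..T}"
  by (rule set_borel_integral_eq_integral(1)[OF tail_set_integrable])

lemma tail_integral_bound:
  assumes "a < t0"
  shows "ennreal (integral {t0..T} (tail R)) \<le> (\<integral>\<^sup>+t\<in>{a<..<T}. mass_tail R t \<partial>lborel)"
proof -
  have "ennreal (integral {t0..T} (tail R)) = ennreal (LINT t|lborel. indicator {t0..T} t *\<^sub>R tail R t)"
    using set_borel_integral_eq_integral(2)[OF tail_set_integrable[OF assms, of T R]]
    by (simp add: set_lebesgue_integral_def)
  also have "\<dots> = (\<integral>\<^sup>+t. ennreal (indicator {t0..T} t *\<^sub>R tail R t) \<partial>lborel)"
    using tail_set_integrable[OF assms, of T R]
    by (intro nn_integral_eq_integral[symmetric]) (auto simp: set_integrable_def)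
  also have "\<dots> \<le> (\<integral>\<^sup>+t\<in>{a<..<T}. mass_tail R t \<partial>lborel)"
  proof (rule nn_integral_mono_AE)
    have "AE t in lborel. t \<noteq> T" by (rule AE_lborel_singleton)
    then show "AE t in lborel. ennreal (indicator {t0..T} t *\<^sub>R tail R t) \<le> mass_tail R t * indicator {a<..<T} t"
      by eventually_elim (use assms in \<open>auto simp: indicator_def mass_tail_eq\<close>)
  qed
  finally show ?thesis .
qed

text \<open>The positive part beyond \<open>R'\<close> contributes to the operator at
  \<open>y\<close> at most a multiple of the tail mass, uniformly in \<open>y\<close> and
  \<open>h\<close>. A bound that depends on time alone can be compensated by subtracting a function
  of time.\<close>

lemma far_integral_le:
  assumes t: "a < t" and y: "norm y \<le> R + 1" "R' \<ge> 2 * (R + 1)" "R \<ge> 0"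
  shows "integrable lborel (\<lambda>z. indicator {z. R' < norm (y + z)} z * wp t (y + z) * cut_kernel p h z)"
    "(LINT z|lborel. indicator {z. R' < norm (y + z)} z * wp t (y + z) * cut_kernel p h z)
      \<le> 2 powr (3 * p / 2) * tail R' t"
proof -
  let ?C = "2 powr (3 * p / 2)"
  let ?f = "\<lambda>z. indicator {z. R' < norm (y + z)} z * wp t (y + z) * cut_kernel p h z"
  have "(\<integral>\<^sup>+z. ennreal (?f z) \<partial>lborel)
      \<le> (\<integral>\<^sup>+z. ennreal ?C * (ennreal (wp t (y + z) * decay (p / 2) (y + z)) * indicator {x. R' < norm x} (y + z)) \<partial>lborel)"
  proof (intro nn_integral_mono)
    fix z
    show "ennreal (?f z) \<le> ennreal ?C * (ennreal (wp t (y + z) * decay (p / 2) (y + z)) * indicator {x. R' < norm x} (y + z))"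
    proof (cases "R' < norm (y + z)")
      case True
      have "wp t (y + z) * cut_kernel p h z \<le> wp t (y + z) * (?C * decay (p / 2) (y + z))"
        using cut_kernel_far[OF p_pos y(1) True y(2,3)] by (intro mult_left_mono) auto
      then show ?thesis using True by (simp add: ennreal_leI mult_ac flip: ennreal_mult')
    qed simp
  qed
  also have "\<dots> = ennreal ?C * (\<integral>\<^sup>+z. ennreal (wp t (y + z) * decay (p / 2) (y + z)) * indicator {x. R' < norm x} (y + z) \<partial>lborel)"
    by (intro nn_integral_cmult) measurable
  also have "(\<integral>\<^sup>+z. ennreal (wp t (y + z) * decay (p / 2) (y + z)) * indicator {x. R' < norm x} (y + z) \<partial>lborel)
      = (\<integral>\<^sup>+x. ennreal (wp t x * decay (p / 2) x) * indicator {x. R' < norm x} x \<partial>distr lborel borel ((+) y))"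
    by (subst nn_integral_distr) simp_all
  also have "\<dots> = mass_tail R' t" by (simp add: lborel_distr_plus mass_tail_def)
  also have "ennreal ?C * mass_tail R' t = ennreal (?C * tail R' t)"
    by (simp add: mass_tail_eq ennreal_mult')
  finally have le: "(\<integral>\<^sup>+z. ennreal (?f z) \<partial>lborel) \<le> ennreal (?C * tail R' t)" .
  show i: "integrable lborel ?f"
  proof (rule integrableI_nonneg)
    show "(\<integral>\<^sup>+z. ennreal (?f z) \<partial>lborel) < \<infinity>" using le by (simp add: le_less_trans[OF _ ennreal_less_top])
  qed auto
  have "ennreal (LINT z|lborel. ?f z) \<le> ennreal (?C * tail R' t)"
    using le i by (subst nn_integral_eq_integral[symmetric]) auto
  then show "(LINT z|lborel. ?f z) \<le> ?C * tail R' t" by (simp add: ennreal_le_iff)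
qed

end

text \<open>\<open>R\<close> encloses the support of the test function. Maximizers belonging to
  points of that support lie within \<open>R + 1\<close>, and the gap up to \<open>R'\<close> makes
  everything lost outside the cylinder a far-field term. \<open>\<eta>\<close> is a slack for the
  initial time \<open>t0\<close>. \<open>C\<close> is a parameter so that one constant can serve all
  truncation levels \<open>\<gamma>\<close>.\<close>

locale frac_subsolution_ball = frac_subsolution p c a w
  for p c a :: real and w :: "real \<Rightarrow> 'a::euclidean_space \<Rightarrow> real" +
  fixes t0 T R R' \<eta> \<gamma> C :: real
  assumes t0: "a < t0" "t0 < T" and R: "R > 0" "R' \<ge> 2 * (R + 1)" and \<eta>: "\<eta> > 0"
    and init: "\<And>x. norm x \<le> R' \<Longrightarrow> w t0 x \<le> \<eta>"
    and \<gamma>: "\<gamma> > 0" and supp: "\<And>x::'a. R < norm x \<Longrightarrow> test_fun p \<gamma> x = 0"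
    and C: "C \<ge> 0" "\<And>(x::'a) h. 0 < h \<Longrightarrow> h \<le> 1/4 \<Longrightarrow> trunc_gen p h (test_fun p \<gamma>) x \<le> C * decay (p / 2) x"
begin

text \<open>\<open>c\<close> times the constant of \<open>far_integral_le\<close>, so that the
  growth of \<open>corr\<close> offsets the far-field term exactly.\<close>

definition C' :: real where "C' = c * 2 powr (3 * p / 2)"

definition corr :: "real \<Rightarrow> real" where "corr t = C' * integral {t0..t} (tail R')"

text \<open>Subtracting \<open>\<eta>\<close> makes this nonpositive at time \<open>t0\<close> in
  the ball of radius \<open>R'\<close>. As \<open>corr \<ge> 0\<close>, it is positive only where
  \<open>w\<close> is, which is the region where the subsolution inequality is available.\<close>

definition lowered :: "real \<times> 'a \<Rightarrow> real" where
  "lowered = (\<lambda>(t, x). w t x - \<eta> - corr t)"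

definition cyl :: "(real \<times> 'a) set" where "cyl = {t0..T} \<times> cball 0 R'"

definition reg :: "real \<Rightarrow> real \<Rightarrow> 'a \<Rightarrow> real" where
  "reg \<delta> t x = sup_conv cyl lowered \<delta> (t, x)"

definition sup_bound :: real where "sup_bound = (SUP q\<in>cyl. \<bar>lowered q\<bar>)"

lemma C'_pos: "C' > 0"
  using c by (simp add: C'_def)

lemma corr_diff:
  assumes "t0 \<le> s" "s \<le> t" "t \<le> T"
  shows "corr t - corr s = C' * integral {s..t} (tail R')"
proof -
  have "integral {t0..t} (tail R') = integral {t0..s} (tail R') + integral {s..t} (tail R')"
    using Henstock_Kurzweil_Integration.integral_combine[of t0 s t "tail R'"]
      tail_integrable_on[OF t0(1), of R' t] assms by simp
  then show ?thesis by (simp add: corr_def distrib_left)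
qed

lemma corr_nonneg: "0 \<le> corr t"
  unfolding corr_def using C'_pos tail_integrable_on[OF t0(1), of R' t]
  by (intro mult_nonneg_nonneg Henstock_Kurzweil_Integration.integral_nonneg) auto

lemma corr_t0: "corr t0 = 0"
  by (simp add: corr_def)

lemma corr_cont: "continuous_on {t0..T} corr"
  unfolding corr_def by (intro continuous_intros indefinite_integral_continuous_1 tail_integrable_on t0)

lemma cyl: "compact cyl" "cyl \<noteq> {}"
  using t0 R by (auto simp: cyl_def intro!: compact_Times)

lemma lowered_cont: "continuous_on cyl lowered"
proof -
  have "continuous_on cyl (\<lambda>q. (case q of (t, x) \<Rightarrow> w t x) - \<eta> - corr (fst q))"
  proof (intro continuous_intros)
    show "continuous_on cyl (\<lambda>q. case q of (t, x) \<Rightarrow> w t x)"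
      by (rule continuous_on_subset[OF w_cont]) (use t0 in \<open>auto simp: cyl_def\<close>)
    show "continuous_on cyl (\<lambda>q. corr (fst q))"
      by (rule continuous_on_compose2[OF corr_cont]) (auto simp: cyl_def intro!: continuous_intros)
  qed
  then show ?thesis by (simp add: lowered_def split_def)
qed

lemma sup_bound: "q \<in> cyl \<Longrightarrow> \<bar>lowered q\<bar> \<le> sup_bound"
proof -
  assume q: "q \<in> cyl"
  have "compact ((\<lambda>q. \<bar>lowered q\<bar>) ` cyl)"
    by (intro compact_continuous_image cyl continuous_intros lowered_cont)
  then have "bdd_above ((\<lambda>q. \<bar>lowered q\<bar>) ` cyl)" by (simp add: bounded_imp_bdd_above compact_imp_bounded)
  then show ?thesis unfolding sup_bound_def using cSUP_upper[OF q] by blast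
qed

lemma sup_bound_nonneg: "0 \<le> sup_bound"
  using cyl(2) sup_bound abs_ge_zero order_trans by blast

lemma lowered_init: "norm x \<le> R' \<Longrightarrow> lowered (t0, x) \<le> 0"
  using init corr_t0 by (simp add: lowered_def)

lemma reg_nonneg [simp]: "0 \<le> reg \<delta> t x"
  unfolding reg_def by (rule sup_conv_nonneg[OF cyl lowered_cont])

lemma reg_le: "\<delta> > 0 \<Longrightarrow> reg \<delta> t x \<le> sup_bound"
  unfolding reg_def using sup_bound sup_bound_nonneg
  by (intro sup_conv_le[OF cyl lowered_cont]) (auto simp: abs_le_iff)

lemma reg_abs_le: "\<delta> > 0 \<Longrightarrow> \<bar>reg \<delta> t x\<bar> \<le> sup_bound"
  using reg_le by simp

lemma reg_cont: "\<delta> > 0 \<Longrightarrow> continuous_on A (reg \<delta> t)"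
proof -
  assume "\<delta> > 0"
  from sup_conv_continuous[OF cyl lowered_cont this]
  have "continuous_on UNIV (sup_conv cyl lowered \<delta>)" .
  then have "continuous_on A (\<lambda>x. sup_conv cyl lowered \<delta> (t, x))"
    by (rule continuous_on_compose2) (auto intro!: continuous_intros)
  then show ?thesis by (simp add: reg_def[abs_def])
qed

lemma reg_measurable: "\<delta> > 0 \<Longrightarrow> reg \<delta> t \<in> borel_measurable borel"
  by (intro borel_measurable_continuous_onI reg_cont)

text \<open>The spatial parts of the penalties cancel. The squared time distances differ by at most
  \<open>2 * (T - t0)\<close> times the time difference, because all times lie in
  \<open>{t0..T}\<close>.\<close>

lemma reg_time_lipschitz:
  assumes \<delta>: "\<delta> > 0" and t: "t \<in> {t0..T}" "t1 \<in> {t0..T}"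
  shows "\<bar>reg \<delta> t x - reg \<delta> t1 x\<bar> \<le> \<bar>t - t1\<bar> * ((T - t0) / \<delta>)"
proof -
  have *: "reg \<delta> t x - reg \<delta> t1 x \<le> \<bar>t - t1\<bar> * ((T - t0) / \<delta>)"
    if t: "t \<in> {t0..T}" "t1 \<in> {t0..T}" for t t1
    unfolding reg_def
  proof (rule sup_conv_diff_le[OF cyl lowered_cont \<delta>])
    show "0 \<le> \<bar>t - t1\<bar> * ((T - t0) / \<delta>)" using t0 \<delta> by simp
    fix q assume q: "q \<in> cyl"
    then obtain \<tau> y where [simp]: "q = (\<tau>, y)" and \<tau>: "\<tau> \<in> {t0..T}" by (auto simp: cyl_def)
    have d: "(dist (s, x) q)\<^sup>2 = (s - \<tau>)\<^sup>2 + (dist x y)\<^sup>2" for s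
      by (simp add: dist_Pair_Pair dist_real_def)
    have "(dist (t1, x) q)\<^sup>2 - (dist (t, x) q)\<^sup>2 = (t1 - t) * ((t1 - \<tau>) + (t - \<tau>))"
      unfolding d by (simp add: power2_eq_square algebra_simps)
    also have "\<dots> \<le> \<bar>t1 - t\<bar> * \<bar>(t1 - \<tau>) + (t - \<tau>)\<bar>" by (metis abs_ge_self abs_mult)
    also have "\<dots> \<le> \<bar>t1 - t\<bar> * (2 * (T - t0))" using t \<tau> by (intro mult_left_mono) auto
    also have "\<dots> = 2 * \<delta> * (\<bar>t - t1\<bar> * ((T - t0) / \<delta>))" using \<delta> by (simp add: abs_minus_commute)
    finally show "(dist (t1, x) q)\<^sup>2 - (dist (t, x) q)\<^sup>2 \<le> 2 * \<delta> * (\<bar>t - t1\<bar> * ((T - t0) / \<delta>))" .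
  qed
  show ?thesis using *[OF t] *[OF t(2,1)] by (simp add: abs_le_iff abs_minus_commute)
qed

text \<open>
  At a maximizer \<open>(\<tau>, y)\<close> of the sup-convolution at \<open>(t, x)\<close>, shifting both points by the same vector leaves the
  penalty unchanged, so all differences of \<open>reg \<delta>\<close> at \<open>(t, x)\<close> are controlled by those of \<open>w\<close> at \<open>(\<tau>, y)\<close>.
\<close>

lemma reg_pointwise:
  assumes t: "t0 < t" "t \<le> T" and x: "norm x \<le> R" and \<delta>: "\<delta> > 0" "2 * \<delta> * sup_bound \<le> 1" and e: "e > 0"
  shows "\<forall>\<^sub>F h in at_right 0. (reg \<delta> t x - reg \<delta> (t - h) x) / h - c * trunc_gen p h (reg \<delta> t) x \<le> e"
proof (cases rule: sup_conv_cases[OF cyl lowered_cont, of \<delta> "(t, x)"])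
  case 1
  then have z: "reg \<delta> t x = 0" by (simp add: reg_def)
  have "\<forall>\<^sub>F h in at_right 0. (0::real) < h" by (simp add: eventually_at_filter)
  then show ?thesis
  proof eventually_elim
    case (elim h)
    have "0 \<le> trunc_gen p h (reg \<delta> t) x"
      unfolding trunc_gen_def z by (intro Bochner_Integration.integral_nonneg) auto
    then have "0 \<le> c * trunc_gen p h (reg \<delta> t) x" using c by simp
    moreover have "(reg \<delta> t x - reg \<delta> (t - h) x) / h \<le> 0"
      using elim by (simp add: z divide_nonneg_pos)
    ultimately show ?case using e by linarith
  qed
next
  case (2 q)
  then obtain \<tau> y where q: "q = (\<tau>, y)" by (cases q)
  let ?pen = "(dist (t, x) (\<tau>, y))\<^sup>2 / (2 * \<delta>)"
  have \<tau>y: "\<tau> \<in> {t0..T}" "norm y \<le> R'" using 2(1) by (auto simp: q cyl_def)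
  have eq: "reg \<delta> t x = lowered (\<tau>, y) - ?pen" "reg \<delta> t x > 0" using 2 by (auto simp: reg_def q)
  have pen: "?pen \<ge> 0" using \<delta> by simp
  have low_pos: "lowered (\<tau>, y) > 0" using eq pen by linarith
  \<comment> \<open>The value is positive, so the penalty is below \<open>sup_bound\<close>; the
    smallness of \<open>\<delta>\<close> then places the maximizer within distance \<open>1\<close>
    of \<open>(t, x)\<close>.\<close>
  have "?pen \<le> sup_bound" using eq sup_bound[OF 2(1)] by (auto simp: q abs_le_iff)
  then have "(dist (t, x) (\<tau>, y))\<^sup>2 \<le> 1" using \<delta> by (simp add: pos_divide_le_eq mult_ac)
  then have "(dist x y)\<^sup>2 \<le> 1\<^sup>2" by (simp add: dist_Pair_Pair) (smt (verit) zero_le_power2)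
  then have "dist x y \<le> 1" by (rule power2_le_imp_le) simp
  then have yR: "norm y \<le> R + 1" using x norm_triangle_sub[of y x] by (simp add: dist_norm norm_minus_commute)
  \<comment> \<open>The maximizer avoids the initial time, where \<open>lowered\<close> is
    nonpositive. This leaves room for steps to the left of \<open>\<tau>\<close> inside the
    cylinder.\<close>
  have "\<tau> \<noteq> t0" using lowered_init[OF \<tau>y(2)] low_pos by auto
  then have \<tau>: "t0 < \<tau>" "\<tau> \<le> T" "a < \<tau>" using \<tau>y t0 by auto
  have wpos: "w \<tau> y > 0" "lowered (\<tau>, y) \<le> w \<tau> y"
    using low_pos corr_nonneg[of \<tau>] \<eta> by (auto simp: lowered_def)
  obtain D L where DL: "((\<lambda>\<tau>. w \<tau> y) has_real_derivative D) (at \<tau>)"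
    "((\<lambda>h. - (c * trunc_gen p h (w \<tau>) y)) \<longlongrightarrow> L) (at_right 0)" "D + L \<le> 0"
    using w_sub[OF \<tau>(3) wpos(1)] by blast
  have dist_eq: "dist (t, x + z) (\<tau>, y + z) = dist (t, x) (\<tau>, y)" "dist (t - h, x) (\<tau> - h, y) = dist (t, x) (\<tau>, y)" for z h
    by (simp_all add: dist_Pair_Pair dist_real_def)
  \<comment> \<open>Inside the cylinder the shifted point is a competitor in the supremum. Beyond
    \<open>R'\<close> it is not, and \<open>reg \<ge> 0\<close> takes its place at the price of
    \<open>wp\<close>.\<close>
  have space: "reg \<delta> t (x + z) - reg \<delta> t x
      \<ge> w \<tau> (y + z) - w \<tau> y - indicator {z. R' < norm (y + z)} z * wp \<tau> (y + z)" for z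
  proof (cases "norm (y + z) \<le> R'")
    case True
    then have "(\<tau>, y + z) \<in> cyl" using \<tau> by (simp add: cyl_def)
    from sup_conv_ge[OF cyl lowered_cont this, of "(t, x + z)" \<delta>]
    have "reg \<delta> t (x + z) \<ge> lowered (\<tau>, y + z) - ?pen" by (simp add: reg_def dist_eq)
    then show ?thesis using eq(1) True by (simp add: lowered_def)
  next
    case False
    have "reg \<delta> t x \<le> w \<tau> y" using eq pen wpos by linarith
    moreover have "w \<tau> (y + z) \<le> wp \<tau> (y + z)" using \<tau>(3) by (simp add: wp_def)
    moreover have "0 \<le> reg \<delta> t (x + z)" by simp
    moreover have "indicator {z. R' < norm (y + z)} z = (1::real)" using False by simp
    ultimately show ?thesis by (simp del: reg_nonneg)
  qed
  have gen: "trunc_gen p h (reg \<delta> t) x \<ge> trunc_gen p h (w \<tau>) y - 2 powr (3 * p / 2) * tail R' \<tau>" if h: "h > 0" for h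
  proof -
    let ?g = "\<lambda>z. indicator {z. R' < norm (y + z)} z * wp \<tau> (y + z) * cut_kernel p h z"
    have i1: "integrable lborel (\<lambda>z. (w \<tau> (y + z) - w \<tau> y) * cut_kernel p h z)"
      by (rule w_int[OF \<tau>(3) wpos(1) h])
    have i2: "integrable lborel ?g" by (rule far_integral_le(1)[OF \<tau>(3) yR R(2)]) (use R in simp)
    have i3: "integrable lborel (\<lambda>z. (reg \<delta> t (x + z) - reg \<delta> t x) * cut_kernel p h z)"
      by (rule integrable_trunc_gen[OF p(1) reg_measurable[OF \<delta>(1)] reg_abs_le[OF \<delta>(1)] h])
    have "trunc_gen p h (w \<tau>) y - (LINT z|lborel. ?g z)
        = (LINT z|lborel. (w \<tau> (y + z) - w \<tau> y) * cut_kernel p h z - ?g z)"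
      unfolding trunc_gen_def by (rule Bochner_Integration.integral_diff[OF i1 i2, symmetric])
    also have "\<dots> \<le> trunc_gen p h (reg \<delta> t) x"
      unfolding trunc_gen_def
    proof (rule Bochner_Integration.integral_mono[OF Bochner_Integration.integrable_diff[OF i1 i2] i3])
      fix z
      show "(w \<tau> (y + z) - w \<tau> y) * cut_kernel p h z - ?g z \<le> (reg \<delta> t (x + z) - reg \<delta> t x) * cut_kernel p h z"
        using mult_right_mono[OF space[of z] cut_kernel_nonneg[of p h z]] by (simp add: algebra_simps)
    qed
    finally show ?thesis using far_integral_le(2)[OF \<tau>(3) yR R(2), of h] R by simp
  qed
  \<comment> \<open>One third of the error \<open>e\<close> is spent on the growth of
    \<open>corr\<close>, the other two on the difference quotient of \<open>w\<close> and on its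
    truncated operator.\<close>
  obtain d where d: "d > 0" "\<And>s. \<bar>s - \<tau>\<bar> < d \<Longrightarrow> tail R' \<tau> - e / (3 * C') \<le> tail R' s"
    using tail_lsc[OF \<tau>(3), of "e / (3 * C')" R'] e C'_pos by auto
  have dq: "((\<lambda>h. (w \<tau> y - w (\<tau> - h) y) / h) \<longlongrightarrow> D) (at_right 0)"
  proof -
    have "((\<lambda>h. (w (\<tau> + h) y - w \<tau> y) / h) \<longlongrightarrow> D) (at 0)"
      using DL(1) by (simp add: DERIV_def)
    then have "((\<lambda>h. (w (\<tau> + h) y - w \<tau> y) / h) \<longlongrightarrow> D) (at_left 0)"
      by (simp add: filterlim_at_split)
    then have "((\<lambda>h. (w (\<tau> + - h) y - w \<tau> y) / - h) \<longlongrightarrow> D) (at_right 0)"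
      unfolding at_left_minus[of 0] by (simp add: filterlim_filtermap)
    then show ?thesis by (simp add: minus_divide_right[symmetric] minus_divide_left)
  qed
  have "\<forall>\<^sub>F h in at_right 0. (w \<tau> y - w (\<tau> - h) y) / h < D + e / 3"
    using order_tendstoD(2)[OF dq, of "D + e/3"] e by simp
  moreover have "\<forall>\<^sub>F h in at_right 0. - (c * trunc_gen p h (w \<tau>) y) < L + e / 3"
    using order_tendstoD(2)[OF DL(2), of "L + e/3"] e by simp
  moreover have "\<forall>\<^sub>F h in at_right 0. 0 < h \<and> h < min d (\<tau> - t0)"
    unfolding eventually_at_right_field using d \<tau> by (intro exI[of _ "min d (\<tau> - t0)"]) auto
  ultimately show ?thesis
  proof eventually_elim
    case (elim h)
    then have h: "0 < h" "h < d" "h < \<tau> - t0" by auto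
    have "(\<tau> - h, y) \<in> cyl" using h \<tau> \<tau>y by (simp add: cyl_def)
    from sup_conv_ge[OF cyl lowered_cont this, of "(t - h, x)" \<delta>]
    have "reg \<delta> (t - h) x \<ge> lowered (\<tau> - h, y) - ?pen" by (simp add: reg_def dist_eq)
    then have "reg \<delta> t x - reg \<delta> (t - h) x \<le> (w \<tau> y - w (\<tau> - h) y) - (corr \<tau> - corr (\<tau> - h))"
      using eq(1) by (simp add: lowered_def)
    \<comment> \<open>By the choice of \<open>d\<close> the integrand stays close above its value at
      \<open>\<tau>\<close>. The resulting term \<open>C' * tail R' \<tau>\<close> cancels the
      far-field loss in \<open>gen\<close>.\<close>
    moreover have "corr \<tau> - corr (\<tau> - h) \<ge> h * (C' * tail R' \<tau> - e / 3)"
    proof -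
      have "integral {\<tau> - h..\<tau>} (\<lambda>_. tail R' \<tau> - e / (3 * C')) \<le> integral {\<tau> - h..\<tau>} (tail R')"
      proof (rule integral_le)
        show "tail R' integrable_on {\<tau> - h..\<tau>}" using h t0 by (intro tail_integrable_on) linarith
        show "tail R' \<tau> - e / (3 * C') \<le> tail R' s" if "s \<in> {\<tau> - h..\<tau>}" for s
          using that h by (intro d(2)) auto
      qed (rule integrable_const_ivl)
      then have "C' * (h * (tail R' \<tau> - e / (3 * C'))) \<le> C' * integral {\<tau> - h..\<tau>} (tail R')"
        using h C'_pos by (intro mult_left_mono) auto
      moreover have "C' * (h * (tail R' \<tau> - e / (3 * C'))) = h * (C' * tail R' \<tau> - e / 3)"
        using C'_pos by (simp add: field_simps)
      ultimately show ?thesis using corr_diff[of "\<tau> - h" \<tau>] h \<tau> by simp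
    qed
    ultimately have "reg \<delta> t x - reg \<delta> (t - h) x \<le> (w \<tau> y - w (\<tau> - h) y) - h * (C' * tail R' \<tau> - e / 3)"
      by linarith
    then have "(reg \<delta> t x - reg \<delta> (t - h) x) / h \<le> ((w \<tau> y - w (\<tau> - h) y) - h * (C' * tail R' \<tau> - e / 3)) / h"
      using h(1) by (intro divide_right_mono) auto
    also have "\<dots> = (w \<tau> y - w (\<tau> - h) y) / h - (C' * tail R' \<tau> - e / 3)"
      using h(1) by (simp add: diff_divide_distrib)
    also have "\<dots> \<le> D + e / 3 - (C' * tail R' \<tau> - e / 3)" using elim by simp
    finally have "(reg \<delta> t x - reg \<delta> (t - h) x) / h \<le> D + 2 * e / 3 - C' * tail R' \<tau>" by simp
    moreover have "c * trunc_gen p h (reg \<delta> t) x \<ge> c * trunc_gen p h (w \<tau>) y - C' * tail R' \<tau>"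
      using mult_left_mono[OF gen[OF h(1)], of c] c by (simp add: C'_def algebra_simps)
    ultimately show ?case using elim DL(3) by linarith
  qed
qed

text \<open>Semiconvexity in space bounds the truncated operator from below independently of
  \<open>h\<close>, and the Lipschitz bound in time controls the quotient. The constant degenerates
  with \<open>\<delta>\<close>, but it only has to dominate the limit in \<open>h\<close> at fixed
  \<open>\<delta>\<close>.\<close>

lemma reg_uniform_bound:
  assumes \<delta>: "\<delta> > 0"
  shows "\<exists>B. \<forall>t x h. t0 < t \<longrightarrow> t \<le> T \<longrightarrow> 0 < h \<longrightarrow> h \<le> 1 \<longrightarrow> h \<le> t - t0 \<longrightarrow>
    (reg \<delta> t x - reg \<delta> (t - h) x) / h - c * trunc_gen p h (reg \<delta> t) x \<le> B"
proof -
  define B1 where "B1 = 1 / (2 * \<delta>) * near_mass TYPE('a) p 1 + 2 * sup_bound * (LINT z|lborel. cut_kernel p 1 (z::'a))"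
  have "(reg \<delta> t x - reg \<delta> (t - h) x) / h - c * trunc_gen p h (reg \<delta> t) x \<le> (T - t0) / \<delta> + c * B1"
    if t: "t0 < t" "t \<le> T" and h: "0 < h" "h \<le> 1" "h \<le> t - t0" for t x h
  proof -
    have [measurable]: "reg \<delta> t \<in> borel_measurable borel" by (rule reg_measurable[OF \<delta>])
    have "reg \<delta> t x - reg \<delta> (t - h) x \<le> \<bar>t - (t - h)\<bar> * ((T - t0) / \<delta>)"
      using reg_time_lipschitz[OF \<delta>, of t "t - h" x] t h by (simp add: abs_le_iff)
    then have q: "(reg \<delta> t x - reg \<delta> (t - h) x) / h \<le> (T - t0) / \<delta>"
      using h by (simp add: pos_divide_le_eq mult.commute)
    have "trunc_gen p h (\<lambda>x. - reg \<delta> t x) x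
        \<le> 1 / (2 * \<delta>) * near_mass TYPE('a) p 1 + trunc_gen p 1 (\<lambda>x. - reg \<delta> t x) x"
    proof (rule trunc_gen_le[OF p(1)])
      show "\<bar>- reg \<delta> t y\<bar> \<le> sup_bound" for y using reg_abs_le[OF \<delta>] by simp
      show "- reg \<delta> t (x + z) + - reg \<delta> t (x - z) - 2 * - reg \<delta> t x \<le> 2 * (1 / (2 * \<delta>)) * (norm z)\<^sup>2" for z
        using sup_conv_semiconvex[OF cyl lowered_cont \<delta>, where z="(t, x)" and e="(0, z)"] by (simp add: reg_def)
    qed (use h \<delta> p in auto)
    also have "trunc_gen p 1 (\<lambda>x. - reg \<delta> t x) x \<le> 2 * sup_bound * (LINT z|lborel. cut_kernel p 1 (z::'a))"
      using trunc_gen_abs_le[OF p(1) _ reg_measurable[OF \<delta>] reg_abs_le[OF \<delta>], of 1 t x]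
      by (simp add: trunc_gen_uminus)
    finally have "- trunc_gen p h (reg \<delta> t) x \<le> B1" by (simp add: trunc_gen_uminus B1_def)
    then have "- (c * trunc_gen p h (reg \<delta> t) x) \<le> c * B1"
      using mult_left_mono[of "- trunc_gen p h (reg \<delta> t) x" B1 c] c by simp
    then show ?thesis using q by linarith
  qed
  then show ?thesis by blast
qed

section \<open>Growth of the weighted masses of the regularisation\<close>

definition test_mass :: "real \<Rightarrow> real \<Rightarrow> real" where
  "test_mass \<delta> t = (LINT x|lborel. reg \<delta> t x * test_fun p \<gamma> x)"

definition decay_mass :: "real \<Rightarrow> real \<Rightarrow> real" where
  "decay_mass \<delta> t = (LINT x|lborel. reg \<delta> t x * decay (p / 2) x)"

lemma decay_integrable: "integrable lborel (decay (p / 2) :: 'a \<Rightarrow> real)"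
  using p by (intro integrable_decay) simp

lemma test_fun_le_1: "test_fun p \<gamma> (x::'a) \<le> 1"
  using test_fun_le[of \<gamma> p x] decay_le_1[of "p / 2" x] \<gamma> p_pos by simp

lemma test_fun_integrable: "integrable lborel (test_fun p \<gamma> :: 'a \<Rightarrow> real)"
proof (rule Bochner_Integration.integrable_bound[OF decay_integrable])
  show "AE x in lborel. norm (test_fun p \<gamma> (x::'a)) \<le> norm (decay (p / 2) x)"
    using test_fun_le[of \<gamma> p] \<gamma> by (intro AE_I2) simp
qed simp

lemma weighted_lipschitz:
  assumes \<delta>: "\<delta> > 0" and f: "integrable lborel f" "\<And>x::'a. 0 \<le> f x" and t: "t \<in> {t0..T}" "t1 \<in> {t0..T}"
  shows "\<bar>(LINT x|lborel. reg \<delta> t x * f x) - (LINT x|lborel. reg \<delta> t1 x * f x)\<bar>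
    \<le> \<bar>t - t1\<bar> * ((T - t0) / \<delta> * (LINT x|lborel. f x))"
proof -
  have i: "integrable lborel (\<lambda>x. reg \<delta> t x * f x)" for t
    by (rule integrable_mult_bounded[OF f(1) reg_measurable[OF \<delta>] reg_abs_le[OF \<delta>]])
  have "\<bar>(LINT x|lborel. reg \<delta> t x * f x) - (LINT x|lborel. reg \<delta> t1 x * f x)\<bar>
      = \<bar>LINT x|lborel. reg \<delta> t x * f x - reg \<delta> t1 x * f x\<bar>"
    using i by simp
  also have "\<dots> \<le> (LINT x|lborel. \<bar>reg \<delta> t x * f x - reg \<delta> t1 x * f x\<bar>)"
    using integral_norm_bound[of lborel "\<lambda>x. reg \<delta> t x * f x - reg \<delta> t1 x * f x"] by simp
  also have "\<dots> \<le> (LINT x|lborel. \<bar>t - t1\<bar> * ((T - t0) / \<delta>) * f x)"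
  proof (rule Bochner_Integration.integral_mono)
    show "integrable lborel (\<lambda>x. \<bar>reg \<delta> t x * f x - reg \<delta> t1 x * f x\<bar>)"
      by (intro integrable_abs Bochner_Integration.integrable_diff i)
    show "\<bar>reg \<delta> t x * f x - reg \<delta> t1 x * f x\<bar> \<le> \<bar>t - t1\<bar> * ((T - t0) / \<delta>) * f x" for x
    proof -
      have "\<bar>reg \<delta> t x * f x - reg \<delta> t1 x * f x\<bar> = \<bar>reg \<delta> t x - reg \<delta> t1 x\<bar> * f x"
        unfolding left_diff_distrib[symmetric] abs_mult using f(2)[of x] by simp
      also have "\<dots> \<le> \<bar>t - t1\<bar> * ((T - t0) / \<delta>) * f x"
        by (rule mult_right_mono[OF reg_time_lipschitz[OF \<delta> t, of x] f(2)[of x]])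
      finally show ?thesis .
    qed
  qed (use f in simp)
  finally show ?thesis by (simp add: mult.assoc)
qed

lemma weighted_continuous:
  assumes \<delta>: "\<delta> > 0" and f: "integrable lborel f" "\<And>x::'a. 0 \<le> f x"
  shows "continuous_on {t0..T} (\<lambda>t. LINT x|lborel. reg \<delta> t x * f x)"
proof -
  have "0 \<le> (LINT x|lborel. f x)" using f(2) by (intro Bochner_Integration.integral_nonneg) auto
  then have "((T - t0) / \<delta> * (LINT x|lborel. f x))-lipschitz_on {t0..T} (\<lambda>t. LINT x|lborel. reg \<delta> t x * f x)"
    using weighted_lipschitz[OF \<delta> f] \<delta> t0 by (intro lipschitz_onI) (auto simp: dist_real_def mult.commute)
  then show ?thesis by (rule lipschitz_on_continuous_on)
qed

text \<open>Time step and truncation radius are the same \<open>h\<close>, so one limit removes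
  both. On the support of the test function the pointwise inequality holds asymptotically with a
  uniform upper bound, hence dominated convergence applies to the positive part of the defect;
  symmetry then moves the operator to the test function. The right-hand side carries the full
  weight, so the inequality does not close until the supports grow.\<close>

lemma test_mass_step:
  assumes t: "t0 < t" "t \<le> T" and \<delta>: "\<delta> > 0" "2 * \<delta> * sup_bound \<le> 1" and e: "e > 0"
  shows "\<forall>\<^sub>F h in at_right 0. (test_mass \<delta> t - test_mass \<delta> (t - h)) / h \<le> c * C * decay_mass \<delta> t + e"
proof -
  \<comment> \<open>The defect in the subsolution inequality for \<open>reg\<close>. It is bounded
    above uniformly in \<open>h\<close>, and only its positive part is taken to the limit.\<close>
  define r where "r h x = (reg \<delta> t x - reg \<delta> (t - h) x) / h - c * trunc_gen p h (reg \<delta> t) x" for h x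
  have [measurable]: "reg \<delta> s \<in> borel_measurable borel" for s by (rule reg_measurable[OF \<delta>(1)])
  have [measurable]: "r h \<in> borel_measurable borel" for h unfolding r_def by measurable
  define b where "b = min (1/4) (t - t0)"
  have b: "b > 0" using t by (simp add: b_def)
  obtain B where B: "\<And>x h. 0 < h \<Longrightarrow> h \<le> b \<Longrightarrow> r h x \<le> B"
    using reg_uniform_bound[OF \<delta>(1)] t unfolding r_def b_def by fastforce
  have lim: "((\<lambda>h. LINT x|lborel. max 0 (r h x) * test_fun p \<gamma> x) \<longlongrightarrow> 0) (at_right 0)"
  proof (rule tendsto_at_right_sequentially[OF b])
    fix S :: "nat \<Rightarrow> real"
    assume S: "\<And>n. 0 < S n" "\<And>n. S n < b" "decseq S" "S \<longlonglongrightarrow> 0"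
    have SR: "filterlim S (at_right 0) sequentially"
      using S by (auto simp: filterlim_at intro!: always_eventually less_imp_neq[symmetric])
    have "(\<lambda>n. LINT x|lborel. max 0 (r (S n) x) * test_fun p \<gamma> x) \<longlonglongrightarrow> (LINT x|lborel. 0 * test_fun p \<gamma> (x::'a))"
    proof (rule integral_dominated_convergence)
      show "integrable lborel (\<lambda>x::'a. \<bar>B\<bar> * test_fun p \<gamma> x)" using test_fun_integrable by simp
      show "AE x in lborel. (\<lambda>n. max 0 (r (S n) x) * test_fun p \<gamma> x) \<longlonglongrightarrow> 0 * test_fun p \<gamma> x"
      proof (intro AE_I2)
        fix x :: 'a
        show "(\<lambda>n. max 0 (r (S n) x) * test_fun p \<gamma> x) \<longlonglongrightarrow> 0 * test_fun p \<gamma> x"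
        proof (cases "norm x \<le> R")
          case True
          have "(\<lambda>n. max 0 (r (S n) x)) \<longlonglongrightarrow> 0"
          proof (rule order_tendstoI)
            fix y :: real assume "0 < y"
            then have "\<forall>\<^sub>F h in at_right 0. r h x \<le> y / 2"
              unfolding r_def using reg_pointwise[OF t True \<delta>, of "y/2"] by simp
            then have "\<forall>\<^sub>F n in sequentially. r (S n) x \<le> y / 2"
              by (rule eventually_compose_filterlim[OF _ SR])
            then show "\<forall>\<^sub>F n in sequentially. max 0 (r (S n) x) < y"
              by eventually_elim (use \<open>0 < y\<close> in auto)
          next
            fix y :: real assume "y < 0"
            then show "\<forall>\<^sub>F n in sequentially. y < max 0 (r (S n) x)"
              by (intro always_eventually) auto
          qed
          then show ?thesis by (rule tendsto_mult_right)
        next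
          case False
          then show ?thesis using supp[of x] by simp
        qed
      qed
      fix n
      show "AE x in lborel. norm (max 0 (r (S n) x) * test_fun p \<gamma> x) \<le> \<bar>B\<bar> * test_fun p \<gamma> x"
      proof (intro AE_I2)
        fix x :: 'a
        have "max 0 (r (S n) x) \<le> \<bar>B\<bar>" using B[of "S n" x] S(1,2)[of n] by simp
        then show "norm (max 0 (r (S n) x) * test_fun p \<gamma> x) \<le> \<bar>B\<bar> * test_fun p \<gamma> x"
          by (simp add: abs_mult mult_right_mono)
      qed
    qed auto
    then show "(\<lambda>n. LINT x|lborel. max 0 (r (S n) x) * test_fun p \<gamma> x) \<longlonglongrightarrow> 0" by simp
  qed
  have "\<forall>\<^sub>F h in at_right 0. 0 < h \<and> h < b"
    unfolding eventually_at_right_field using b by blast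
  moreover have "\<forall>\<^sub>F h in at_right 0. (LINT x|lborel. max 0 (r h x) * test_fun p \<gamma> x) < e"
    by (rule order_tendstoD(2)[OF lim e])
  ultimately show ?thesis
  proof eventually_elim
    case (elim h)
    then have h: "0 < h" "h \<le> b" "h \<le> 1/4" by (auto simp: b_def)
    let ?\<psi> = "test_fun p \<gamma> :: 'a \<Rightarrow> real" and ?g = "trunc_gen p h (reg \<delta> t)"
    have i\<psi>: "integrable lborel (\<lambda>x. v x * ?\<psi> x)"
      if "v \<in> borel_measurable borel" "\<And>x. \<bar>v x\<bar> \<le> M" for v M
      by (rule integrable_mult_bounded[OF test_fun_integrable that])
    have ireg: "integrable lborel (\<lambda>x. reg \<delta> s x * ?\<psi> x)" for s
      by (rule i\<psi>[OF reg_measurable[OF \<delta>(1)] reg_abs_le[OF \<delta>(1)]])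
    have ig: "integrable lborel (\<lambda>x. ?g x * ?\<psi> x)"
      by (rule i\<psi>[OF _ trunc_gen_abs_le[OF p(1) h(1) reg_measurable[OF \<delta>(1)] reg_abs_le[OF \<delta>(1)]]]) simp
    have ir: "integrable lborel (\<lambda>x. max 0 (r h x) * ?\<psi> x)"
    proof (rule i\<psi>)
      show "\<bar>max 0 (r h x)\<bar> \<le> \<bar>B\<bar>" for x using B[OF h(1,2), of x] by simp
    qed simp
    have "(test_mass \<delta> t - test_mass \<delta> (t - h)) / h
        = (LINT x|lborel. (reg \<delta> t x * ?\<psi> x - reg \<delta> (t - h) x * ?\<psi> x) / h)"
      unfolding test_mass_def using ireg by simp
    also have "\<dots> \<le> (LINT x|lborel. max 0 (r h x) * ?\<psi> x + c * (?g x * ?\<psi> x))"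
    proof (rule Bochner_Integration.integral_mono)
      show "integrable lborel (\<lambda>x. (reg \<delta> t x * ?\<psi> x - reg \<delta> (t - h) x * ?\<psi> x) / h)"
        using ireg by simp
      show "integrable lborel (\<lambda>x. max 0 (r h x) * ?\<psi> x + c * (?g x * ?\<psi> x))"
        using ir ig by simp
      fix x
      have "(reg \<delta> t x * ?\<psi> x - reg \<delta> (t - h) x * ?\<psi> x) / h = (r h x + c * ?g x) * ?\<psi> x"
        by (simp add: r_def left_diff_distrib diff_divide_distrib)
      also have "\<dots> \<le> (max 0 (r h x) + c * ?g x) * ?\<psi> x"
        by (intro mult_right_mono) auto
      finally show "(reg \<delta> t x * ?\<psi> x - reg \<delta> (t - h) x * ?\<psi> x) / h \<le> max 0 (r h x) * ?\<psi> x + c * (?g x * ?\<psi> x)"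
        by (simp add: distrib_right mult.assoc)
    qed
    also have "\<dots> = (LINT x|lborel. max 0 (r h x) * ?\<psi> x) + c * (LINT x|lborel. ?\<psi> x * ?g x)"
      using ir ig by (simp add: mult.commute)
    also have "(LINT x|lborel. ?\<psi> x * ?g x) = (LINT x|lborel. reg \<delta> t x * trunc_gen p h ?\<psi> x)"
    proof (rule trunc_gen_symmetric[OF p(1) h(1) test_fun_integrable _ reg_measurable[OF \<delta>(1)] reg_abs_le[OF \<delta>(1)]])
      show "\<bar>?\<psi> x\<bar> \<le> 1" for x using test_fun_le_1 by simp
    qed
    also have "\<dots> \<le> (LINT x|lborel. C * (reg \<delta> t x * decay (p / 2) x))"
    \<comment> \<open>a non-integrable left-hand side has integral 0\<close>
    proof (rule integral_mono')
      show "integrable lborel (\<lambda>x. C * (reg \<delta> t x * decay (p / 2) x))"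
        using integrable_mult_bounded[OF decay_integrable reg_measurable[OF \<delta>(1)] reg_abs_le[OF \<delta>(1)], of t] by simp
      show "reg \<delta> t x * trunc_gen p h ?\<psi> x \<le> C * (reg \<delta> t x * decay (p / 2) x)" for x
        using mult_left_mono[OF C(2)[OF h(1,3), of x] reg_nonneg[of \<delta> t x]] by (simp add: mult_ac)
      show "0 \<le> C * (reg \<delta> t x * decay (p / 2) x)" for x using C(1) by simp
    qed
    also have "\<dots> = C * decay_mass \<delta> t" by (simp add: decay_mass_def)
    finally show ?case using elim c by (simp add: mult.assoc mult_left_mono)
  qed
qed

text \<open>The estimate for left quotients is integrated by
  \<open>nonincreasing_from_left_steps\<close>. The slack \<open>e * (t - t0)\<close> in
  \<open>\<phi>\<close> absorbs the error of each step and amounts to \<open>e'\<close> at time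
  \<open>T\<close>.\<close>

lemma test_mass_estimate:
  assumes \<delta>: "\<delta> > 0" "2 * \<delta> * sup_bound \<le> 1"
  shows "test_mass \<delta> T \<le> test_mass \<delta> t0 + c * C * integral {t0..T} (decay_mass \<delta>)"
proof (rule field_le_epsilon)
  fix e' :: real assume "e' > 0"
  define e where "e = e' / (T - t0)"
  have e: "e > 0" using \<open>e' > 0\<close> t0 by (simp add: e_def)
  define LJ where "LJ = (T - t0) / \<delta> * (LINT x|lborel. decay (p / 2) (x::'a))"
  have LJ: "0 \<le> LJ" using \<delta> t0 by (auto simp: LJ_def intro!: Bochner_Integration.integral_nonneg)
  have cC: "0 \<le> c * C" using c C by simp
  have Jc: "continuous_on {t0..T} (decay_mass \<delta>)"
    unfolding decay_mass_def by (rule weighted_continuous[OF \<delta>(1) decay_integrable]) simp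
  have Jl: "decay_mass \<delta> t - LJ * h \<le> decay_mass \<delta> s"
    if "t \<in> {t0..T}" "s \<in> {t0..T}" "\<bar>t - s\<bar> \<le> h" for t s h
  proof -
    have "\<bar>decay_mass \<delta> t - decay_mass \<delta> s\<bar> \<le> \<bar>t - s\<bar> * LJ"
      unfolding decay_mass_def LJ_def by (rule weighted_lipschitz[OF \<delta>(1) decay_integrable _ that(1,2)]) simp
    also have "\<dots> \<le> h * LJ" using that(3) LJ by (intro mult_right_mono) auto
    finally show ?thesis by (simp add: abs_le_iff mult.commute)
  qed
  define \<phi> where "\<phi> t = test_mass \<delta> t - c * C * integral {t0..t} (decay_mass \<delta>) - e * (t - t0)" for t
  have "\<phi> T \<le> \<phi> t0"
  proof (rule nonincreasing_from_left_steps[where \<phi>=\<phi> and \<alpha>=t0 and \<beta>=T])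
    show "continuous_on {t0..T} \<phi>"
      unfolding \<phi>_def test_mass_def
      by (intro continuous_intros weighted_continuous[OF \<delta>(1) test_fun_integrable]
          indefinite_integral_continuous_1 integrable_continuous_real Jc) simp
    fix t assume t: "t0 < t" "t \<le> T"
    \<comment> \<open>For such \<open>h\<close>, replacing \<open>decay_mass\<close> on
      \<open>{t - h..t}\<close> by its value at \<open>t\<close>, with an error of at most
      \<open>LJ * h\<close>, uses up no more than the second \<open>e / 2\<close>.\<close>
    define b where "b = min (t - t0) (e / (2 * (c * C * LJ + 1)))"
    have pos: "c * C * LJ + 1 > 0" using cC LJ by (simp add: add_nonneg_pos)
    have b: "b > 0" using t e pos by (simp add: b_def)
    have "\<forall>\<^sub>F h in at_right 0. 0 < h \<and> h < b"
      unfolding eventually_at_right_field using b by blast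
    moreover have "\<forall>\<^sub>F h in at_right 0. (test_mass \<delta> t - test_mass \<delta> (t - h)) / h \<le> c * C * decay_mass \<delta> t + e / 2"
      using test_mass_step[OF t \<delta>, of "e / 2"] e by simp
    ultimately have "\<forall>\<^sub>F h in at_right 0. h > 0 \<and> h \<le> t - t0 \<and> \<phi> t \<le> \<phi> (t - h)"
    proof eventually_elim
      case (elim h)
      then have h: "0 < h" "h < t - t0" "h \<le> e / (2 * (c * C * LJ + 1))" by (auto simp: b_def)
      have "test_mass \<delta> t - test_mass \<delta> (t - h) \<le> h * (c * C * decay_mass \<delta> t + e / 2)"
        using elim h(1) by (simp add: pos_divide_le_eq mult.commute)
      moreover have "c * C * integral {t0..t} (decay_mass \<delta>)
          = c * C * integral {t0..t - h} (decay_mass \<delta>) + c * C * integral {t - h..t} (decay_mass \<delta>)"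
      proof -
        have "integral {t0..t - h} (decay_mass \<delta>) + integral {t - h..t} (decay_mass \<delta>) = integral {t0..t} (decay_mass \<delta>)"
          using h t by (intro Henstock_Kurzweil_Integration.integral_combine integrable_continuous_real
              continuous_on_subset[OF Jc]) auto
        then show ?thesis by (metis distrib_left)
      qed
      moreover have "h * (decay_mass \<delta> t - LJ * h) \<le> integral {t - h..t} (decay_mass \<delta>)"
      proof -
        have "integral {t - h..t} (\<lambda>_. decay_mass \<delta> t - LJ * h) \<le> integral {t - h..t} (decay_mass \<delta>)"
        proof (rule integral_le)
          show "decay_mass \<delta> integrable_on {t - h..t}"
            using h t by (intro integrable_continuous_real continuous_on_subset[OF Jc]) auto
          show "decay_mass \<delta> t - LJ * h \<le> decay_mass \<delta> s" if "s \<in> {t - h..t}" for s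
            using that h t by (intro Jl) auto
        qed (rule integrable_const_ivl)
        then show ?thesis using h by simp
      qed
      then have "c * C * (h * (decay_mass \<delta> t - LJ * h)) \<le> c * C * integral {t - h..t} (decay_mass \<delta>)"
        using cC by (rule mult_left_mono)
      moreover have "h * (c * C * LJ) * h \<le> h * (e / 2)"
      proof -
        have "h * (2 * (c * C * LJ + 1)) \<le> e" using h(3) pos by (simp add: pos_le_divide_eq)
        then have "h * (c * C * LJ) \<le> e / 2" using h(1) by (simp add: algebra_simps)
        then show ?thesis using h(1) by (simp add: mult.commute mult.left_commute mult_left_mono)
      qed
      ultimately have "\<phi> t \<le> \<phi> (t - h)"
        unfolding \<phi>_def by (simp add: algebra_simps)
      then show ?case using h by simp
    qed
    then show "\<exists>h>0. h \<le> t - t0 \<and> \<phi> t \<le> \<phi> (t - h)"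
      using eventually_happens'[OF trivial_limit_at_right_real] by blast
  qed (use t0 in simp)
  then show "test_mass \<delta> T \<le> test_mass \<delta> t0 + c * C * integral {t0..T} (decay_mass \<delta>) + e'"
    using t0 by (simp add: \<phi>_def e_def)
qed

section \<open>Removing the sup-convolution\<close>

definition limit_fun :: "real \<Rightarrow> 'a \<Rightarrow> real" where
  "limit_fun t x = (if (t, x) \<in> cyl then max 0 (lowered (t, x)) else 0)"

text \<open>Scaled so that maximizers stay within distance \<open>1\<close>; the summand
  \<open>1\<close> covers the case \<open>sup_bound = 0\<close>.\<close>

definition width :: "nat \<Rightarrow> real" where
  "width n = inverse (real (Suc n)) / (2 * (sup_bound + 1))"

lemma width: "width n > 0" "2 * width n * sup_bound \<le> 1" "width \<longlonglongrightarrow> 0"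
proof -
  have s: "sup_bound + 1 > 0" using sup_bound_nonneg by simp
  then show "width n > 0" by (simp add: width_def)
  have "inverse (real (Suc n)) * sup_bound \<le> 1 * (sup_bound + 1)"
    using sup_bound_nonneg by (intro mult_mono) (auto simp: inverse_le_1_iff)
  then show "2 * width n * sup_bound \<le> 1" using s by (simp add: width_def pos_divide_le_eq)
  have "(\<lambda>n. inverse (real (Suc n)) / (2 * (sup_bound + 1))) \<longlonglongrightarrow> 0 / (2 * (sup_bound + 1))"
    using s by (intro tendsto_divide LIMSEQ_inverse_real_of_nat tendsto_const) auto
  then show "width \<longlonglongrightarrow> 0" by (simp add: width_def[abs_def])
qed

lemma reg_tendsto: "(\<lambda>n. reg (width n) t x) \<longlonglongrightarrow> limit_fun t x"
  unfolding reg_def limit_fun_def by (rule sup_conv_tendsto[OF cyl lowered_cont width(1,3)])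

lemma limit_fun_measurable: "limit_fun t \<in> borel_measurable borel"
  by (rule borel_measurable_LIMSEQ_real[OF reg_tendsto]) (rule reg_measurable[OF width(1)])

lemma limit_fun_bounds: "0 \<le> limit_fun t x" "limit_fun t x \<le> wp t x" "\<bar>limit_fun t x\<bar> \<le> sup_bound"
proof -
  show "0 \<le> limit_fun t x" by (simp add: limit_fun_def)
  show "limit_fun t x \<le> wp t x"
    using t0 \<eta> corr_nonneg[of t] by (auto simp: limit_fun_def wp_def cyl_def lowered_def)
  show "\<bar>limit_fun t x\<bar> \<le> sup_bound"
    using sup_bound[of "(t, x)"] sup_bound_nonneg by (auto simp: limit_fun_def)
qed

lemma weighted_tendsto:
  assumes "integrable lborel f" "\<And>x. 0 \<le> f x"
  shows "(\<lambda>n. LINT x|lborel. reg (width n) t x * f x) \<longlonglongrightarrow> (LINT x|lborel. limit_fun t x * f x)"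
proof (rule integral_dominated_convergence)
  have [measurable]: "f \<in> borel_measurable borel" using assms(1) by auto
  note [measurable] = limit_fun_measurable reg_measurable[OF width(1)]
  show "(\<lambda>x. limit_fun t x * f x) \<in> borel_measurable lborel" by measurable
  show "(\<lambda>x. reg (width n) t x * f x) \<in> borel_measurable lborel" for n by measurable
  show "integrable lborel (\<lambda>x. sup_bound * f x)" using assms(1) by simp
  show "AE x in lborel. (\<lambda>n. reg (width n) t x * f x) \<longlonglongrightarrow> limit_fun t x * f x"
    by (intro AE_I2 tendsto_intros reg_tendsto)
  show "AE x in lborel. norm (reg (width n) t x * f x) \<le> sup_bound * f x" for n
    using reg_abs_le[OF width(1)] assms(2) by (intro AE_I2) (simp add: abs_mult mult_right_mono)
qed

text \<open>On the fixed cylinder all limits are dominated: \<open>reg\<close> is at most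
  \<open>sup_bound\<close>, the weights are integrable and the time interval is bounded. The initial
  term disappears because \<open>lowered\<close> is nonpositive at \<open>t0\<close>, and the limit
  of the decay masses is at most \<open>mass\<close>, which no longer depends on the
  cylinder.\<close>

lemma ball_estimate:
  "(\<integral>\<^sup>+x. ennreal (test_fun p \<gamma> x * max 0 (w T x - \<eta> - corr T)) \<partial>lborel)
    \<le> ennreal (c * C) * (\<integral>\<^sup>+t\<in>{a<..<T}. mass t \<partial>lborel)"
proof -
  define J where "J t = (LINT x|lborel. limit_fun t x * decay (p / 2) x)" for t
  have cC: "0 \<le> c * C" using c C by simp
  have Jlim: "(\<lambda>n. decay_mass (width n) t) \<longlonglongrightarrow> J t" for t
    unfolding decay_mass_def J_def by (rule weighted_tendsto[OF decay_integrable]) simp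
  have Jnn: "0 \<le> J t" for t
    unfolding J_def using limit_fun_bounds(1) by (intro Bochner_Integration.integral_nonneg) simp
  have J_mass: "ennreal (J t) \<le> mass t" for t
  proof -
    have "integrable lborel (\<lambda>x. limit_fun t x * decay (p / 2) x)"
      by (rule integrable_mult_bounded[OF decay_integrable limit_fun_measurable limit_fun_bounds(3)])
    then have "ennreal (J t) = (\<integral>\<^sup>+x. ennreal (limit_fun t x * decay (p / 2) x) \<partial>lborel)"
      unfolding J_def using limit_fun_bounds(1) by (intro nn_integral_eq_integral[symmetric]) auto
    also have "\<dots> \<le> mass t"
      unfolding mass_def using limit_fun_bounds(2) by (intro nn_integral_mono ennreal_leI mult_right_mono) auto
    finally show ?thesis .
  qed
  have Jc: "continuous_on {t0..T} (decay_mass (width n))" for n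
    unfolding decay_mass_def by (rule weighted_continuous[OF width(1) decay_integrable]) simp
  let ?I = "indicator {t0..T} :: real \<Rightarrow> real"
  let ?M = "sup_bound * (LINT x|lborel. decay (p / 2) (x::'a))"
  have iJn: "integrable lborel (\<lambda>t. ?I t *\<^sub>R decay_mass (width n) t)" for n
    using borel_integrable_atLeastAtMost'[OF Jc] by (simp add: set_integrable_def)
  have lim: "(\<lambda>n. ?I t *\<^sub>R decay_mass (width n) t) \<longlonglongrightarrow> ?I t *\<^sub>R J t" for t
    by (intro tendsto_intros Jlim)
  have Jm [measurable]: "(\<lambda>t. ?I t *\<^sub>R J t) \<in> borel_measurable borel"
    by (rule borel_measurable_LIMSEQ_real[OF lim]) (use iJn in auto)
  have bound: "\<bar>decay_mass (width n) t\<bar> \<le> ?M" for n t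
  proof -
    have "decay_mass (width n) t \<le> (LINT x|lborel. sup_bound * decay (p / 2) (x::'a))"
      unfolding decay_mass_def
    proof (rule Bochner_Integration.integral_mono)
      show "integrable lborel (\<lambda>x. reg (width n) t x * decay (p / 2) x)"
        by (rule integrable_mult_bounded[OF decay_integrable reg_measurable[OF width(1)] reg_abs_le[OF width(1)]])
      show "reg (width n) t x * decay (p / 2) x \<le> sup_bound * decay (p / 2) x" for x
        by (intro mult_right_mono reg_le width) simp
    qed (use decay_integrable in simp)
    moreover have "0 \<le> decay_mass (width n) t"
      unfolding decay_mass_def by (intro Bochner_Integration.integral_nonneg) simp
    ultimately show ?thesis by simp
  qed
  have idom: "integrable lborel (\<lambda>t. ?I t *\<^sub>R ?M)"
    by (intro integrable_scaleR_left integrable_real_indicator) (auto simp: emeasure_lborel_Icc_eq)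
  have dom: "AE t in lborel. norm (?I t *\<^sub>R decay_mass (width n) t) \<le> ?I t *\<^sub>R ?M" for n
    using bound by (intro AE_I2) (auto simp: indicator_def)
  have limI: "(\<lambda>n. LINT t|lborel. ?I t *\<^sub>R decay_mass (width n) t) \<longlonglongrightarrow> (LINT t|lborel. ?I t *\<^sub>R J t)"
  proof (rule integral_dominated_convergence[OF _ _ idom _ dom])
    show "AE t in lborel. (\<lambda>n. ?I t *\<^sub>R decay_mass (width n) t) \<longlonglongrightarrow> ?I t *\<^sub>R J t"
      by (intro AE_I2 lim)
  qed (use iJn Jm in auto)
  have iJ: "integrable lborel (\<lambda>t. ?I t *\<^sub>R J t)"
  proof (rule integrable_dominated_convergence[OF _ _ idom _ dom])
    show "AE t in lborel. (\<lambda>n. ?I t *\<^sub>R decay_mass (width n) t) \<longlonglongrightarrow> ?I t *\<^sub>R J t"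
      by (intro AE_I2 lim)
  qed (use iJn Jm in auto)
  have eqI: "integral {t0..T} (decay_mass (width n)) = (LINT t|lborel. ?I t *\<^sub>R decay_mass (width n) t)" for n
    using set_borel_integral_eq_integral(2)[OF borel_integrable_atLeastAtMost'[OF Jc]]
    by (simp add: set_lebesgue_integral_def)
  have limT: "(\<lambda>n. test_mass (width n) t) \<longlonglongrightarrow> (LINT x|lborel. limit_fun t x * test_fun p \<gamma> x)" for t
    unfolding test_mass_def by (rule weighted_tendsto[OF test_fun_integrable]) simp
  have z: "limit_fun t0 x = 0" for x
    using lowered_init[of x] by (auto simp: limit_fun_def cyl_def)
  have "(LINT x|lborel. limit_fun T x * test_fun p \<gamma> x)
      \<le> (LINT x|lborel. limit_fun t0 x * test_fun p \<gamma> x) + c * C * (LINT t|lborel. ?I t *\<^sub>R J t)"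
  proof (rule LIMSEQ_le)
    show "(\<lambda>n. test_mass (width n) T) \<longlonglongrightarrow> (LINT x|lborel. limit_fun T x * test_fun p \<gamma> x)" by (rule limT)
    show "(\<lambda>n. test_mass (width n) t0 + c * C * integral {t0..T} (decay_mass (width n))) \<longlonglongrightarrow>
        (LINT x|lborel. limit_fun t0 x * test_fun p \<gamma> x) + c * C * (LINT t|lborel. ?I t *\<^sub>R J t)"
      unfolding eqI by (intro tendsto_intros limT limI)
    show "\<exists>N. \<forall>n\<ge>N. test_mass (width n) T \<le> test_mass (width n) t0 + c * C * integral {t0..T} (decay_mass (width n))"
      using test_mass_estimate[OF width(1,2)] by blast
  qed
  then have main: "(LINT x|lborel. limit_fun T x * test_fun p \<gamma> x) \<le> c * C * (LINT t|lborel. ?I t *\<^sub>R J t)"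
    by (simp add: z)
  have "(\<integral>\<^sup>+x. ennreal (test_fun p \<gamma> x * max 0 (w T x - \<eta> - corr T)) \<partial>lborel)
      = (\<integral>\<^sup>+x. ennreal (limit_fun T x * test_fun p \<gamma> x) \<partial>lborel)"
  proof (intro nn_integral_cong)
    fix x :: 'a
    have "test_fun p \<gamma> x * max 0 (w T x - \<eta> - corr T) = limit_fun T x * test_fun p \<gamma> x"
    proof (cases "norm x \<le> R'")
      case True
      then show ?thesis using t0 by (simp add: limit_fun_def cyl_def lowered_def)
    next
      case False
      then show ?thesis using supp[of x] R by simp
    qed
    then show "ennreal (test_fun p \<gamma> x * max 0 (w T x - \<eta> - corr T)) = ennreal (limit_fun T x * test_fun p \<gamma> x)"
      by (simp only:)
  qed
  also have "\<dots> = ennreal (LINT x|lborel. limit_fun T x * test_fun p \<gamma> x)"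
    using integrable_mult_bounded[OF test_fun_integrable limit_fun_measurable limit_fun_bounds(3)] limit_fun_bounds(1)
    by (intro nn_integral_eq_integral) auto
  also have "\<dots> \<le> ennreal (c * C * (LINT t|lborel. ?I t *\<^sub>R J t))" by (rule ennreal_leI[OF main])
  also have "\<dots> = ennreal (c * C) * ennreal (LINT t|lborel. ?I t *\<^sub>R J t)"
    by (rule ennreal_mult'[OF cC])
  also have "ennreal (LINT t|lborel. ?I t *\<^sub>R J t) = (\<integral>\<^sup>+t. ennreal (?I t *\<^sub>R J t) \<partial>lborel)"
    using iJ Jnn by (intro nn_integral_eq_integral[symmetric]) auto
  also have "\<dots> \<le> (\<integral>\<^sup>+t\<in>{a<..<T}. mass t \<partial>lborel)"
  proof (rule nn_integral_mono_AE)
    have "AE t in lborel. t \<noteq> T" by (rule AE_lborel_singleton)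
    then show "AE t in lborel. ennreal (?I t *\<^sub>R J t) \<le> mass t * indicator {a<..<T} t"
      by eventually_elim (use t0 J_mass in \<open>auto simp: indicator_def\<close>)
  qed
  finally show ?thesis by (simp add: mult_left_mono)
qed

end

text \<open>Extending the tail integral back to \<open>a\<close> enlarges the correction and weakens
  the estimate, but frees it from \<open>t0\<close>, which has to vary with \<open>\<eta>\<close>
  and \<open>R'\<close>.\<close>

lemma (in frac_subsolution_ball) ball_estimate_tail:
  "(\<integral>\<^sup>+x. ennreal (test_fun p \<gamma> x * max 0 (w T x - \<eta>
      - C' * enn2real (\<integral>\<^sup>+t\<in>{a<..<T}. mass_tail R' t \<partial>lborel))) \<partial>lborel)
    \<le> ennreal (c * C) * (\<integral>\<^sup>+t\<in>{a<..<T}. mass t \<partial>lborel)"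
proof -
  let ?m = "\<integral>\<^sup>+t\<in>{a<..<T}. mass_tail R' t \<partial>lborel"
  have "?m \<le> (\<integral>\<^sup>+t\<in>{a<..<T}. mass t \<partial>lborel)"
    by (intro nn_integral_mono mult_right_mono mass_tail_le) simp
  then have "?m < \<infinity>" using mass_int by (rule le_less_trans)
  then have "ennreal (enn2real ?m) = ?m" by simp
  then have "ennreal (integral {t0..T} (tail R')) \<le> ennreal (enn2real ?m)"
    using tail_integral_bound[OF t0(1), of T R'] by (simp only:)
  then have "integral {t0..T} (tail R') \<le> enn2real ?m"
    by (simp only: ennreal_le_iff[OF enn2real_nonneg])
  then have "corr T \<le> C' * enn2real ?m"
    unfolding corr_def using C'_pos by (intro mult_left_mono) auto
  then have "(\<integral>\<^sup>+x. ennreal (test_fun p \<gamma> x * max 0 (w T x - \<eta> - C' * enn2real ?m)) \<partial>lborel)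
      \<le> (\<integral>\<^sup>+x. ennreal (test_fun p \<gamma> x * max 0 (w T x - \<eta> - corr T)) \<partial>lborel)"
    by (intro nn_integral_mono ennreal_leI mult_left_mono) auto
  then show ?thesis using ball_estimate by (rule order_trans)
qed

text \<open>The function is merely measurable, so the argument runs on its primitive. Over a step of
  length \<open>d\<close> with \<open>C * d \<le> 1/2\<close> the primitive is at most half of
  itself, and being finite it vanishes. The assumed inequality turns this into vanishing at every
  single time.\<close>

lemma ennreal_gronwall:
  fixes f :: "real \<Rightarrow> ennreal"
  assumes [measurable]: "f \<in> borel_measurable borel" and C: "C \<ge> 0"
    and fin: "\<And>T. (\<integral>\<^sup>+t\<in>{a<..<T}. f t \<partial>lborel) < \<infinity>"
    and le: "\<And>T. a < T \<Longrightarrow> f T \<le> ennreal C * (\<integral>\<^sup>+t\<in>{a<..<T}. f t \<partial>lborel)"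
    and t: "a < t"
  shows "f t = 0"
proof -
  define I where "I T = (\<integral>\<^sup>+t\<in>{a<..<T}. f t \<partial>lborel)" for T
  define d where "d = 1 / (2 * (C + 1))"
  have d: "d > 0" "C * d \<le> 1/2" using C by (auto simp: d_def field_simps)
  have mono: "I s \<le> I t" if "s \<le> t" for s t
    unfolding I_def using that by (intro nn_integral_mono) (auto simp: indicator_def)
  have zero: "I (a + real k * d) = 0" for k
  proof (induction k)
    case 0
    then show ?case by (simp add: I_def)
  next
    case (Suc k)
    let ?s = "a + real k * d" and ?e = "a + real (Suc k) * d"
    have "I ?e \<le> (\<integral>\<^sup>+t. f t * indicator {a<..<?s} t + (ennreal C * I ?e) * indicator {?s..<?e} t \<partial>lborel)"
      unfolding I_def[of ?e]
    proof (rule nn_integral_mono_AE)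
      have "AE t in lborel. t \<noteq> a" by (rule AE_lborel_singleton)
      then show "AE t in lborel. f t * indicator {a<..<?e} t \<le>
          f t * indicator {a<..<?s} t + (ennreal C * (\<integral>\<^sup>+t\<in>{a<..<?e}. f t \<partial>lborel)) * indicator {?s..<?e} t"
      proof eventually_elim
        case (elim t)
        have "f t \<le> ennreal C * (\<integral>\<^sup>+t\<in>{a<..<?e}. f t \<partial>lborel)" if "a < t" "t < ?e"
          using le[OF that(1)] mono[of t ?e] that(2) unfolding I_def
          by (meson less_imp_le mult_left_mono order_trans zero_le)
        then show ?case by (auto simp: indicator_def)
      qed
    qed
    also have "\<dots> = I ?s + ennreal C * I ?e * emeasure lborel {?s..<?e}"
      unfolding I_def[of ?s] by (subst nn_integral_add) (auto simp: nn_integral_cmult_indicator)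
    also have "\<dots> = ennreal (C * d) * I ?e"
      using Suc d(1) C by (simp add: algebra_simps ennreal_mult')
    also have "\<dots> \<le> ennreal (1/2) * I ?e" using d by (intro mult_right_mono ennreal_leI) auto
    finally have le2: "I ?e \<le> ennreal (1/2) * I ?e" .
    have "I ?e < \<infinity>" using fin[of ?e] unfolding I_def .
    then obtain r where r: "r \<ge> 0" "I ?e = ennreal r" by (cases "I ?e") auto
    have "ennreal (1/2) * ennreal r = ennreal (1/2 * r)" using r(1) by (intro ennreal_mult[symmetric]) auto
    then have "ennreal r \<le> ennreal (1/2 * r)" using le2 unfolding r(2) by (simp only:)
    then have "r \<le> 1/2 * r" using r(1) ennreal_le_iff[of "1/2 * r" r] by simp
    then have "r = 0" using r(1) by simp
    then show ?case using r by simp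
  qed
  obtain k :: nat where "real k > (t - a) / d" using reals_Archimedean2 by blast
  then have "t \<le> a + real k * d" using d by (simp add: pos_divide_less_eq)
  then have "I t = 0" using mono[of t "a + real k * d"] zero[of k] by simp
  then show ?thesis using le[OF t] by (simp add: I_def)
qed

section \<open>Growing supports and nonpositivity of subsolutions\<close>

context frac_subsolution
begin

lemma mass_tail_antimono: "r \<le> s \<Longrightarrow> mass_tail s t \<le> mass_tail r t"
  unfolding mass_tail_def by (intro nn_integral_mono) (auto simp: indicator_def)

lemma mass_tail_integral_tendsto:
  "(\<lambda>n. \<integral>\<^sup>+t\<in>{a<..<T}. mass_tail (real n) t \<partial>lborel) \<longlonglongrightarrow> 0"
proof -
  have inner: "(\<lambda>n. mass_tail (real n) t) \<longlonglongrightarrow> 0" for t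
  proof -
    have "(\<lambda>n. \<integral>\<^sup>+x. ennreal (wp t x * decay (p / 2) x) * indicator {x. real n < norm x} x \<partial>lborel)
        \<longlonglongrightarrow> (\<integral>\<^sup>+x. 0 \<partial>(lborel :: 'a measure))"
    proof (rule nn_integral_dominated_convergence[where w="\<lambda>x. ennreal (wp t x * decay (p / 2) x)"])
      show "(\<integral>\<^sup>+x. ennreal (wp t x * decay (p / 2) x) \<partial>lborel) < \<infinity>" using mass_fin by (simp add: mass_def)
      show "AE x in lborel. (\<lambda>n. ennreal (wp t x * decay (p / 2) x) * indicator {x. real n < norm x} x) \<longlonglongrightarrow> 0"
      proof (intro AE_I2 tendsto_eventually)
        fix x :: 'a
        obtain N where N: "norm x \<le> real N" using real_arch_simple by blast
        show "\<forall>\<^sub>F n in sequentially. ennreal (wp t x * decay (p / 2) x) * indicator {x. real n < norm x} x = 0"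
          using eventually_ge_at_top[of N] by eventually_elim (use N in \<open>auto simp: indicator_def\<close>)
      qed
    qed (auto simp: indicator_def)
    then show ?thesis by (simp add: mass_tail_def)
  qed
  have "(\<lambda>n. \<integral>\<^sup>+t\<in>{a<..<T}. mass_tail (real n) t \<partial>lborel) \<longlonglongrightarrow> (\<integral>\<^sup>+t. 0 \<partial>(lborel :: real measure))"
  proof (rule nn_integral_dominated_convergence[where w="\<lambda>t. mass t * indicator {a<..<T} t"])
    show "(\<integral>\<^sup>+t\<in>{a<..<T}. mass t \<partial>lborel) < \<infinity>" by (rule mass_int)
    show "AE t in lborel. (\<lambda>n. mass_tail (real n) t * indicator {a<..<T} t) \<longlonglongrightarrow> 0"
      using inner by (auto simp: indicator_def)
    show "AE t in lborel. mass_tail (real n) t * indicator {a<..<T} t \<le> mass t * indicator {a<..<T} t" for n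
      by (intro AE_I2 mult_right_mono mass_tail_le) simp
  qed auto
  then show ?thesis by simp
qed

text \<open>The initial condition is uniform on bounded sets only; control at infinity comes from
  the masses.\<close>

context
  assumes initial: "\<And>r \<eta>. \<eta> > 0 \<Longrightarrow> \<exists>t'>a. \<forall>t x. a < t \<longrightarrow> t \<le> t' \<longrightarrow> norm x \<le> r \<longrightarrow> w t x \<le> \<eta>"
begin

text \<open>One sequence \<open>\<epsilon> n\<close> serves as initial slack and as truncation level
  of the test function, while radii \<open>r n \<ge> n\<close> make the tail correction vanish.
  Since \<open>C\<close> depends on none of these, Fatou's lemma yields an inequality with the same
  weight on both sides.\<close>

lemma mass_estimate: "\<exists>C\<ge>0. \<forall>T>a. mass T \<le> ennreal C * (\<integral>\<^sup>+t\<in>{a<..<T}. mass t \<partial>lborel)"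
proof -
  obtain C where C: "C \<ge> 0" "\<And>\<gamma> h (x::'a). \<gamma> \<ge> 0 \<Longrightarrow> 0 < h \<Longrightarrow> h \<le> 1/4 \<Longrightarrow>
      trunc_gen p h (test_fun p \<gamma>) x \<le> C * decay (p / 2) x"
    using trunc_gen_test_fun[OF p] by blast
  have "mass T \<le> ennreal (c * C) * (\<integral>\<^sup>+t\<in>{a<..<T}. mass t \<partial>lborel)" if T: "a < T" for T
  proof -
    let ?X = "ennreal (c * C) * (\<integral>\<^sup>+t\<in>{a<..<T}. mass t \<partial>lborel)"
    define K where "K = c * 2 powr (3 * p / 2)"
    define tl where "tl r = enn2real (\<integral>\<^sup>+t\<in>{a<..<T}. mass_tail r t \<partial>lborel)" for r
    define \<epsilon> where "\<epsilon> n = inverse (real (Suc n))" for n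
    have \<epsilon>: "\<epsilon> n > 0" for n by (simp add: \<epsilon>_def)
    have \<epsilon>0: "\<epsilon> \<longlonglongrightarrow> 0" unfolding \<epsilon>_def by (rule LIMSEQ_inverse_real_of_nat)
    have ex: "\<exists>r\<ge>real n. (\<integral>\<^sup>+x. ennreal (test_fun p (\<epsilon> n) x * max 0 (w T x - \<epsilon> n - K * tl r)) \<partial>lborel) \<le> ?X" for n
    proof -
      obtain R where R: "R > 0" "\<And>x::'a. norm x > R \<Longrightarrow> test_fun p (\<epsilon> n) x = 0"
        using test_fun_support[OF p_pos \<epsilon>[of n]] by blast
      \<comment> \<open>The first entry separates the support from the far field; the second forces
        the radius to infinity with \<open>n\<close>.\<close>
      define R' where "R' = max (2 * (R + 1)) (real n)"
      obtain t' where t': "t' > a" "\<And>t x. a < t \<Longrightarrow> t \<le> t' \<Longrightarrow> norm x \<le> R' \<Longrightarrow> w t x \<le> \<epsilon> n"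
        using initial[OF \<epsilon>[of n], of R'] by blast
      \<comment> \<open>Early enough for the initial bound to hold, and strictly between
        \<open>a\<close> and \<open>T\<close>.\<close>
      define t0 where "t0 = min t' ((a + T) / 2)"
      interpret B: frac_subsolution_ball p c a w t0 T R R' "\<epsilon> n" "\<epsilon> n" C
      proof unfold_locales
        show "a < t0" "t0 < T" using t'(1) T by (auto simp: t0_def min_def)
        show "w t0 x \<le> \<epsilon> n" if "norm x \<le> R'" for x
          using t'(2)[of t0 x] that t'(1) T by (auto simp: t0_def min_def)
      qed (use R \<epsilon>[of n] C in \<open>auto simp: R'_def less_imp_le\<close>)
      show ?thesis
        using B.ball_estimate_tail unfolding B.C'_def
        by (intro exI[of _ R']) (simp add: R'_def K_def tl_def)
    qed
    obtain r where r: "\<And>n. r n \<ge> real n"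
      "\<And>n. (\<integral>\<^sup>+x. ennreal (test_fun p (\<epsilon> n) x * max 0 (w T x - \<epsilon> n - K * tl (r n))) \<partial>lborel) \<le> ?X"
    proof -
      have "\<forall>n. \<exists>r\<ge>real n. (\<integral>\<^sup>+x. ennreal (test_fun p (\<epsilon> n) x * max 0 (w T x - \<epsilon> n - K * tl r)) \<partial>lborel) \<le> ?X"
        by (intro allI ex)
      from choice[OF this] show ?thesis using that by blast
    qed
    have tl0: "(\<lambda>n. tl (r n)) \<longlonglongrightarrow> 0"
    proof (rule tendsto_sandwich[OF _ _ tendsto_const])
      have fin: "(\<integral>\<^sup>+t\<in>{a<..<T}. mass_tail s t \<partial>lborel) < \<infinity>" for s
        by (rule le_less_trans[OF _ mass_int[of T]]) (intro nn_integral_mono mult_right_mono mass_tail_le, simp)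
      show "(\<lambda>n. tl (real n)) \<longlonglongrightarrow> 0"
      proof -
        have "(\<lambda>n. \<integral>\<^sup>+t\<in>{a<..<T}. mass_tail (real n) t \<partial>lborel) \<longlonglongrightarrow> ennreal 0"
          using mass_tail_integral_tendsto[of T] by simp
        from tendsto_enn2real[OF this] show ?thesis by (simp add: tl_def)
      qed
      have "tl (r n) \<le> tl (real n)" for n
        unfolding tl_def using fin[of "real n"]
        by (intro enn2real_mono nn_integral_mono mult_right_mono mass_tail_antimono r) auto
      then show "\<forall>\<^sub>F n in sequentially. tl (r n) \<le> tl (real n)" by simp
      show "\<forall>\<^sub>F n in sequentially. 0 \<le> tl (r n)" by (simp add: tl_def)
    qed
    have wm: "w T \<in> borel_measurable borel" by (rule borel_measurable_continuous_onI[OF w_cont_x[OF T]])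
    have "mass T = (\<integral>\<^sup>+x. liminf (\<lambda>n. ennreal (test_fun p (\<epsilon> n) x * max 0 (w T x - \<epsilon> n - K * tl (r n)))) \<partial>lborel)"
      unfolding mass_def
    proof (intro nn_integral_cong)
      fix x :: 'a
      have "filterlim \<epsilon> (at_right 0) sequentially"
        using \<epsilon>0 \<epsilon> by (auto simp: filterlim_at intro!: always_eventually less_imp_neq[symmetric])
      then have "(\<lambda>n. test_fun p (\<epsilon> n) x) \<longlonglongrightarrow> decay (p / 2) x"
        by (rule filterlim_compose[OF test_fun_tendsto])
      moreover have "(\<lambda>n. max 0 (w T x - \<epsilon> n - K * tl (r n))) \<longlonglongrightarrow> max 0 (w T x - 0 - K * 0)"
        by (intro tendsto_intros \<epsilon>0 tl0)
      ultimately have "(\<lambda>n. ennreal (test_fun p (\<epsilon> n) x * max 0 (w T x - \<epsilon> n - K * tl (r n))))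
          \<longlonglongrightarrow> ennreal (decay (p / 2) x * max 0 (w T x - 0 - K * 0))"
        by (intro tendsto_ennrealI tendsto_mult)
      then have "liminf (\<lambda>n. ennreal (test_fun p (\<epsilon> n) x * max 0 (w T x - \<epsilon> n - K * tl (r n))))
          = ennreal (decay (p / 2) x * max 0 (w T x - 0 - K * 0))"
        by (rule lim_imp_Liminf[OF sequentially_bot])
      then show "ennreal (wp T x * decay (p / 2) x) = liminf (\<lambda>n. ennreal (test_fun p (\<epsilon> n) x * max 0 (w T x - \<epsilon> n - K * tl (r n))))"
        using T by (simp add: wp_def mult.commute)
    qed
    also have "\<dots> \<le> liminf (\<lambda>n. \<integral>\<^sup>+x. ennreal (test_fun p (\<epsilon> n) x * max 0 (w T x - \<epsilon> n - K * tl (r n))) \<partial>lborel)"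
      using wm by (intro nn_integral_liminf) simp
    also have "\<dots> \<le> ?X"
      by (intro Liminf_le sequentially_bot always_eventually allI r)
    finally show ?thesis .
  qed
  then show ?thesis using C(1) c by (intro exI[of _ "c * C"]) auto
qed

text \<open>Gronwall annihilates the mass at every time. The weight is positive, so the positive
  part vanishes almost everywhere, and continuity in space removes the exceptional set.\<close>

theorem subsolution_nonpos:
  assumes "a < t"
  shows "w t x \<le> 0"
proof -
  obtain C where "C \<ge> 0" "\<And>T. a < T \<Longrightarrow> mass T \<le> ennreal C * (\<integral>\<^sup>+t\<in>{a<..<T}. mass t \<partial>lborel)"
    using mass_estimate by blast
  from ennreal_gronwall[OF mass_measurable this(1) mass_int this(2) assms]
  have "mass t = 0" .
  then have "AE x in lborel. ennreal (wp t x * decay (p / 2) x) = 0"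
    unfolding mass_def by (subst (asm) nn_integral_0_iff_AE) auto
  then have "AE x in lborel. max 0 (w t x) = 0"
  proof eventually_elim
    case (elim x)
    then have "wp t x * decay (p / 2) x \<le> 0" by (simp add: ennreal_eq_0_iff)
    then show ?case using assms decay_pos[of "p / 2" x] by (simp add: wp_def mult_le_0_iff)
  qed
  moreover have "continuous_on UNIV (\<lambda>x. max 0 (w t x))"
    by (intro continuous_intros w_cont_x[OF assms])
  ultimately have "max 0 (w t x) = 0" using AE_zero_continuous_imp_zero by blast
  then show ?thesis by simp
qed

end

end

section \<open>A barrier and the strong maximum principle\<close>

text \<open>A parabolic cap. It lies above \<open>1 - |x|^2\<close> everywhere, so at a point of the
  open ball second differences are bounded below by a quadratic even if the shifted points leave the
  ball.\<close>

definition bump :: "'a::euclidean_space \<Rightarrow> real" where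
  "bump x = max 0 (1 - (norm x)\<^sup>2)"

lemma bump_measurable [measurable]: "bump \<in> borel_measurable borel"
  unfolding bump_def by measurable

lemma bump_bounds: "0 \<le> bump x" "bump x \<le> 1" "\<bar>bump x\<bar> \<le> 1"
  by (auto simp: bump_def)

lemma bump_eq: "norm x < 1 \<Longrightarrow> bump x = 1 - (norm x)\<^sup>2"
  using power_mono[of "norm x" 1 2] by (simp add: bump_def)

lemma bump_zero: "1 \<le> norm x \<Longrightarrow> bump x = 0"
  by (simp add: bump_def)

lemma bump_pos_iff: "0 < bump x \<longleftrightarrow> norm x < 1"
  by (cases "norm x < 1") (auto simp: bump_eq bump_zero abs_square_less_1)

lemma bump_integrable: "integrable lborel (bump :: 'a::euclidean_space \<Rightarrow> real)"
proof (rule Bochner_Integration.integrable_bound)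
  show "integrable lborel (indicator (cball 0 1) :: 'a \<Rightarrow> real)"
    by (rule integrable_real_indicator) (auto simp: emeasure_cball)
  show "AE x in lborel. norm (bump (x::'a)) \<le> norm (indicator (cball 0 1) x :: real)"
    by (intro AE_I2) (auto simp: indicator_def bump_bounds bump_zero)
qed simp

lemma bump_integral_pos: "0 < (LINT x|lborel. bump (x::'a::euclidean_space))"
proof (rule ccontr)
  assume "\<not> ?thesis"
  moreover have "0 \<le> (LINT x|lborel. bump (x::'a))"
    using bump_bounds by (intro Bochner_Integration.integral_nonneg) auto
  ultimately have "(LINT x|lborel. bump (x::'a)) = 0" by linarith
  then have "AE x in lborel. bump (x::'a) = 0"
    using integral_nonneg_eq_0_iff_AE[OF bump_integrable] bump_bounds by auto
  moreover have "continuous_on UNIV (bump :: 'a \<Rightarrow> real)"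
    unfolding bump_def by (intro continuous_intros)
  ultimately have "bump (0::'a) = 0" using AE_zero_continuous_imp_zero by blast
  then show False by (simp add: bump_def)
qed

text \<open>The critical points are near the unit sphere, where \<open>bump x\<close> is too small
  to absorb any fixed loss. There the loss from short jumps, at most \<open>near_mass\<close> of
  radius \<open>\<rho>\<close>, is outweighed by the gain from long jumps into the ball, on which
  the kernel is at least \<open>2 powr - p\<close> because two points of the unit ball are less than
  \<open>2\<close> apart. What remains is \<open>\<kappa> * bump x\<close>, with
  \<open>\<kappa>\<close> the mass of the kernel beyond \<open>\<rho>\<close>.\<close>

lemma trunc_gen_bump:
  assumes p: "real DIM('a) < p" "p < real DIM('a) + 2"
  shows "\<exists>K\<ge>0. \<exists>h0>0. \<forall>h. 0 < h \<longrightarrow> h \<le> h0 \<longrightarrow> (\<forall>x::'a::euclidean_space. norm x < 1 \<longrightarrow>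
    - trunc_gen p h bump x \<le> K * bump x)"
proof -
  let ?n = "DIM('a)"
  let ?b = "LINT x|lborel. bump (x::'a)" and ?w = "unit_ball_vol (real ?n)"
  have p0: "p > 0" using p by (smt (verit) of_nat_0_le_iff)
  have "((\<lambda>\<rho>. near_mass TYPE('a) p \<rho> + 2 powr - p * (?w * \<rho> ^ ?n)) \<longlongrightarrow> 0 + 2 powr - p * (?w * 0 ^ ?n)) (at_right 0)"
    by (intro tendsto_intros near_mass_tendsto_0 p)
  then have "((\<lambda>\<rho>. near_mass TYPE('a) p \<rho> + 2 powr - p * (?w * \<rho> ^ ?n)) \<longlongrightarrow> 0) (at_right 0)"
    by (simp add: zero_power)
  from order_tendstoD(2)[OF this, of "2 powr - p * ?b"] bump_integral_pos[where 'a='a]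
  have "\<forall>\<^sub>F \<rho> in at_right 0. near_mass TYPE('a) p \<rho> + 2 powr - p * (?w * \<rho> ^ ?n) < 2 powr - p * ?b" by simp
  moreover have "\<forall>\<^sub>F \<rho> in at_right 0. (0::real) < \<rho>" by (simp add: eventually_at_filter)
  ultimately have "\<forall>\<^sub>F \<rho> in at_right 0. 0 < \<rho> \<and> near_mass TYPE('a) p \<rho> + 2 powr - p * (?w * \<rho> ^ ?n) < 2 powr - p * ?b"
    by eventually_elim simp
  \<comment> \<open>The inequality says exactly that gain exceeds loss; the volume term accounts for
    the jumps shorter than \<open>\<rho>\<close>, which are excluded from the gain.\<close>
  then obtain \<rho> where \<rho>: "0 < \<rho>" "near_mass TYPE('a) p \<rho> + 2 powr - p * (?w * \<rho> ^ ?n) < 2 powr - p * ?b"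
    using eventually_happens'[OF trivial_limit_at_right_real] by blast
  define \<kappa> where "\<kappa> = (LINT z|lborel. cut_kernel p \<rho> (z::'a))"
  note ik = integrable_cut_kernel[OF p(1) \<rho>(1)]
  have "- trunc_gen p h bump x \<le> \<kappa> * bump x" if h: "0 < h" "h \<le> \<rho>" and x: "norm x < 1" for h and x :: 'a
  proof -
    have it: "integrable lborel (\<lambda>z. bump (x + z))"
    proof -
      have "integrable (distr lborel borel ((+) x)) bump" using bump_integrable by (simp add: lborel_distr_plus)
      then show ?thesis by (simp add: integrable_distr_eq)
    qed
    have ib: "integrable lborel (\<lambda>z. bump (x + z) * cut_kernel p \<rho> z)"
      by (rule integrable_shift_kernel[OF p(1) _ bump_bounds(3) \<rho>(1)]) simp
    have ic: "integrable lborel (indicator (cball 0 \<rho>) :: 'a \<Rightarrow> real)"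
      by (rule integrable_real_indicator) (use \<rho> in \<open>auto simp: emeasure_cball\<close>)
    have "2 powr - p * (?b - ?w * \<rho> ^ ?n) = (LINT z|lborel. 2 powr - p * (bump (x + z) - indicator (cball 0 \<rho>) z))"
      using it ic integral_translate[of bump x] \<rho>(1)
      by (simp add: measure_def emeasure_cball)
    also have "\<dots> \<le> (LINT z|lborel. bump (x + z) * cut_kernel p \<rho> z)"
    proof (rule Bochner_Integration.integral_mono)
      show "integrable lborel (\<lambda>z. 2 powr - p * (bump (x + z) - indicator (cball 0 \<rho>) z))" using it ic by simp
      fix z :: 'a
      show "2 powr - p * (bump (x + z) - indicator (cball 0 \<rho>) z) \<le> bump (x + z) * cut_kernel p \<rho> z"
      proof (cases "norm z \<le> \<rho>")
        case True
        have "2 powr - p * (bump (x + z) - 1) \<le> 0" using bump_bounds(2)[of "x + z"] by (simp add: mult_le_0_iff)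
        moreover have "0 \<le> bump (x + z) * cut_kernel p \<rho> z" by (simp add: bump_bounds(1))
        ultimately show ?thesis using True by simp
      next
        case False
        then have k: "cut_kernel p \<rho> z = norm z powr - p" and nz: "0 < norm z" using \<rho>(1) by (auto simp: cut_kernel_def)
        show ?thesis
        proof (cases "norm (x + z) < 1")
          case True
          have "norm z \<le> norm (x + z) + norm x" by (metis add_diff_cancel_left' norm_triangle_ineq4)
          then have "2 powr - p \<le> norm z powr - p" using True x nz p0 by (intro powr_mono2') auto
          then have "2 powr - p * bump (x + z) \<le> norm z powr - p * bump (x + z)"
            using bump_bounds(1) by (intro mult_right_mono)
          then show ?thesis using False k by (simp add: mult.commute)
        next
          case f: False
          then show ?thesis using False bump_zero[of "x + z"] by simp
        qed
      qed
    qed (rule ib)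
    finally have far: "2 powr - p * (?b - ?w * \<rho> ^ ?n) \<le> (LINT z|lborel. bump (x + z) * cut_kernel p \<rho> z)" .
    have "trunc_gen p \<rho> bump x = (LINT z|lborel. bump (x + z) * cut_kernel p \<rho> z) - bump x * \<kappa>"
      unfolding trunc_gen_def \<kappa>_def left_diff_distrib using ib ik by simp
    then have far': "trunc_gen p \<rho> (\<lambda>x. - bump x) x \<le> bump x * \<kappa> - 2 powr - p * (?b - ?w * \<rho> ^ ?n)"
      using far by (simp add: trunc_gen_uminus)
    have "trunc_gen p h (\<lambda>x. - bump x) x \<le> 1 * near_mass TYPE('a) p \<rho> + trunc_gen p \<rho> (\<lambda>x. - bump x) x"
    proof (rule trunc_gen_le[OF p(1)])
      show "\<bar>- bump y\<bar> \<le> 1" for y :: 'a using bump_bounds(3) by simp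
      fix z :: 'a
      have "(norm (x + z))\<^sup>2 + (norm (x - z))\<^sup>2 = 2 * (norm x)\<^sup>2 + 2 * (norm z)\<^sup>2"
        by (simp add: power2_norm_eq_inner inner_simps inner_commute)
      moreover have "bump (x + z) \<ge> 1 - (norm (x + z))\<^sup>2" "bump (x - z) \<ge> 1 - (norm (x - z))\<^sup>2"
        by (auto simp: bump_def)
      ultimately show "- bump (x + z) + - bump (x - z) - 2 * - bump x \<le> 2 * 1 * (norm z)\<^sup>2"
        using bump_eq[OF x] by simp
    qed (use h p in auto)
    then show ?thesis using far' \<rho>(2) by (simp add: trunc_gen_uminus algebra_simps)
  qed
  moreover have "0 \<le> \<kappa>" unfolding \<kappa>_def by (intro Bochner_Integration.integral_nonneg) simp
  ultimately show ?thesis using \<rho>(1) by blast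
qed

text \<open>At a global maximum the integrand is nonpositive, so the truncated integrals decrease as
  \<open>h\<close> does, and the limit \<open>0\<close> forces each of them to vanish. As the kernel
  is positive beyond \<open>h\<close>, the function equals its maximum there almost everywhere,
  hence everywhere by continuity.\<close>

lemma trunc_gen_zero_imp_constant:
  fixes \<phi> :: "'a::euclidean_space \<Rightarrow> real"
  assumes cont: "continuous_on UNIV \<phi>" and le: "\<And>z. \<phi> z \<le> \<phi> x"
    and int: "\<And>h. 0 < h \<Longrightarrow> integrable lborel (\<lambda>z. (\<phi> (x + z) - \<phi> x) * cut_kernel p h z)"
    and lim: "((\<lambda>h. trunc_gen p h \<phi> x) \<longlongrightarrow> 0) (at_right 0)"
  shows "\<phi> y = \<phi> x"
proof (cases "y = x")
  case False
  define h where "h = norm (y - x) / 2"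
  have h: "h > 0" using False by (simp add: h_def)
  have [measurable]: "\<phi> \<in> borel_measurable borel" by (rule borel_measurable_continuous_onI[OF cont])
  have np: "(\<phi> (x + z) - \<phi> x) * cut_kernel p h z \<le> 0" for h z
    using le[of "x + z"] by (simp add: mult_le_0_iff)
  have "trunc_gen p h \<phi> x \<ge> 0"
  proof (rule tendsto_upperbound[OF lim])
    have "\<forall>\<^sub>F h' in at_right 0. 0 < h' \<and> h' < h" unfolding eventually_at_right_field using h by blast
    then show "\<forall>\<^sub>F h' in at_right 0. trunc_gen p h' \<phi> x \<le> trunc_gen p h \<phi> x"
    proof eventually_elim
      case (elim h')
      show ?case unfolding trunc_gen_def
      proof (rule Bochner_Integration.integral_mono)
        fix z :: 'a
        have "cut_kernel p h z \<le> cut_kernel p h' z" using elim by (auto simp: cut_kernel_def indicator_def)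
        then show "(\<phi> (x + z) - \<phi> x) * cut_kernel p h' z \<le> (\<phi> (x + z) - \<phi> x) * cut_kernel p h z"
          using le[of "x + z"] by (intro mult_left_mono_neg) auto
      qed (use int h elim in auto)
    qed
  qed simp
  moreover have "(LINT z|lborel. - ((\<phi> (x + z) - \<phi> x) * cut_kernel p h z)) = - trunc_gen p h \<phi> x"
    by (simp add: trunc_gen_def)
  moreover have "0 \<le> (LINT z|lborel. - ((\<phi> (x + z) - \<phi> x) * cut_kernel p h z))"
    using np by (intro Bochner_Integration.integral_nonneg) (metis neg_0_le_iff_le)
  ultimately have "(LINT z|lborel. - ((\<phi> (x + z) - \<phi> x) * cut_kernel p h z)) = 0" by linarith
  then have "AE z in lborel. - ((\<phi> (x + z) - \<phi> x) * cut_kernel p h z) = 0"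
    using integral_nonneg_eq_0_iff_AE[of lborel "\<lambda>z. - ((\<phi> (x + z) - \<phi> x) * cut_kernel p h z)"]
      int[OF h] np by simp
  \<comment> \<open>\<open>max 0 (norm z - h)\<close> is a continuous replacement for the kernel
    with the same zero set, so that vanishing almost everywhere can be upgraded by
    continuity.\<close>
  then have "AE z in lborel. (\<phi> (x + z) - \<phi> x) * max 0 (norm z - h) = 0"
    by eventually_elim (use h in \<open>auto simp: cut_kernel_def indicator_def max_def split: if_splits\<close>)
  moreover have "continuous_on UNIV (\<lambda>z. (\<phi> (x + z) - \<phi> x) * max 0 (norm z - h))"
    by (intro continuous_intros continuous_on_compose2[OF cont]) auto
  ultimately have "(\<phi> (x + (y - x)) - \<phi> x) * max 0 (norm (y - x) - h) = 0"
    using AE_zero_continuous_imp_zero by blast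
  then show ?thesis using h by (simp add: h_def max_def split: if_splits)
qed simp

section \<open>Comparison with the flat solution\<close>

lemma frac_const_pos:
  assumes "0 < s" "s < 1"
  shows "0 < frac_const N s"
proof -
  have "0 < Gamma (real N / 2 + s)" "0 < Gamma (2 - s)"
    using assms by (auto simp: Gamma_real_pos_exp add_nonneg_pos)
  then show ?thesis using assms by (simp add: frac_const_def)
qed

text \<open>The substitution of \<open>x + z\<close> for \<open>z\<close> centres the integrals at
  the origin. Continuity of \<open>\<phi>\<close> makes the integrands Borel, which permits the
  passage from Lebesgue measure to \<open>lborel\<close>.\<close>

lemma has_frac_laplacian_trunc_gen:
  fixes \<phi> :: "real ^ 'n \<Rightarrow> real"
  assumes L: "has_frac_laplacian s \<phi> x l" and cont: "continuous_on UNIV \<phi>"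
  defines "p \<equiv> real CARD('n) + 2 * s"
  shows "\<And>h. 0 < h \<Longrightarrow> integrable lborel (\<lambda>z. (\<phi> (x + z) - \<phi> x) * cut_kernel p h z)"
    "((\<lambda>h. - (frac_const CARD('n) s * trunc_gen p h \<phi> x)) \<longlongrightarrow> l) (at_right 0)"
proof -
  have [measurable]: "\<phi> \<in> borel_measurable borel" by (rule borel_measurable_continuous_onI[OF cont])
  define f where "f h z = (\<phi> x - \<phi> z) * cut_kernel p h (z - x)" for h z
  have [measurable]: "f h \<in> borel_measurable borel" for h unfolding f_def by measurable
  have f_eq: "(\<lambda>z. indicator {z. h < norm (z - x)} z *\<^sub>R frac_kernel_diff s \<phi> x z) = f h" for h
  proof
    fix z
    have "frac_kernel_diff s \<phi> x z = (\<phi> x - \<phi> z) / norm (z - x) powr p"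
      by (simp add: frac_kernel_diff_def p_def)
    then show "indicator {z. h < norm (z - x)} z *\<^sub>R frac_kernel_diff s \<phi> x z = f h z"
      by (simp add: f_def cut_kernel_def powr_minus_divide indicator_def)
  qed
  have int: "integrable lebesgue (f h)" if "h > 0" for h
    using L that unfolding has_frac_laplacian_def set_integrable_def f_eq[symmetric] by simp
  have "integrable lborel (f h)" if "h > 0" for h
    using int[OF that] by (subst (asm) integrable_completion) auto
  then have "integrable (distr lborel borel ((+) x)) (f h)" if "h > 0" for h
    using that by (simp add: lborel_distr_plus)
  then have "integrable lborel (\<lambda>z. f h (x + z))" if "h > 0" for h
    using that by (simp add: integrable_distr_eq)
  then have neg: "integrable lborel (\<lambda>z. - ((\<phi> (x + z) - \<phi> x) * cut_kernel p h z))" if "h > 0" for h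
    using that by (simp add: f_def algebra_simps)
  show "integrable lborel (\<lambda>z. (\<phi> (x + z) - \<phi> x) * cut_kernel p h z)" if "0 < h" for h
    using integrable_minus[OF neg[OF that]] by simp
  have "(LINT z:{z. h < norm (z - x)}|lebesgue. frac_kernel_diff s \<phi> x z) = - trunc_gen p h \<phi> x" for h
  proof -
    have "(LINT z:{z. h < norm (z - x)}|lebesgue. frac_kernel_diff s \<phi> x z) = (LINT z|lborel. f h z)"
      unfolding set_lebesgue_integral_def f_eq by (rule integral_completion) simp
    also have "\<dots> = (LINT z|lborel. f h (x + z))" by (rule integral_translate[symmetric]) simp
    also have "\<dots> = (LINT z|lborel. - ((\<phi> (x + z) - \<phi> x) * cut_kernel p h z))"
      by (simp add: f_def algebra_simps)
    finally show ?thesis by (simp add: trunc_gen_def)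
  qed
  then show "((\<lambda>h. - (frac_const CARD('n) s * trunc_gen p h \<phi> x)) \<longlongrightarrow> l) (at_right 0)"
    using L unfolding has_frac_laplacian_def by simp
qed

lemma decay_le_frac_weight:
  fixes x :: "'a::euclidean_space"
  assumes "p > 0"
  shows "decay (p / 2) x \<le> 2 / (1 + norm x powr p)"
proof -
  have x1: "1 \<le> 1 + (norm x)\<^sup>2" by simp
  have "norm x powr p \<le> (1 + (norm x)\<^sup>2) powr (p / 2)"
  proof (cases "x = 0")
    case False
    then have "norm x powr p = ((norm x)\<^sup>2) powr (p / 2)" by (simp add: powr_powr flip: powr_numeral)
    also have "\<dots> \<le> (1 + (norm x)\<^sup>2) powr (p / 2)" using assms by (intro powr_mono2) auto
    finally show ?thesis .
  qed simp
  moreover have "1 \<le> (1 + (norm x)\<^sup>2) powr (p / 2)" using x1 assms by (intro ge_one_powr_ge_zero) auto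
  ultimately have le: "1 + norm x powr p \<le> 2 * (1 + (norm x)\<^sup>2) powr (p / 2)" by linarith
  have "decay (p / 2) x = 1 / (1 + (norm x)\<^sup>2) powr (p / 2)" by (simp add: decay_def powr_minus_divide)
  also have "\<dots> \<le> 2 / (1 + norm x powr p)"
  proof -
    have "0 < 1 + norm x powr p" by (simp add: add_pos_nonneg)
    moreover have "0 < (1 + (norm x)\<^sup>2) powr (p / 2)" using x1 by (intro powr_gt_zero[THEN iffD2]) linarith
    ultimately show ?thesis using le by (simp add: divide_simps mult.commute)
  qed
  finally show ?thesis .
qed

locale absorption_solution = absorption g
  for g :: "real \<Rightarrow> real" +
  fixes s \<beta> :: real and u :: "real \<Rightarrow> real ^ 'n \<Rightarrow> real"
  assumes s: "0 < s" "s < 1" and beta: "\<beta> > -1"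
    and u_nonneg: "\<And>t x. t > 0 \<Longrightarrow> u t x \<ge> 0"
    and sol: "classical_solution s \<beta> g u"
    and L1: "L1_loc_frac_space s u"
begin

definition p :: real where "p = real CARD('n) + 2 * s"

definition c :: real where "c = frac_const CARD('n) s"

abbreviation U :: "real \<Rightarrow> real" where "U \<equiv> shifted_flat \<beta> 0"

lemma p_bounds: "real DIM(real ^ 'n) < p" "p < real DIM(real ^ 'n) + 2" "p > 0"
  using s by (auto simp: p_def add_nonneg_pos)

lemma c_pos: "c > 0"
  unfolding c_def by (rule frac_const_pos[OF s])

section \<open>The equation and the weighted mass of the given solution\<close>

lemma u_cont: "continuous_on ({0<..} \<times> UNIV) (\<lambda>(t, x). u t x)"
  using sol by (simp add: classical_solution_def)

lemma u_cont_x: "t > 0 \<Longrightarrow> continuous_on UNIV (u t)"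
proof -
  assume "t > 0"
  then have "continuous_on UNIV (\<lambda>x. case (t, x) of (t, x) \<Rightarrow> u t x)"
    by (intro continuous_on_compose2[OF u_cont]) (auto intro!: continuous_intros)
  then show ?thesis by simp
qed

lemma equation:
  assumes "t > 0"
  shows "\<exists>D L. ((\<lambda>\<tau>. u \<tau> x) has_real_derivative D) (at t) \<and>
    (\<forall>h>0. integrable lborel (\<lambda>z. (u t (x + z) - u t x) * cut_kernel p h z)) \<and>
    ((\<lambda>h. - (c * trunc_gen p h (u t) x)) \<longlongrightarrow> L) (at_right 0) \<and>
    D + L + t powr \<beta> * g (u t x) = 0"
proof -
  obtain D L where DL: "((\<lambda>\<tau>. u \<tau> x) has_real_derivative D) (at t)"
    "has_frac_laplacian s (u t) x L" "D + L + t powr \<beta> * g (u t x) = 0"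
    using sol assms unfolding classical_solution_def by blast
  then show ?thesis
    using has_frac_laplacian_trunc_gen[OF DL(2) u_cont_x[OF assms]]
    by (intro exI[of _ D] exI[of _ L]) (simp add: p_def c_def)
qed

lemma u_mass_le:
  assumes "t > 0"
  shows "(\<integral>\<^sup>+x. ennreal (u t x * decay (p / 2) x) \<partial>lborel) \<le> ennreal (2 * frac_space_norm s (u t))"
proof -
  have i: "integrable lebesgue (frac_weighted s (u t))"
    using L1 assms by (simp add: L1_loc_frac_space_def frac_space_def)
  have nn: "0 \<le> frac_weighted s (u t) x" for x by (simp add: frac_weighted_def add_nonneg_nonneg)
  have "(\<integral>\<^sup>+x. ennreal (u t x * decay (p / 2) x) \<partial>lborel) \<le> (\<integral>\<^sup>+x. ennreal (2 * frac_weighted s (u t) x) \<partial>lborel)"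
  proof (intro nn_integral_mono ennreal_leI)
    fix x
    have "u t x * decay (p / 2) x \<le> u t x * (2 / (1 + norm x powr p))"
      using decay_le_frac_weight[OF p_bounds(3), of x] u_nonneg[OF assms] by (intro mult_left_mono) auto
    then show "u t x * decay (p / 2) x \<le> 2 * frac_weighted s (u t) x"
      using u_nonneg[OF assms, of x] by (simp add: frac_weighted_def p_def mult.commute)
  qed
  also have "\<dots> = (\<integral>\<^sup>+x. ennreal (2 * frac_weighted s (u t) x) \<partial>lebesgue)"
    by (rule nn_integral_completion[symmetric])
  also have "\<dots> = ennreal (LINT x|lebesgue. 2 * frac_weighted s (u t) x)"
    using i nn by (intro nn_integral_eq_integral) auto
  also have "\<dots> = ennreal (2 * frac_space_norm s (u t))" by (simp add: frac_space_norm_def)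
  finally show ?thesis .
qed

lemma u_mass_integrable:
  assumes "0 < a" "a \<le> T"
  shows "(\<integral>\<^sup>+t\<in>{a<..<T}. (\<integral>\<^sup>+x. ennreal (u t x * decay (p / 2) x) \<partial>lborel) \<partial>lborel) < \<infinity>"
proof -
  have i: "integrable lebesgue (\<lambda>t. indicator {a..T} t *\<^sub>R frac_space_norm s (u t))"
    using L1 assms unfolding L1_loc_frac_space_def set_integrable_def by blast
  have nn: "0 \<le> frac_space_norm s (u t)" for t
    unfolding frac_space_norm_def
    by (intro Bochner_Integration.integral_nonneg) (simp add: frac_weighted_def add_nonneg_nonneg)
  have "(\<integral>\<^sup>+t\<in>{a<..<T}. (\<integral>\<^sup>+x. ennreal (u t x * decay (p / 2) x) \<partial>lborel) \<partial>lborel)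
      \<le> (\<integral>\<^sup>+t. ennreal (2 * (indicator {a..T} t *\<^sub>R frac_space_norm s (u t))) \<partial>lborel)"
    using u_mass_le assms by (intro nn_integral_mono) (auto simp: indicator_def)
  also have "\<dots> = (\<integral>\<^sup>+t. ennreal (2 * (indicator {a..T} t *\<^sub>R frac_space_norm s (u t))) \<partial>lebesgue)"
    by (rule nn_integral_completion[symmetric])
  also have "\<dots> = ennreal (LINT t|lebesgue. 2 * (indicator {a..T} t *\<^sub>R frac_space_norm s (u t)))"
    using integrable_mult_right[OF i, of 2] nn by (intro nn_integral_eq_integral) auto
  also have "\<dots> < \<infinity>" by simp
  finally show ?thesis .
qed

lemma U_pos: "t > 0 \<Longrightarrow> U t > 0"
  by (rule shifted_flat_pos[OF beta]) auto

lemma U_deriv: "t > 0 \<Longrightarrow> (U has_real_derivative - (t powr \<beta> * g (U t))) (at t)"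
  by (rule shifted_flat_deriv[OF beta]) auto

lemma U_cont: "continuous_on {0<..} U"
  by (intro continuous_at_imp_continuous_on ballI DERIV_isCont[OF U_deriv]) auto

text \<open>Where \<open>u\<close> exceeds the flat solution, monotonicity of \<open>g\<close> makes
  the difference a subsolution. Its positive part is at most \<open>u\<close>, which bounds the
  masses. For the initial condition, \<open>u\<close> is bounded on \<open>{a..a + 1}\<close> times
  a ball, whereas the flat solution blows up at \<open>a\<close>.\<close>

lemma u_le_shifted:
  assumes a: "0 < a" and t: "a < t"
  shows "u t x \<le> shifted_flat \<beta> a t"
proof -
  define S where "S = shifted_flat \<beta> a"
  have Sd: "(S has_real_derivative - (t powr \<beta> * g (S t))) (at t)" if "a < t" for t
    unfolding S_def by (rule shifted_flat_deriv[OF beta]) (use a that in auto)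
  have Spos: "S t > 0" if "a < t" for t
    unfolding S_def by (rule shifted_flat_pos[OF beta]) (use a that in auto)
  have Sc: "continuous_on {a<..} S"
    by (intro continuous_at_imp_continuous_on ballI DERIV_isCont[OF Sd]) auto
  let ?w = "\<lambda>t x. u t x - S t"
  have le: "max 0 (?w t x) * decay (p / 2) x \<le> u t x * decay (p / 2) x" if "a < t" for t x
    using Spos[OF that] u_nonneg[of t x] a that by (intro mult_right_mono) auto
  have tg: "trunc_gen p h (\<lambda>x. u t x - S t) x = trunc_gen p h (u t) x" for h t x
    by (simp add: trunc_gen_def)
  interpret W: frac_subsolution p c a ?w
  proof unfold_locales
    show "real DIM(real ^ 'n) < p" "p < real DIM(real ^ 'n) + 2" "0 < c" using p_bounds c_pos by auto
    have "continuous_on ({a<..} \<times> UNIV) (\<lambda>q. (case q of (t, x) \<Rightarrow> u t x) - S (fst q))"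
    proof (intro continuous_intros)
      show "continuous_on ({a<..} \<times> UNIV) (\<lambda>q. case q of (t, x) \<Rightarrow> u t x)"
        by (rule continuous_on_subset[OF u_cont]) (use a in auto)
      show "continuous_on ({a<..} \<times> UNIV) (\<lambda>q. S (fst q))"
        by (rule continuous_on_compose2[OF Sc]) (auto intro!: continuous_intros)
    qed
    then show "continuous_on ({a<..} \<times> UNIV) (\<lambda>(t, x). u t x - S t)" by (simp add: split_def)
  next
    fix t x assume t: "a < t" and w: "0 < u t x - S t"
    then have t0: "0 < t" using a by simp
    obtain D L where DL: "((\<lambda>\<tau>. u \<tau> x) has_real_derivative D) (at t)"
      "\<forall>h>0. integrable lborel (\<lambda>z. (u t (x + z) - u t x) * cut_kernel p h z)"
      "((\<lambda>h. - (c * trunc_gen p h (u t) x)) \<longlongrightarrow> L) (at_right 0)"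
      "D + L + t powr \<beta> * g (u t x) = 0"
      using equation[OF t0, of x] by blast
    have "t powr \<beta> * g (S t) \<le> t powr \<beta> * g (u t x)"
      using monoD[OF g_mono, of "S t" "u t x"] w by (intro mult_left_mono) auto
    then have "(D - - (t powr \<beta> * g (S t))) + L \<le> 0" using DL(4) by simp
    then show "\<exists>D L. ((\<lambda>\<tau>. u \<tau> x - S \<tau>) has_real_derivative D) (at t) \<and>
        ((\<lambda>h. - (c * trunc_gen p h (\<lambda>x. u t x - S t) x)) \<longlongrightarrow> L) (at_right 0) \<and> D + L \<le> 0"
      unfolding tg using DERIV_diff[OF DL(1) Sd[OF t]] DL(3) by blast
    show "integrable lborel (\<lambda>z. (u t (x + z) - S t - (u t x - S t)) * cut_kernel p h z)" if "0 < h" for h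
      using DL(2) that by simp
  next
    fix t assume t: "a < t"
    have "(\<integral>\<^sup>+x. ennreal (max 0 (u t x - S t) * decay (p / 2) x) \<partial>lborel)
        \<le> (\<integral>\<^sup>+x. ennreal (u t x * decay (p / 2) x) \<partial>lborel)"
      by (intro nn_integral_mono ennreal_leI le t)
    also have "\<dots> \<le> ennreal (2 * frac_space_norm s (u t))" by (rule u_mass_le) (use a t in simp)
    also have "\<dots> < \<infinity>" by simp
    finally show "(\<integral>\<^sup>+x. ennreal (max 0 (u t x - S t) * decay (p / 2) x) \<partial>lborel) < \<infinity>" .
  next
    fix T assume T: "a < T"
    have "(\<integral>\<^sup>+t\<in>{a<..<T}. (\<integral>\<^sup>+x. ennreal (max 0 (u t x - S t) * decay (p / 2) x) \<partial>lborel) \<partial>lborel)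
        \<le> (\<integral>\<^sup>+t\<in>{a<..<T}. (\<integral>\<^sup>+x. ennreal (u t x * decay (p / 2) x) \<partial>lborel) \<partial>lborel)"
    proof (intro nn_integral_mono)
      fix t
      show "(\<integral>\<^sup>+x. ennreal (max 0 (u t x - S t) * decay (p / 2) x) \<partial>lborel) * indicator {a<..<T} t
          \<le> (\<integral>\<^sup>+x. ennreal (u t x * decay (p / 2) x) \<partial>lborel) * indicator {a<..<T} t"
        by (cases "a < t") (auto intro!: mult_right_mono nn_integral_mono ennreal_leI le)
    qed
    also have "\<dots> < \<infinity>" by (rule u_mass_integrable) (use a T in auto)
    finally show "(\<integral>\<^sup>+t\<in>{a<..<T}. (\<integral>\<^sup>+x. ennreal (max 0 (u t x - S t) * decay (p / 2) x) \<partial>lborel) \<partial>lborel) < \<infinity>" .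
  qed
  have "?w t x \<le> 0"
  proof (rule W.subsolution_nonpos[OF _ t])
    fix r \<eta> :: real assume "0 < \<eta>"
    let ?K = "{a..a + 1} \<times> cball (0 :: real ^ 'n) r"
    have "continuous_on ?K (\<lambda>(t, x). u t x)" by (rule continuous_on_subset[OF u_cont]) (use a in auto)
    then have "compact ((\<lambda>(t, x). u t x) ` ?K)" by (intro compact_continuous_image compact_Times) auto
    then obtain B where B: "\<And>q. q \<in> ?K \<Longrightarrow> \<bar>(case q of (t, x) \<Rightarrow> u t x)\<bar> \<le> B"
      using compact_imp_bounded[THEN bounded_pos[THEN iffD1]] by (metis image_eqI real_norm_def)
    have "\<forall>\<^sub>F t in at_right a. B \<le> S t"
      using shifted_flat_blowup[OF beta a] unfolding S_def filterlim_at_top by blast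
    then obtain b where b: "b > a" "\<And>t. a < t \<Longrightarrow> t < b \<Longrightarrow> B \<le> S t"
      unfolding eventually_at_right_field by blast
    define t' where "t' = min (a + 1) ((a + b) / 2)"
    have "u t x - S t \<le> \<eta>" if "a < t" "t \<le> t'" "norm x \<le> r" for t x
    proof -
      have "(t, x) \<in> ?K" using that by (auto simp: t'_def)
      from B[OF this] have "u t x \<le> B" by simp
      moreover have "B \<le> S t" using b that by (intro b(2)) (auto simp: t'_def min_def split: if_splits)
      ultimately show ?thesis using \<open>0 < \<eta>\<close> by linarith
    qed
    moreover have "t' > a" using b(1) by (simp add: t'_def)
    ultimately show "\<exists>t'>a. \<forall>t x. a < t \<longrightarrow> t \<le> t' \<longrightarrow> norm x \<le> r \<longrightarrow> u t x - S t \<le> \<eta>" by blast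
  qed
  then show ?thesis by (simp add: S_def)
qed

section \<open>The bound by the maximal flat solution and the spread of contact\<close>

lemma u_le_U:
  assumes "t > 0"
  shows "u t x \<le> U t"
proof (rule tendsto_lowerbound[OF shifted_flat_tendsto[OF beta assms]])
  have "\<forall>\<^sub>F a in at_right 0. 0 < a \<and> a < t" unfolding eventually_at_right_field using assms by blast
  then show "\<forall>\<^sub>F a in at_right 0. u t x \<le> shifted_flat \<beta> a t"
    by eventually_elim (use u_le_shifted in blast)
qed simp

text \<open>The gap \<open>U - u\<close> at the point \<open>x\<close> has an interior minimum in
  time at contact, so the time derivatives agree; the absorption terms agree as well, and
  subtracting the equations leaves operator value \<open>0\<close>. Since \<open>x\<close> is also a
  spatial maximum of \<open>u t\<close>, the function is constant.\<close>

lemma contact_propagates: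
  assumes t: "t > 0" and contact: "u t x = U t"
  shows "u t y = U t"
proof -
  obtain D L where DL: "((\<lambda>\<tau>. u \<tau> x) has_real_derivative D) (at t)"
    "\<forall>h>0. integrable lborel (\<lambda>z. (u t (x + z) - u t x) * cut_kernel p h z)"
    "((\<lambda>h. - (c * trunc_gen p h (u t) x)) \<longlongrightarrow> L) (at_right 0)"
    "D + L + t powr \<beta> * g (u t x) = 0"
    using equation[OF t, of x] by blast
  have "((\<lambda>\<tau>. U \<tau> - u \<tau> x) has_real_derivative - (t powr \<beta> * g (U t)) - D) (at t)"
    by (rule DERIV_diff[OF U_deriv[OF t] DL(1)])
  then have "- (t powr \<beta> * g (U t)) - D = 0"
  proof (rule DERIV_local_min[OF _ t])
    show "\<forall>\<tau>. \<bar>t - \<tau>\<bar> < t \<longrightarrow> U t - u t x \<le> U \<tau> - u \<tau> x"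
      using contact u_le_U by fastforce
  qed
  then have "L = 0" using DL(4) contact by simp
  then have "((\<lambda>h. - (c * trunc_gen p h (u t) x) / - c) \<longlongrightarrow> 0 / - c) (at_right 0)"
    using DL(3) c_pos by (intro tendsto_intros) auto
  then have "((\<lambda>h. trunc_gen p h (u t) x) \<longlongrightarrow> 0) (at_right 0)" using c_pos by simp
  from trunc_gen_zero_imp_constant[OF u_cont_x[OF t] _ DL(2)[rule_format] this, of y]
  show ?thesis using contact u_le_U[OF t] by simp
qed

lemma gap_cont: "continuous_on ({0<..} \<times> UNIV) (\<lambda>(t, x). U t - u t x)"
proof -
  have "continuous_on ({0<..} \<times> UNIV) (\<lambda>q. U (fst q) - (case q of (t, x) \<Rightarrow> u t x))"
    by (intro continuous_intros u_cont continuous_on_compose2[OF U_cont]) auto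
  then show ?thesis by (simp add: split_def)
qed

text \<open>With the roles exchanged, monotonicity of \<open>g\<close> again makes the difference a
  subsolution where it is positive. Its masses are bounded because \<open>0 \<le> u\<close> and
  \<open>U\<close> is nonincreasing, so it is at most \<open>U t0\<close>. The initial condition is
  uniform continuity on compact sets from the vanishing gap at \<open>t0\<close>.\<close>

lemma contact_forward:
  assumes t0: "t0 > 0" and contact: "\<And>x. u t0 x = U t0" and t: "t0 < t"
  shows "u t x = U t"
proof -
  let ?w = "\<lambda>t x. U t - u t x"
  let ?d = "LINT x|lborel. decay (p / 2) (x :: real ^ 'n)"
  have idec: "integrable lborel (decay (p / 2) :: real ^ 'n \<Rightarrow> real)"
    using p_bounds by (intro integrable_decay) simp
  have tg: "trunc_gen p h (\<lambda>x. U t - u t x) x = - trunc_gen p h (u t) x" for h t x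
    unfolding trunc_gen_def by (simp flip: integral_minus) (simp add: algebra_simps)
  have mass_le: "(\<integral>\<^sup>+x. ennreal (max 0 (U t - u t x) * decay (p / 2) x) \<partial>lborel) \<le> ennreal (U t0 * ?d)"
    if "t0 < t" for t
  proof -
    have "U t \<le> U t0"
    proof (rule DERIV_nonpos_imp_nonincreasing[of t0 t U])
      show "t0 \<le> t" using that by simp
      show "\<exists>y. (U has_real_derivative y) (at r) \<and> y \<le> 0" if "t0 \<le> r" "r \<le> t" for r
        using U_deriv[of r] that t0 g_nonneg[of "U r"] by (intro exI[of _ "- (r powr \<beta> * g (U r))"]) auto
    qed
    then have "(\<integral>\<^sup>+x. ennreal (max 0 (U t - u t x) * decay (p / 2) x) \<partial>lborel)
        \<le> (\<integral>\<^sup>+x. ennreal (U t0 * decay (p / 2) (x :: real ^ 'n)) \<partial>lborel)"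
      using u_nonneg[of t] U_pos[OF t0] t0 that
      by (intro nn_integral_mono ennreal_leI mult_right_mono) (auto simp: max_def intro: order_trans[of _ "U t"])
    also have "\<dots> = ennreal (LINT x|lborel. U t0 * decay (p / 2) (x :: real ^ 'n))"
      using idec U_pos[OF t0] by (intro nn_integral_eq_integral) auto
    finally show ?thesis by simp
  qed
  interpret W: frac_subsolution p c t0 ?w
  proof unfold_locales
    show "real DIM(real ^ 'n) < p" "p < real DIM(real ^ 'n) + 2" "0 < c" using p_bounds c_pos by auto
    show "continuous_on ({t0<..} \<times> UNIV) (\<lambda>(t, x). U t - u t x)"
      by (rule continuous_on_subset[OF gap_cont]) (use t0 in auto)
  next
    fix t x assume t: "t0 < t" and w: "0 < U t - u t x"
    then have tp: "0 < t" using t0 by simp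
    obtain D L where DL: "((\<lambda>\<tau>. u \<tau> x) has_real_derivative D) (at t)"
      "\<forall>h>0. integrable lborel (\<lambda>z. (u t (x + z) - u t x) * cut_kernel p h z)"
      "((\<lambda>h. - (c * trunc_gen p h (u t) x)) \<longlongrightarrow> L) (at_right 0)"
      "D + L + t powr \<beta> * g (u t x) = 0"
      using equation[OF tp, of x] by blast
    have "t powr \<beta> * g (u t x) \<le> t powr \<beta> * g (U t)"
      using monoD[OF g_mono, of "u t x" "U t"] w by (intro mult_left_mono) auto
    then have "(- (t powr \<beta> * g (U t)) - D) + - L \<le> 0" using DL(4) by simp
    moreover have "((\<lambda>h. - (c * trunc_gen p h (\<lambda>x. U t - u t x) x)) \<longlongrightarrow> - L) (at_right 0)"
      using tendsto_minus[OF DL(3)] unfolding tg by simp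
    ultimately show "\<exists>D L. ((\<lambda>\<tau>. U \<tau> - u \<tau> x) has_real_derivative D) (at t) \<and>
        ((\<lambda>h. - (c * trunc_gen p h (\<lambda>x. U t - u t x) x)) \<longlongrightarrow> L) (at_right 0) \<and> D + L \<le> 0"
      using DERIV_diff[OF U_deriv[OF tp] DL(1)] by blast
    show "integrable lborel (\<lambda>z. (U t - u t (x + z) - (U t - u t x)) * cut_kernel p h z)" if "0 < h" for h
      using integrable_minus[OF DL(2)[rule_format, OF that]] by (simp add: algebra_simps)
  next
    fix t assume "t0 < t"
    from mass_le[OF this] show "(\<integral>\<^sup>+x. ennreal (max 0 (U t - u t x) * decay (p / 2) x) \<partial>lborel) < \<infinity>"
      by (simp add: le_less_trans[OF _ ennreal_less_top])
  next
    fix T assume T: "t0 < T"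
    have "(\<integral>\<^sup>+t\<in>{t0<..<T}. (\<integral>\<^sup>+x. ennreal (max 0 (U t - u t x) * decay (p / 2) x) \<partial>lborel) \<partial>lborel)
        \<le> (\<integral>\<^sup>+t\<in>{t0<..<T}. ennreal (U t0 * ?d) \<partial>lborel)"
      using mass_le by (intro nn_integral_mono) (auto simp: indicator_def)
    also have "\<dots> = ennreal (U t0 * ?d) * ennreal (T - t0)"
      using T by (simp add: nn_integral_cmult_indicator)
    also have "\<dots> < \<infinity>" by (simp add: ennreal_mult_less_top)
    finally show "(\<integral>\<^sup>+t\<in>{t0<..<T}. (\<integral>\<^sup>+x. ennreal (max 0 (U t - u t x) * decay (p / 2) x) \<partial>lborel) \<partial>lborel) < \<infinity>" .
  qed
  have "?w t x \<le> 0"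
  proof (rule W.subsolution_nonpos[OF _ t])
    fix r \<eta> :: real assume \<eta>: "0 < \<eta>"
    let ?K = "{t0..t0 + 1} \<times> cball (0 :: real ^ 'n) r"
    have "continuous_on ?K (\<lambda>(t, x). U t - u t x)" by (rule continuous_on_subset[OF gap_cont]) (use t0 in auto)
    then have "uniformly_continuous_on ?K (\<lambda>(t, x). U t - u t x)"
      by (rule compact_uniformly_continuous) (intro compact_Times compact_Icc compact_cball)
    then obtain d where d: "d > 0" "\<And>q q'. q \<in> ?K \<Longrightarrow> q' \<in> ?K \<Longrightarrow> dist q' q < d \<Longrightarrow>
        dist (case q' of (t, x) \<Rightarrow> U t - u t x) (case q of (t, x) \<Rightarrow> U t - u t x) < \<eta>"
      using \<eta> unfolding uniformly_continuous_on_def by meson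
    define t' where "t' = t0 + min 1 (d / 2)"
    have "U t - u t x \<le> \<eta>" if "t0 < t" "t \<le> t'" "norm x \<le> r" for t x
    proof -
      have "(t0, x) \<in> ?K" "(t, x) \<in> ?K" using that by (auto simp: t'_def)
      moreover have "dist (t, x) (t0, x) < d" using that d(1) by (simp add: dist_Pair_Pair dist_real_def t'_def)
      ultimately have "dist (U t - u t x) (U t0 - u t0 x) < \<eta>" using d(2) by fastforce
      then show ?thesis by (simp add: contact dist_real_def)
    qed
    moreover have "t' > t0" using d(1) by (simp add: t'_def)
    ultimately show "\<exists>t'>t0. \<forall>t x. t0 < t \<longrightarrow> t \<le> t' \<longrightarrow> norm x \<le> r \<longrightarrow> U t - u t x \<le> \<eta>" by blast
  qed
  then show ?thesis using u_le_U[of t x] t0 t by simp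
qed

lemma trunc_gen_bump_solution:
  obtains K h0 where "K \<ge> 0" "h0 > 0"
    "\<And>h (x :: real ^ 'n). 0 < h \<Longrightarrow> h \<le> h0 \<Longrightarrow> norm x < 1 \<Longrightarrow> - trunc_gen p h bump x \<le> K * bump x"
  using trunc_gen_bump[OF p_bounds(1,2)] by blast

text \<open>The largest multiple of the barrier \<open>bump x * E t\<close> below the gap
  \<open>m\<close> touches it at a maximum of the ratio. If this happened after \<open>t1\<close>,
  the equation at the touching point would give \<open>lam \<le> c * K + C\<close>. So it happens at
  \<open>t1\<close>, where the multiple is at least \<open>\<mu>\<close>.\<close>

lemma gap_lower_bound:
  assumes t1: "0 < t1" "t1 < t2" and pos: "\<And>t x. t1 \<le> t \<Longrightarrow> t \<le> t2 \<Longrightarrow> u t x < U t"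
    and C: "\<And>t x. t1 \<le> t \<Longrightarrow> t \<le> t2 \<Longrightarrow> norm x \<le> 1 \<Longrightarrow> t powr \<beta> * (g (U t) - g (u t x)) \<le> C * (U t - u t x)"
    and K: "h0 > 0" "\<And>h (x :: real ^ 'n). 0 < h \<Longrightarrow> h \<le> h0 \<Longrightarrow> norm x < 1 \<Longrightarrow> - trunc_gen p h bump x \<le> K * bump x"
    and \<mu>: "\<mu> > 0" "\<And>x. norm x \<le> 1 \<Longrightarrow> \<mu> \<le> U t1 - u t1 x"
    and lam: "lam > c * K + C"
  shows "\<mu> * exp (- lam * (t2 - t1)) \<le> U t2 - u t2 0"
proof -
  define m where "m t x = U t - u t x" for t x
  define E where "E t = exp (- lam * (t - t1))" for t
  have mpos: "m t x > 0" if "t1 \<le> t" "t \<le> t2" for t x using pos[OF that] by (simp add: m_def)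
  let ?K = "{t1..t2} \<times> cball (0 :: real ^ 'n) 1"
  have mc: "continuous_on ?K (\<lambda>q. m (fst q) (snd q))"
  proof -
    have "continuous_on ?K (\<lambda>(t, x). U t - u t x)" by (rule continuous_on_subset[OF gap_cont]) (use t1 in auto)
    then show ?thesis by (simp add: m_def split_def)
  qed
  have ratio: "continuous_on ?K (\<lambda>q. bump (snd q) * E (fst q) / m (fst q) (snd q))"
    unfolding bump_def E_def
  proof (intro continuous_intros mc ballI)
    fix q assume "q \<in> ?K"
    then have "m (fst q) (snd q) > 0" by (intro mpos) auto
    then show "m (fst q) (snd q) \<noteq> 0" by simp
  qed
  have "compact ?K" by (intro compact_Times compact_Icc compact_cball)
  moreover have "?K \<noteq> {}" using t1 by auto
  ultimately obtain q where q: "q \<in> ?K"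
    "\<And>q'. q' \<in> ?K \<Longrightarrow> bump (snd q') * E (fst q') / m (fst q') (snd q') \<le> bump (snd q) * E (fst q) / m (fst q) (snd q)"
    using continuous_attains_sup[OF _ _ ratio] by blast
  obtain t x where tx: "q = (t, x)" by (cases q)
  define Q where "Q = bump x * E t / m t x"
  have t: "t1 \<le> t" "t \<le> t2" and x: "norm x \<le> 1" using q(1) by (auto simp: tx)
  have Qmax: "bump y * E \<tau> / m \<tau> y \<le> Q" if "t1 \<le> \<tau>" "\<tau> \<le> t2" "norm y \<le> 1" for \<tau> y
    using q(2)[of "(\<tau>, y)"] that by (simp add: tx Q_def)
  have "0 < bump (0 :: real ^ 'n) * E t1 / m t1 0"
    using mpos[of t1 0] t1 by (simp add: bump_def E_def)
  also have "\<dots> \<le> Q" by (rule Qmax) (use t1 in auto)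
  finally have Q: "Q > 0" .
  \<comment> \<open>Outside the unit ball the barrier vanishes and the gap is positive. The ordering
    is thus global in space, as comparing nonlocal operators requires.\<close>
  have below: "bump y * E \<tau> / Q \<le> m \<tau> y" if "t1 \<le> \<tau>" "\<tau> \<le> t2" for \<tau> y
  proof (cases "norm y \<le> 1")
    case True
    then show ?thesis using Qmax[OF that True] mpos[OF that, of y] Q by (simp add: pos_divide_le_eq mult.commute)
  next
    case False
    then show ?thesis using mpos[OF that, of y] by (simp add: bump_zero less_imp_le)
  qed
  have "m t x * Q = bump x * E t" using mpos[OF t, of x] by (simp add: Q_def)
  then have touch: "m t x = bump x * E t / Q" using Q by (simp add: eq_divide_eq)
  have "bump x \<noteq> 0" using Q by (auto simp: Q_def)
  then have bx: "bump x > 0" "norm x < 1" using bump_bounds(1)[of x] bump_pos_iff[of x] by auto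
  have "t = t1"
  proof (rule ccontr)
    assume "t \<noteq> t1"
    then have t': "t1 < t" "0 < t" using t t1 by auto
    obtain D L where DL: "((\<lambda>\<tau>. u \<tau> x) has_real_derivative D) (at t)"
      "\<forall>h>0. integrable lborel (\<lambda>z. (u t (x + z) - u t x) * cut_kernel p h z)"
      "((\<lambda>h. - (c * trunc_gen p h (u t) x)) \<longlongrightarrow> L) (at_right 0)"
      "D + L + t powr \<beta> * g (u t x) = 0"
      using equation[OF t'(2), of x] by blast
    \<comment> \<open>At the touching point every increment of the gap dominates that of the scaled
      barrier; \<open>U\<close> is constant in space, so the increments of the gap are those of
      \<open>- u\<close>.\<close>
    have L: "L \<ge> - (c * K * m t x)"
    proof (rule tendsto_lowerbound[OF DL(3)])
      have "\<forall>\<^sub>F h in at_right 0. 0 < h \<and> h < h0" unfolding eventually_at_right_field using K(1) by blast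
      then show "\<forall>\<^sub>F h in at_right 0. - (c * K * m t x) \<le> - (c * trunc_gen p h (u t) x)"
      proof eventually_elim
        case (elim h)
        then have h: "0 < h" "h \<le> h0" by auto
        have "E t / Q * trunc_gen p h bump x = (LINT z|lborel. E t / Q * ((bump (x + z) - bump x) * cut_kernel p h z))"
          by (simp add: trunc_gen_def)
        also have "\<dots> \<le> (LINT z|lborel. - ((u t (x + z) - u t x) * cut_kernel p h z))"
        proof (rule Bochner_Integration.integral_mono)
          show "integrable lborel (\<lambda>z. E t / Q * ((bump (x + z) - bump x) * cut_kernel p h z))"
            using integrable_trunc_gen[OF p_bounds(1) bump_measurable bump_bounds(3) h(1), of x] by simp
          show "integrable lborel (\<lambda>z. - ((u t (x + z) - u t x) * cut_kernel p h z))"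
            using DL(2) h(1) by simp
          fix z
          have "E t / Q * (bump (x + z) - bump x) \<le> m t (x + z) - m t x"
            using below[OF t, of "x + z"] touch by (simp add: algebra_simps)
          also have "\<dots> = - (u t (x + z) - u t x)" by (simp add: m_def)
          finally show "E t / Q * ((bump (x + z) - bump x) * cut_kernel p h z) \<le> - ((u t (x + z) - u t x) * cut_kernel p h z)"
            using mult_right_mono[OF _ cut_kernel_nonneg[of p h z]] by (metis minus_mult_left mult.assoc)
        qed
        also have "\<dots> = - trunc_gen p h (u t) x" by (simp add: trunc_gen_def)
        finally have 1: "E t / Q * trunc_gen p h bump x \<le> - trunc_gen p h (u t) x" .
        have "E t / Q * (- trunc_gen p h bump x) \<le> E t / Q * (K * bump x)"
          using K(2)[OF h bx(2)] Q by (intro mult_left_mono) (auto simp: E_def)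
        also have "\<dots> = K * m t x" by (simp add: touch)
        finally have "trunc_gen p h (u t) x \<le> K * m t x" using 1 by simp
        then show ?case using c_pos by (simp add: mult.assoc mult_left_mono)
      qed
    qed simp
    define f where "f \<tau> = m \<tau> x - bump x * E \<tau> / Q" for \<tau>
    define l where "l = - (t powr \<beta> * g (U t)) - D + lam * (bump x * E t / Q)"
    have "(E has_real_derivative - lam * E t) (at t)"
      unfolding E_def by (auto intro!: derivative_eq_intros)
    from DERIV_diff[OF DERIV_diff[OF U_deriv[OF t'(2)] DL(1)] DERIV_cdivide[OF DERIV_cmult[OF this, of "bump x"], of Q]]
    have fd: "(f has_real_derivative l) (at t)"
      by (simp add: f_def[abs_def] m_def l_def mult.left_commute)
    \<comment> \<open>Only times before \<open>t\<close> are compared, since \<open>t\<close> may be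
      the final time \<open>t2\<close>.\<close>
    have "l \<le> 0"
    proof (rule ccontr)
      assume "\<not> l \<le> 0"
      then obtain d where d: "d > 0" "\<And>h. 0 < h \<Longrightarrow> h < d \<Longrightarrow> f (t - h) < f t"
        using DERIV_pos_inc_left[OF fd] by (metis not_le)
      define h where "h = min (d / 2) (t - t1)"
      have h: "0 < h" "h < d" "h \<le> t - t1" using d(1) t' by (auto simp: h_def)
      have "f (t - h) < 0" using d(2)[OF h(1,2)] touch by (simp add: f_def)
      moreover have "f (t - h) \<ge> 0" using below[of "t - h" x] h t by (simp add: f_def)
      ultimately show False by simp
    qed
    then have "- (t powr \<beta> * g (U t)) - D + lam * m t x \<le> 0" by (simp add: l_def touch)
    moreover have "t powr \<beta> * (g (U t) - g (u t x)) \<le> C * m t x" using C[OF t x] by (simp add: m_def)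
    then have "t powr \<beta> * g (U t) - t powr \<beta> * g (u t x) \<le> C * m t x" by (simp add: right_diff_distrib)
    ultimately have "lam * m t x \<le> c * K * m t x + C * m t x" using DL(4) L by linarith
    then have "lam * m t x \<le> (c * K + C) * m t x" by (simp add: distrib_right)
    then show False using mpos[OF t, of x] lam by simp
  qed
  then have "Q = bump x / m t1 x" by (simp add: Q_def E_def)
  also have "\<dots> \<le> 1 / \<mu>" using bump_bounds[of x] \<mu>(1) \<mu>(2)[OF x] by (intro frac_le) (auto simp: m_def)
  finally have "1 / Q \<ge> \<mu>" using Q \<mu>(1) by (simp add: field_simps)
  then have "\<mu> * E t2 \<le> 1 / Q * E t2" by (intro mult_right_mono) (auto simp: E_def)
  also have "\<dots> = bump (0 :: real ^ 'n) * E t2 / Q" by (simp add: bump_def)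
  also have "\<dots> \<le> m t2 0" by (rule below) (use t1 in auto)
  finally show ?thesis by (simp add: E_def m_def)
qed

text \<open>If contact failed at time \<open>t\<close>, there would be a first contact time
  \<open>ts\<close> after it. Before \<open>ts\<close> the gap is positive everywhere, and the
  barrier bounds it below at the origin by a positive number independent of how close to
  \<open>ts\<close> one gets; continuity then contradicts contact at \<open>ts\<close>.\<close>

lemma contact_backward:
  assumes t: "0 < t" "t < t0" and contact: "u t0 0 = U t0"
  shows "u t x = U t"
proof (rule ccontr)
  assume "u t x \<noteq> U t"
  then have ne: "u t y \<noteq> U t" for y using contact_propagates[OF t(1), of y x] by auto
  have gap0: "continuous_on {t..t0} (\<lambda>\<tau>. U \<tau> - u \<tau> 0)"
  proof -
    have "continuous_on {t..t0} (\<lambda>\<tau>. case (\<tau>, 0) of (t, x) \<Rightarrow> U t - u t x)"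
      by (rule continuous_on_compose2[OF gap_cont]) (use t in \<open>auto intro!: continuous_intros\<close>)
    then show ?thesis by simp
  qed
  define Z where "Z = {\<tau> \<in> {t..t0}. U \<tau> - u \<tau> 0 = 0}"
  have "closed Z" unfolding Z_def
    using continuous_closed_preimage_constant[OF gap0, of 0] by simp
  have Zne: "t0 \<in> Z" using contact t by (simp add: Z_def)
  have bdd: "bdd_below Z" by (auto simp: Z_def intro!: bdd_belowI[of _ t])
  define ts where "ts = Inf Z"
  have tsZ: "ts \<in> Z" unfolding ts_def using closed_contains_Inf[OF _ bdd \<open>closed Z\<close>] Zne by auto
  then have ts: "t < ts" "ts \<le> t0" "u ts 0 = U ts" using ne[of 0] by (auto simp: Z_def order.strict_iff_order)
  have ts0: "0 < ts" using t ts by simp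
  have all_ts: "u ts y = U ts" for y by (rule contact_propagates[OF ts0 ts(3)])
  have before: "u \<tau> y < U \<tau>" if "t \<le> \<tau>" "\<tau> < ts" for \<tau> y
  proof -
    have \<tau>: "0 < \<tau>" using that t by simp
    have "\<tau> \<notin> Z" using that cInf_lower[OF _ bdd, of \<tau>] by (auto simp: ts_def)
    then have "u \<tau> 0 \<noteq> U \<tau>" using that ts by (auto simp: Z_def)
    then have "u \<tau> y \<noteq> U \<tau>" using contact_propagates[OF \<tau>, of y 0] by auto
    then show ?thesis using u_le_U[OF \<tau>, of y] by simp
  qed
  obtain d Lg where lip: "d > 0" "Lg-lipschitz_on (cball (U ts) d) g" using g_lip by blast
  have Lg: "Lg \<ge> 0" using lip(2) lipschitz_on_nonneg by blast
  let ?K = "{t..ts} \<times> cball (0 :: real ^ 'n) 1"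
  have uK: "uniformly_continuous_on ?K (\<lambda>(t, x). u t x)"
    by (intro compact_uniformly_continuous compact_Times compact_Icc compact_cball continuous_on_subset[OF u_cont])
      (use t in auto)
  then obtain e1 where e1: "e1 > 0" "\<And>q q'. q \<in> ?K \<Longrightarrow> q' \<in> ?K \<Longrightarrow> dist q' q < e1 \<Longrightarrow>
      dist (case q' of (t, x) \<Rightarrow> u t x) (case q of (t, x) \<Rightarrow> u t x) < d"
    using lip(1) unfolding uniformly_continuous_on_def by meson
  have "isCont U ts" by (rule DERIV_isCont[OF U_deriv[OF ts0]])
  then obtain e2 where e2: "e2 > 0" "\<And>\<tau>. dist \<tau> ts < e2 \<Longrightarrow> dist (U \<tau>) (U ts) < d"
    using lip(1) unfolding continuous_at_eps_delta by meson
  \<comment> \<open>So close to \<open>ts\<close> that on the unit ball both \<open>u\<close> and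
    \<open>U\<close> stay in the neighbourhood of \<open>U ts\<close> where \<open>g\<close> is
    Lipschitz.\<close>
  define t1 where "t1 = max t (ts - min e1 e2 / 2)"
  have t1: "t \<le> t1" "t1 < ts" "0 < t1" using t ts e1(1) e2(1) by (auto simp: t1_def)
  have near: "dist (u \<tau> y) (U ts) \<le> d" "dist (U \<tau>) (U ts) \<le> d" if "t1 \<le> \<tau>" "\<tau> \<le> ts" "norm y \<le> 1" for \<tau> y
  proof -
    have \<tau>: "\<bar>\<tau> - ts\<bar> < e1" "\<bar>\<tau> - ts\<bar> < e2" using that e1(1) e2(1) by (auto simp: t1_def)
    have "dist (\<tau>, y) (ts, y) < e1" using \<tau> by (simp add: dist_Pair_Pair dist_real_def)
    moreover have "(\<tau>, y) \<in> ?K" "(ts, y) \<in> ?K" using that t1 ts by auto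
    ultimately have "dist (u \<tau> y) (u ts y) < d" using e1(2) by fastforce
    then show "dist (u \<tau> y) (U ts) \<le> d" by (simp add: all_ts)
    show "dist (U \<tau>) (U ts) \<le> d" using e2(2)[of \<tau>] \<tau>(2) by (simp add: dist_real_def)
  qed
  \<comment> \<open>The power is monotone in time, in a direction that depends on the sign of
    \<open>\<beta>\<close>; the sum of the end values covers both cases.\<close>
  define P where "P = t1 powr \<beta> + ts powr \<beta>"
  have P: "\<tau> powr \<beta> \<le> P" if "t1 \<le> \<tau>" "\<tau> \<le> ts" for \<tau>
  proof (cases "\<beta> \<ge> 0")
    case True
    then have "\<tau> powr \<beta> \<le> ts powr \<beta>" using that t1 by (intro powr_mono2) auto
    then show ?thesis by (simp add: P_def add_increasing)
  next
    case False
    then have "\<tau> powr \<beta> \<le> t1 powr \<beta>" using that t1 by (intro powr_mono2') auto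
    then show ?thesis by (simp add: P_def add_increasing2)
  qed
  have C: "\<tau> powr \<beta> * (g (U \<tau>) - g (u \<tau> y)) \<le> P * Lg * (U \<tau> - u \<tau> y)"
    if "t1 \<le> \<tau>" "\<tau> \<le> ts" "norm y \<le> 1" for \<tau> y
  proof -
    have \<tau>: "0 < \<tau>" using that t1 by simp
    have "dist (g (U \<tau>)) (g (u \<tau> y)) \<le> Lg * dist (U \<tau>) (u \<tau> y)"
      using near[OF that] by (intro lipschitz_onD[OF lip(2)]) (auto simp: dist_commute)
    then have "g (U \<tau>) - g (u \<tau> y) \<le> Lg * (U \<tau> - u \<tau> y)"
      using u_le_U[OF \<tau>, of y] by (simp add: dist_real_def)
    moreover have "0 \<le> g (U \<tau>) - g (u \<tau> y)" using monoD[OF g_mono u_le_U[OF \<tau>, of y]] by simp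
    ultimately have "\<tau> powr \<beta> * (g (U \<tau>) - g (u \<tau> y)) \<le> P * (Lg * (U \<tau> - u \<tau> y))"
      using P[OF that(1,2)] by (intro mult_mono) (auto simp: P_def)
    then show ?thesis by (simp add: mult.assoc)
  qed
  obtain K h0 where K: "h0 > 0" "\<And>h (x :: real ^ 'n). 0 < h \<Longrightarrow> h \<le> h0 \<Longrightarrow> norm x < 1 \<Longrightarrow> - trunc_gen p h bump x \<le> K * bump x"
    by (rule trunc_gen_bump_solution) blast
  have "continuous_on (cball 0 1) (\<lambda>y. U t1 - u t1 y)"
    by (intro continuous_intros continuous_on_subset[OF u_cont_x[OF t1(3)]]) simp
  then obtain y0 where "\<forall>y\<in>cball 0 1. U t1 - u t1 y0 \<le> U t1 - u t1 y"
    using continuous_attains_inf[of "cball (0 :: real ^ 'n) 1" "\<lambda>y. U t1 - u t1 y"] by auto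
  then have y0: "U t1 - u t1 y0 \<le> U t1 - u t1 y" if "norm y \<le> 1" for y using that by simp
  define \<mu> where "\<mu> = U t1 - u t1 y0"
  have \<mu>: "\<mu> > 0" using before[OF t1(1,2), of y0] by (simp add: \<mu>_def)
  \<comment> \<open>The absolute value also makes \<open>lam\<close> positive, so the exponential
    may be evaluated at \<open>ts\<close> instead of \<open>t2\<close>, which gives the uniform
    bound.\<close>
  define lam where "lam = \<bar>c * K + P * Lg\<bar> + 1"
  have lam: "lam > c * K + P * Lg" "lam > 0" by (auto simp: lam_def)
  have low: "\<mu> * exp (- lam * (ts - t1)) \<le> U t2 - u t2 0" if t2: "t1 < t2" "t2 < ts" for t2
  proof -
    have "\<mu> * exp (- lam * (ts - t1)) \<le> \<mu> * exp (- lam * (t2 - t1))"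
      using \<mu> lam(2) t2 by (intro mult_left_mono) auto
    also have "\<dots> \<le> U t2 - u t2 0"
    proof (rule gap_lower_bound[OF t1(3) t2(1) _ _ K \<mu> _ lam(1)])
      show "u \<tau> y < U \<tau>" if "t1 \<le> \<tau>" "\<tau> \<le> t2" for \<tau> y using before that t1 t2 by simp
      show "\<mu> \<le> U t1 - u t1 y" if "norm y \<le> 1" for y using y0[OF that] by (simp add: \<mu>_def)
      show "\<tau> powr \<beta> * (g (U \<tau>) - g (u \<tau> y)) \<le> P * Lg * (U \<tau> - u \<tau> y)"
        if "t1 \<le> \<tau>" "\<tau> \<le> t2" "norm y \<le> 1" for \<tau> y using C that t2 by simp
    qed
    finally show ?thesis .
  qed
  have "((\<lambda>\<tau>. U \<tau> - u \<tau> 0) \<longlongrightarrow> U ts - u ts 0) (at_left ts)"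
  proof -
    have "((\<lambda>\<tau>. U \<tau> - u \<tau> 0) \<longlongrightarrow> U ts - u ts 0) (at ts within {t..t0})"
    proof -
      have "ts \<in> {t..t0}" using ts by simp
      then show ?thesis using gap0 unfolding continuous_on by blast
    qed
    then have "((\<lambda>\<tau>. U \<tau> - u \<tau> 0) \<longlongrightarrow> U ts - u ts 0) (at ts within {t..ts})"
      by (rule tendsto_within_subset) (use ts in auto)
    then show ?thesis using at_within_Icc_at_left[OF ts(1)] by simp
  qed
  moreover have "\<forall>\<^sub>F \<tau> in at_left ts. \<mu> * exp (- lam * (ts - t1)) \<le> U \<tau> - u \<tau> 0"
    unfolding eventually_at_left_field using low t1(2) by blast
  ultimately have "\<mu> * exp (- lam * (ts - t1)) \<le> U ts - u ts 0"
    by (intro tendsto_lowerbound) auto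
  moreover have "0 < \<mu> * exp (- lam * (ts - t1))" using \<mu> by simp
  ultimately show False using ts(3) by linarith
qed

lemma dichotomy: "(\<forall>t>0. \<forall>x. u t x < U t) \<or> (\<forall>t>0. \<forall>x. u t x = U t)"
proof (cases "\<exists>t>0. \<exists>x. u t x = U t")
  case True
  then obtain t0 x0 where t0: "t0 > 0" "u t0 x0 = U t0" by blast
  have all: "u t0 x = U t0" for x by (rule contact_propagates[OF t0])
  have "u t x = U t" if "t > 0" for t x
    using contact_backward[OF that _ all] contact_forward[OF t0(1) all] all
    by (cases t t0 rule: linorder_cases) auto
  then show ?thesis by blast
next
  case False
  then show ?thesis using u_le_U by (metis order.not_eq_order_implies_strict)
qed

end

theorem theoremE:
  fixes s \<beta> :: real
    and g :: "real \<Rightarrow> real"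
    and u :: "real \<Rightarrow> real ^ 'n \<Rightarrow> real"
  assumes "0 < s" "s < 1" "\<beta> > -1"
    and "\<And>r. g r \<ge> 0"
    and "mono g"
    and "\<And>r. \<exists>d>0. \<exists>L. L-lipschitz_on (cball r d) g"
    and "\<And>r. g r * r \<ge> 0"
    and "\<And>r. r > 0 \<Longrightarrow> recip_tail g r < \<infinity>"
    and "\<And>t x. t > 0 \<Longrightarrow> u t x \<ge> 0"
    and "classical_solution s \<beta> g u"
    and "L1_loc_frac_space s u"
  shows "(\<forall>t>0. \<forall>x. u t x < flat_sol g \<beta> t) \<or> (\<forall>t>0. \<forall>x. u t x = flat_sol g \<beta> t)"
proof -
  interpret absorption_solution g s \<beta> u
    using assms by unfold_locales
  show ?thesis using dichotomy flat_sol_eq[OF assms(3)] by simp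
qed

end
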